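(* Let $n\ge1$ and $0\le M\le n-1$ be integers and let $\kappa$ be a complex number with $|\Re(\kappa)|<\frac{M+1}{3}$. Then $$B_n(\kappa)=\frac{2}{3\pi(12\pi)^{\frac n3}}\left(\sum_{m=0}^{M-1}(12\pi)^{\frac m3}B_m(\kappa)\sin\left(\frac{(m+1)\pi}{3}\right)\Gamma\left(\frac{m+1}{3}\right)\frac{\Gamma\left(\frac{n-m}{3}\right)}{\Gamma\left(\frac{n+1}{3}\right)}\cos\left(2\pi\kappa-\frac{\pi}{2}(n+m)\right)+A_M(n,\kappa)\right),$$ where $$A_M(n,\kappa)=\frac{3\pi(2\pi)^{\frac n3}}{6^{\frac13}\,4\,\Gamma\left(\frac{n+1}{3}\right)}\int_0^{+\infty}t^{\frac{n-2}{3}}e^{-2\pi t}\,i\left(e^{(2\pi\kappa-\frac{\pi}{2}n)i}R_M^{(H)}(it,-\kappa)+e^{-(2\pi\kappa-\frac{\pi}{2}n)i}R_M^{(H)}(it,\kappa)\right)dt,$$ and, for fixed $\kappa$ and $M$, $$A_M(n,\kappa)=\mathcal O_{\kappa,M}\left(\frac{\Gamma\left(\frac{n-M}{3}\right)}{\Gamma\left(\frac{n+1}{3}\right)}\right)\qquad(n\to+\infty).$$ Consequently, for every fixed complex $\kappa$, as $n\to+\infty$, $$B_n(\kappa)\sim\frac{2}{3\pi(12\pi)^{\frac n3}}\sum_{m=0}^{\infty}(12\pi)^{\frac m3}B_m(\kappa)\sin\left(\frac{(m+1)\pi}{3}\right)\Gamma\left(\frac{m+1}{3}\right)\frac{\G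amma\left(\frac{n-m}{3}\right)}{\Gamma\left(\frac{n+1}{3}\right)}\cos\left(2\pi\kappa-\frac{\pi}{2}(n+m)\right).$$
   Context: The polynomials $B_n(\kappa)$ are $$B_n(\kappa)=\frac{1}{n!}\left[\frac{d^n}{dt^n}\left(e^{\kappa t}\left(\frac16\frac{t^3}{\sinh t-t}\right)^{\frac{n+1}{3}}\right)\right]_{t=0},$$ the power being the branch equal to $1$ at $t=0$. $R_M^{(H)}(z,\kappa)$ is the remainder in the expansion of the Hankel function $H^{(1)}_{z-\kappa}(z)$, i.e. $$R_M^{(H)}(z,\kappa)=H_{z-\kappa}^{(1)}(z)+\frac{2}{3\pi}\sum_{m=0}^{M-1}6^{\frac{m+1}{3}}B_m(\kappa)e^{\frac{2(m+1)\pi i}{3}}\sin\left(\frac{(m+1)\pi}{3}\right)\frac{\Gamma\left(\frac{m+1}{3}\right)}{z^{\frac{m+1}{3}}},$$ with $z^{1/3}=|z|^{1/3}e^{i(\arg z)/3}$ and $\arg(it)=\frac{\pi}{2}$ for $t>0$. The final infinite (inverse factorial) series is an asymptotic expansion with respect to the scale $\Gamma(\frac{n-m}{3})/\Gamma(\frac{n+1}{3})$: for each fixed $M\ge0$, truncating the sum after the term $m=M-1$ gives an error $\mathcal O_{\kappa,M}\left((12\pi)^{-n/3}\Gamma(\frac{n-M}{3})/\Gamma(\frac{n+1}{3})\right)$. Subscripts on $\mathcal O$ indicate the dependence of the implied constant. Empty sums are zero. *)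

theory Defs
  imports "HOL-Analysis.Analysis" "HOL-Library.Landau_Symbols"
begin

(* The base has a removable singularity at 0, where it is given its limit 1; hence near 0 the
   principal power below is the branch that equals 1 at 0. *)
definition B_base :: "complex \<Rightarrow> complex" where
  "B_base t = (if t = 0 then 1 else (1 / 6) * (t ^ 3 / (sinh t - t)))"

definition B :: "nat \<Rightarrow> complex \<Rightarrow> complex" where
  "B n \<kappa> = 1 / fact n *
     (deriv ^^ n) (\<lambda>t. exp (\<kappa> * t) * B_base t powr (of_nat (n + 1) / 3)) 0"

(* Principal branch in z, complex order. The entire function rGamma makes the terms with
   1 / Gamma at a pole vanish. *)
definition bessel_J :: "complex \<Rightarrow> complex \<Rightarrow> complex" where
  "bessel_J \<nu> z = (z / 2) powr \<nu> *
     (\<Sum>k. (- 1) ^ k * (z\<^sup>2 / 4) ^ k / fact k * rGamma (\<nu> + of_nat k + 1))"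

definition bessel_Y_quot :: "complex \<Rightarrow> complex \<Rightarrow> complex" where
  "bessel_Y_quot \<nu> z =
     (bessel_J \<nu> z * cos (\<nu> * of_real pi) - bessel_J (- \<nu>) z) / sin (\<nu> * of_real pi)"

(* At integer orders the quotient is 0 / 0 and is replaced by its limit in the order. *)
definition bessel_Y :: "complex \<Rightarrow> complex \<Rightarrow> complex" where
  "bessel_Y \<nu> z =
     (if \<nu> \<in> \<int> then Lim (at \<nu>) (\<lambda>\<mu>. bessel_Y_quot \<mu> z) else bessel_Y_quot \<nu> z)"

definition hankel1 :: "complex \<Rightarrow> complex \<Rightarrow> complex" where
  "hankel1 \<nu> z = bessel_J \<nu> z + \<i> * bessel_Y \<nu> z"

(* The principal power gives z = i t, t > 0, the argument pi / 2. *)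
definition R_H :: "nat \<Rightarrow> complex \<Rightarrow> complex \<Rightarrow> complex" where
  "R_H M z \<kappa> = hankel1 (z - \<kappa>) z + of_real (2 / (3 * pi)) *
     (\<Sum>m<M. of_real (6 powr (real (m + 1) / 3)) * B m \<kappa>
        * exp (of_real (2 * real (m + 1) * pi / 3) * \<i>)
        * of_real (sin (real (m + 1) * pi / 3))
        * (of_real (Gamma (real (m + 1) / 3)) / z powr (of_nat (m + 1) / 3)))"

definition A_integrand :: "nat \<Rightarrow> nat \<Rightarrow> complex \<Rightarrow> real \<Rightarrow> complex" where
  "A_integrand M n \<kappa> t =
     of_real (t powr ((real n - 2) / 3) * exp (- 2 * pi * t)) * \<i> *
       (exp ((of_real (2 * pi) * \<kappa> - of_real (pi / 2 * real n)) * \<i>)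
           * R_H M (\<i> * of_real t) (- \<kappa>)
        + exp (- (of_real (2 * pi) * \<kappa> - of_real (pi / 2 * real n)) * \<i>)
           * R_H M (\<i> * of_real t) \<kappa>)"

definition A :: "nat \<Rightarrow> nat \<Rightarrow> complex \<Rightarrow> complex" where
  "A M n \<kappa> =
     of_real (3 * pi * (2 * pi) powr (real n / 3)
              / (6 powr (1 / 3) * 4 * Gamma (real (n + 1) / 3)))
     * (LINT t:{0<..}|lborel. A_integrand M n \<kappa> t)"

(* Only used for n > m, or for n tending to infinity; real subtraction, so no truncation. *)
definition Gamma_ratio :: "nat \<Rightarrow> nat \<Rightarrow> real" where
  "Gamma_ratio n m = Gamma ((real n - real m) / 3) / Gamma (real (n + 1) / 3)"

definition B_term :: "nat \<Rightarrow> complex \<Rightarrow> nat \<Rightarrow> complex" where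
  "B_term n \<kappa> m =
     of_real ((12 * pi) powr (real m / 3)) * B m \<kappa>
     * of_real (sin (real (m + 1) * pi / 3)) * of_real (Gamma (real (m + 1) / 3))
     * of_real (Gamma_ratio n m)
     * cos (of_real (2 * pi) * \<kappa> - of_real (pi / 2 * (real n + real m)))"

definition B_prefactor :: "nat \<Rightarrow> real" where
  "B_prefactor n = 2 / (3 * pi * (12 * pi) powr (real n / 3))"

end

theory Submission
  imports Defs "HOL-Complex_Analysis.Complex_Analysis" "HOL-Real_Asymp.Real_Asymp"
begin

text \<open>
  Let \<open>W\<close> be the branch of \<open>(6 (sinh t - t)) powr (1 / 3)\<close> in the strip \<open>\<bar>Im t\<bar> < 2 \<pi>\<close> with
  \<open>W' 0 = 1\<close>. Since \<open>sinh t - t\<close> has no zero in the strip except the triple zero \<open>t = 0\<close>,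
  \<open>B n \<kappa>\<close> is the residue of \<open>exp (\<kappa> t) / W t ^ (n + 1)\<close> at \<open>0\<close>, and moving the contour to
  the lines \<open>Im t = \<plusminus> 3 \<pi> / 2\<close> gives two integrals of powers of \<open>3 \<pi> / 2 + cosh x \<mp> \<i> x\<close>. Writing
  these powers as Gamma integrals over \<open>t > 0\<close> and exchanging the integrations produces the
  Schlaefli integrals of the Hankel functions of orders \<open>\<i> t \<plusminus> \<kappa>\<close>, which is the formula for \<open>M = 0\<close>;
  the terms with \<open>m < M\<close> only rearrange it, because each is an elementary Gamma integral.
  By Lagrange inversion \<open>exp (\<kappa> u) = (\<Sum>m<N. B m \<kappa> * W u ^ m * W' u) + O(u ^ N)\<close>. Along the rays
  \<open>arg u = \<pi> / 6\<close> and \<open>arg u = 5 \<pi> / 6\<close> this turns the Schlaefli integral into the expansion of the Hankel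
  function with remainder \<open>O(t powr (- (M + 1) / 3))\<close>; for small \<open>t\<close> the same bound is
  elementary and is where \<open>\<bar>Re \<kappa>\<bar> < (M + 1) / 3\<close> enters.
\<close>

section \<open>Gamma integrals over a half plane\<close>


text \<open>The height 3 \<pi> / 2 meets two demands. There \<open>cos\<close> vanishes and
  \<open>sin\<close> is - 1, so \<open>sinh t - t\<close> is a unit times a number with real part
  \<open>3 * pi / 2 + cosh x > 0\<close>; at height \<pi> / 2 that part would be
  \<open>cosh x - pi / 2\<close>, negative near \<open>x = 0\<close>, and the Gamma integral would
  diverge. Moreover, 3 \<pi> / 2 differs from the term - \<pi> / 2 in the Schlaefli exponent by 2
  \<pi>, which is the source of the weight \<open>exp (- 2 * pi * t)\<close>. As the Hankel function
  is given by power series, its Schlaefli integral has to be derived: the real line is cut at 0,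
  each half is a series of incomplete Gamma functions, the Gamma parts sum to modified Bessel
  functions and the rest cancels between the halves. Integer orders, where Y is a limit, occur for
  at most two values of \<open>t\<close>, a null set. The exact formula assumes \<bar>Re
  \<kappa>\<bar> < (M + 1) / 3, while the final expansion holds for every \<kappa>: more terms than
  requested are split off, and the surplus is compared with the scale by monotonicity of Gamma on
  [2, \<infinity>).\<close>

lemma gamma_integral_scaled_pos:
  fixes z :: complex and c :: real
  assumes z: "Re z > 0" and c: "c > 0"
  shows "has_bochner_integral lborel
    (\<lambda>t. indicator {0<..} t *\<^sub>R (of_real t powr (z - 1) * exp (- of_real (c * t))))
    (Gamma z * of_real c powr (-z))"
proof -
  let ?f = "\<lambda>t. indicator {0<..} t *\<^sub>R (of_real t powr (z - 1) * exp (- complex_of_real t))"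
  have f_eq: "?f = (\<lambda>t. indicator {0<..} t *\<^sub>R (of_real t powr (z - 1) / of_real (exp t)))"
    by (auto simp: fun_eq_iff exp_minus exp_of_real field_simps)
  have meas: "?f \<in> borel_measurable lborel"
  proof -
    have "continuous_on {0<..} (\<lambda>t. of_real t powr (z - 1) * exp (- complex_of_real t))"
      by (intro continuous_intros) auto
    then show ?thesis
      using borel_measurable_continuous_on_indicator[of "{0<..}"] by simp
  qed
  have int: "integrable lebesgue ?f"
    using absolutely_integrable_Gamma_integral'[OF z] unfolding f_eq set_integrable_def .
  have int': "integrable lborel ?f"
    using int integrable_completion meas by blast
  have "integral\<^sup>L lborel ?f = integral\<^sup>L lebesgue ?f"
    using integral_completion meas by metis
  also have "\<dots> = (LINT t:{0<..}|lebesgue. (of_real t powr (z - 1) / of_real (exp t)))"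
    unfolding f_eq set_lebesgue_integral_def ..
  also have "\<dots> = Gamma z"
    using set_lebesgue_integral_eq_integral(2)[OF absolutely_integrable_Gamma_integral'[OF z]]
      Gamma_integral_complex'[OF z] by (simp add: integral_unique)
  finally have "has_bochner_integral lborel ?f (Gamma z)"
    using int' by (simp add: has_bochner_integral_iff)
  then have "has_bochner_integral lborel (\<lambda>t. ?f (0 + c * t)) (Gamma z /\<^sub>R \<bar>c\<bar>)"
    using c lborel_has_bochner_integral_real_affine_iff[of c ?f "Gamma z" 0] by simp
  then have *: "has_bochner_integral lborel
      (\<lambda>t. of_real c powr (1 - z) * ?f (0 + c * t)) (of_real c powr (1 - z) * (Gamma z /\<^sub>R \<bar>c\<bar>))"
    by (rule has_bochner_integral_mult_right)
  have 1: "of_real c powr (1 - z) * (Gamma z /\<^sub>R \<bar>c\<bar>) = Gamma z * of_real c powr (-z)"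
    using c by (simp add: powr_diff powr_minus field_simps scaleR_conv_of_real)
  have 2: "of_real c powr (1 - z) * ?f (0 + c * t)
     = indicator {0<..} t *\<^sub>R (of_real t powr (z - 1) * exp (- of_real (c * t)))" for t
  proof (cases "t > 0")
    case True
    have "of_real (c * t) powr (z - 1) = of_real c powr (z-1) * of_real t powr (z-1)"
      using True c by (simp add: powr_times_real)
    moreover have "of_real c powr (1 - z) * of_real c powr (z-1) = (1::complex)"
      using c by (simp add: powr_add[symmetric])
    ultimately show ?thesis using True c by (simp add: zero_less_mult_iff)
  qed (use c in \<open>auto simp: zero_less_mult_iff\<close>)
  show ?thesis using * unfolding 1 2 .
qed

text \<open>The case of real \<open>b\<close> extends to the half plane by expanding \<open>exp (- b t)\<close> around
  a large real point \<open>c\<close>, which turns the claim into the binomial series of \<open>b powr (- z)\<close>.\<close>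

lemma gamma_integral_complex_scaled:
  fixes z b :: complex
  assumes z: "Re z > 0" and b: "Re b > 0"
  shows "has_bochner_integral lborel
    (\<lambda>t. indicator {0<..} t *\<^sub>R (of_real t powr (z - 1) * exp (- (b * of_real t))))
    (Gamma z * b powr (-z))"
proof -
  \<comment> \<open>With this choice \<open>c * Re b\<close> is the squared norm of
    \<open>b\<close>, so the squared norm of \<open>c - b\<close> is that of \<open>c\<close> minus
    that of \<open>b\<close>. Hence \<open>norm d < c\<close>, the convergence condition of the
    binomial series around \<open>c\<close>.\<close>
  define c where "c = (norm b)\<^sup>2 / Re b"
  have b0: "b \<noteq> 0" using b by auto
  have c: "c > 0" using b b0 by (auto simp: c_def)
  define d where "d = of_real c - b"
  have "(norm d)\<^sup>2 = c\<^sup>2 - 2 * c * Re b + (norm b)\<^sup>2"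
    unfolding d_def cmod_power2 by (simp add: power2_eq_square algebra_simps)
  also have "\<dots> = c\<^sup>2 - (norm b)\<^sup>2" using b by (simp add: c_def)
  also have "\<dots> < c\<^sup>2" using b0 by simp
  finally have dc: "norm d < c" using c by (meson less_imp_le norm_ge_zero power2_less_imp_less)
  define f where "f = (\<lambda>(k::nat) t. indicator {0<..} t *\<^sub>R (of_real t powr (z - 1) * exp (- of_real (c * t)) * (d * of_real t)^k / fact k))"
  have hk: "has_bochner_integral lborel (f k) (d^k / fact k * (Gamma (z + of_nat k) * of_real c powr (-(z + of_nat k))))" for k
  proof -
    have "has_bochner_integral lborel (\<lambda>t. d^k / fact k * (indicator {0<..} t *\<^sub>R (of_real t powr ((z + of_nat k) - 1) * exp (- of_real (c * t))))) (d^k / fact k * (Gamma (z + of_nat k) * of_real c powr (-(z + of_nat k))))"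
      by (rule has_bochner_integral_mult_right, intro gamma_integral_scaled_pos) (use z c in auto)
    moreover have "d^k / fact k * (indicator {0<..} t *\<^sub>R (of_real t powr ((z + of_nat k) - 1) * exp (- of_real (c * t)))) = f k t" for t
    proof (cases "t > 0")
      case True
      have "of_real t powr ((z + of_nat k) - 1) = of_real t powr (z - 1) * complex_of_real t ^ k"
        using True by (simp add: powr_add powr_diff powr_nat')
      then show ?thesis using True by (simp add: f_def power_mult_distrib)
    qed (simp add: f_def)
    ultimately show ?thesis by simp
  qed
  have nf: "norm (f k t) = indicator {0<..} t *\<^sub>R (t powr (Re z - 1) * exp (- (c * t)) * (norm d * t)^k / fact k)" for k t
    by (cases "t > 0") (auto simp: f_def norm_mult norm_divide norm_power norm_powr_real_powr norm_exp_eq_Re)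
  have intf: "integrable lborel (f k)" for k
    using hk by (simp add: has_bochner_integral_iff)
  have hn: "(\<integral>t. norm (f k t) \<partial>lborel) = norm d^k / fact k * (Gamma (Re z + real k) * c powr (-(Re z+real k)))" for k
  proof -
    define F where "F = (\<lambda>t. indicator {0<..} t *\<^sub>R (of_real t powr ((of_real (Re z) + of_nat k) - 1) * exp (- complex_of_real (c * t))))"
    have "has_bochner_integral lborel F (Gamma (of_real (Re z) + of_nat k) * of_real c powr (-(of_real (Re z) + of_nat k)))"
      unfolding F_def by (intro gamma_integral_scaled_pos) (use z c in auto)
    then have "has_bochner_integral lborel (\<lambda>t. Re (F t)) (Re (Gamma (of_real (Re z) + of_nat k) * of_real c powr (-(of_real (Re z) + of_nat k))))"
      by (rule has_bochner_integral_Re)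
    also have "Gamma (of_real (Re z) + of_nat k) = complex_of_real (Gamma (Re z + real k))"
      using Gamma_complex_of_real[of "Re z + real k"] by simp
    also have "of_real c powr (-(of_real (Re z) + of_nat k)) = complex_of_real (c powr (-(Re z + real k)))"
      using c powr_of_real[of c "-(Re z + real k)"] by simp
    finally have "has_bochner_integral lborel (\<lambda>t. norm d^k / fact k * Re (F t)) (norm d^k / fact k * (Gamma (Re z + real k) * c powr (-(Re z+real k))))"
      by (intro has_bochner_integral_mult_right) simp
    moreover have "norm d^k / fact k * Re (F t) = norm (f k t)" for t
    proof (cases "t > 0")
      case True
      have "of_real t powr ((of_real (Re z) + of_nat k) - 1) = complex_of_real (t powr (Re z + real k - 1))"
        using True powr_of_real[of t "Re z + real k - 1"] by simp
      moreover have "exp (- complex_of_real (c * t)) = of_real (exp (- (c * t)))"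
        by (metis exp_of_real of_real_minus)
      ultimately have "F t = of_real (t powr (Re z + real k - 1) * exp (- (c * t)))"
        using True by (simp add: F_def)
      then have "Re (F t) = t powr (Re z + real k - 1) * exp (- (c * t))" by (simp only: Re_complex_of_real)
      moreover have "t powr (Re z + real k - 1) = t powr (Re z - 1) * t ^ k"
        using True by (metis add_diff_eq add.commute powr_add powr_realpow)
      ultimately show ?thesis using True by (simp add: nf power_mult_distrib)
    qed (simp add: nf F_def)
    ultimately show ?thesis by (simp only: has_bochner_integral_iff)
  qed
  have zk: "z \<notin> \<int>\<^sub>\<le>\<^sub>0" "Re z \<notin> \<int>\<^sub>\<le>\<^sub>0" using z
    by (auto elim!: nonpos_Ints_cases)
  \<comment> \<open>Turns the moments into binomial coefficients. It serves twice: with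
    \<open>z\<close> and \<open>d\<close> for the value of the integral, and with
    \<open>Re z\<close> and \<open>norm d\<close> for the integrals of the norms, whose series
    converges because \<open>norm d < c\<close> and so justifies termwise integration.\<close>
  have binom: "w^k / fact k * (Gamma (y + of_nat k) * x powr (-(y + of_nat k)))
      = Gamma y * x powr (-y) * (((-y) gchoose k) * (- (w / x))^k)"
    if "y \<notin> \<int>\<^sub>\<le>\<^sub>0" "x \<noteq> 0" for w y x :: complex and k
  proof -
    have "Gamma (y + of_nat k) = pochhammer y k * Gamma y"
      using pochhammer_Gamma[OF that(1), of k] that(1) by (simp add: Gamma_eq_zero_iff)
    moreover have "x powr (-(y + of_nat k)) = x powr (-y) / x ^ k"
      using that by (simp add: powr_diff powr_nat powr_minus field_simps powr_add)
    moreover have "(- (w / x))^k = (-1)^k * (w^k / x^k)"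
      by (metis power_divide power_minus)
    moreover have "(-1)^k * ((-1)^k * v) = v" for v :: complex
      by (metis left_minus_one_mult_self)
    ultimately show ?thesis
      by (simp add: gbinomial_pochhammer field_simps)
  qed
  have lt1: "norm (- (d / of_real c)) < 1" using dc c by (simp add: norm_divide)
  have summ: "summable (\<lambda>k. \<integral>t. norm (f k t) \<partial>lborel)"
  proof -
    have "summable (\<lambda>k. Gamma (of_real (Re z)) * of_real c powr (- of_real (Re z)) * (((- of_real (Re z)) gchoose k) * (- (of_real (norm d) / complex_of_real c))^k))"
      using dc c by (intro summable_mult sums_summable[OF gen_binomial_complex]) (simp add: norm_divide)
    moreover have "Gamma (of_real (Re z)) * of_real c powr (- of_real (Re z)) * (((- of_real (Re z)) gchoose k) * (- (of_real (norm d) / complex_of_real c))^k) = of_real (\<integral>t. norm (f k t) \<partial>lborel)" for k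
    proof -
      have "Gamma (of_real (Re z)) * of_real c powr (- of_real (Re z)) * (((- of_real (Re z)) gchoose k) * (- (of_real (norm d) / complex_of_real c))^k)
         = of_real (norm d)^k / fact k * (Gamma (of_real (Re z) + of_nat k) * of_real c powr (-(of_real (Re z) + of_nat k)))"
        using zk c by (subst binom) (auto simp: of_real_in_nonpos_Ints_iff)
      also have "Gamma (of_real (Re z) + of_nat k) = complex_of_real (Gamma (Re z + real k))"
        using Gamma_complex_of_real[of "Re z + real k"] by simp
      also have "of_real c powr (-(of_real (Re z) + of_nat k)) = complex_of_real (c powr (-(Re z + real k)))"
        using c powr_of_real[of c "-(Re z + real k)"] by simp
      finally show ?thesis by (simp add: hn)
    qed
    ultimately have "summable (\<lambda>k. complex_of_real (\<integral>t. norm (f k t) \<partial>lborel))" by simp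
    then show ?thesis by (simp only: summable_of_real_iff)
  qed
  have pt: "(\<lambda>k. f k t) sums (indicator {0<..} t *\<^sub>R (of_real t powr (z - 1) * exp (- (b * of_real t))))" for t
  proof -
    have "(\<lambda>k. (d * of_real t)^k /\<^sub>R fact k) sums exp (d * of_real t)" by (rule exp_converges)
    from sums_mult[OF this, of "indicator {0<..} t *\<^sub>R (of_real t powr (z - 1) * exp (- of_real (c * t)))"]
    have "(\<lambda>k. f k t) sums (indicator {0<..} t *\<^sub>R (of_real t powr (z - 1) * (exp (- of_real (c * t)) * exp (d * of_real t))))"
      by (simp add: f_def scaleR_conv_of_real field_simps)
    also have "exp (- of_real (c * t)) * exp (d * of_real t) = exp (- (b * of_real t))"
      by (simp add: d_def exp_add[symmetric] algebra_simps)
    finally show ?thesis .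
  qed
  have sn: "AE t in lborel. summable (\<lambda>k. norm (f k t))"
  proof (rule AE_I2)
    fix t
    have "summable (\<lambda>k. indicator {0<..} t *\<^sub>R (t powr (Re z - 1) * exp (- (c * t))) * ((norm d * t)^k /\<^sub>R fact k))"
      by (intro summable_mult sums_summable[OF exp_converges])
    then show "summable (\<lambda>k. norm (f k t))" unfolding nf by (simp add: field_simps)
  qed
  have "integrable lborel (\<lambda>t. \<Sum>k. f k t)" "(\<lambda>k. integral\<^sup>L lborel (f k)) sums (\<integral>t. (\<Sum>k. f k t) \<partial>lborel)"
    using integrable_suminf[OF intf sn summ] sums_integral[OF intf sn summ] .
  then have I: "integrable lborel (\<lambda>t. indicator {0<..} t *\<^sub>R (of_real t powr (z - 1) * exp (- (b * of_real t))))"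
     and S: "(\<lambda>k. integral\<^sup>L lborel (f k)) sums (\<integral>t. indicator {0<..} t *\<^sub>R (of_real t powr (z - 1) * exp (- (b * of_real t))) \<partial>lborel)"
    using sums_unique[OF pt] by simp_all
  have "integral\<^sup>L lborel (f k) = Gamma z * of_real c powr (-z) * (((-z) gchoose k) * (- (d / of_real c))^k)" for k
    using hk[of k] binom[of z "of_real c" d k] zk c by (simp add: has_bochner_integral_iff)
  then have "(\<lambda>k. integral\<^sup>L lborel (f k)) sums (Gamma z * of_real c powr (-z) * (1 + - (d / of_real c)) powr (-z))"
    by (simp only:) (intro sums_mult gen_binomial_complex lt1)
  from sums_unique2[OF S this] have "(\<integral>t. indicator {0<..} t *\<^sub>R (of_real t powr (z - 1) * exp (- (b * of_real t))) \<partial>lborel) = Gamma z * (of_real c powr (-z) * (1 + - (d / of_real c)) powr (-z))" 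
    by (simp add: mult.assoc)
  also have "1 + - (d / of_real c) = b / of_real c" using c by (simp add: d_def field_simps)
  also have "of_real c powr (-z) * (b / of_real c) powr (-z) = b powr (-z)"
    using c b0 powr_times_real_left[of "b / of_real c" "of_real c" "-z"] 
    by (subst powr_times_real_left[symmetric]) auto
  finally show ?thesis using I by (simp add: has_bochner_integral_iff)
qed

section \<open>The modified Bessel function of the second kind\<close>


text \<open>A bridge: the change of variables theorem speaks about absolute integrability on a set,
  whereas termwise integration and Fubini are carried out with Bochner integrals over
  \<open>lborel\<close>. For a Borel integrand both notions and both values agree.\<close>

lemma has_bochner_integral_indicator_iff_absolutely_integrable:
  fixes f :: "real \<Rightarrow> complex"
  assumes "(\<lambda>x. indicator S x *\<^sub>R f x) \<in> borel_measurable borel"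
  shows "has_bochner_integral lborel (\<lambda>x. indicator S x *\<^sub>R f x) b \<longleftrightarrow>
         f absolutely_integrable_on S \<and> integral S f = b"
proof -
  have m: "(\<lambda>x. indicator S x *\<^sub>R f x) \<in> borel_measurable lborel" using assms by simp
  have "integrable lborel (\<lambda>x. indicator S x *\<^sub>R f x) \<longleftrightarrow> f absolutely_integrable_on S"
    unfolding set_integrable_def using integrable_completion[OF m] by simp
  moreover have "integral\<^sup>L lborel (\<lambda>x. indicator S x *\<^sub>R f x) = integral S f"
    if "f absolutely_integrable_on S"
    using set_lebesgue_integral_eq_integral(2)[OF that] integral_completion[OF m]
    unfolding set_lebesgue_integral_def by simp
  ultimately show ?thesis by (auto simp: has_bochner_integral_iff)
qed

text \<open>The substitution \<open>t = exp s\<close> spreads the Gamma integral over the whole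
  line, where cutting at \<open>s = 0\<close> produces the two incomplete Gamma functions.\<close>

lemma gamma_integral_exp_line:
  fixes z :: complex and a :: real
  assumes "Re z > 0" "a > 0"
  shows "has_bochner_integral lborel (\<lambda>s. exp (z * of_real s - of_real (a * exp s)))
           (Gamma z * of_real a powr (-z))"
proof -
  define f where "f = (\<lambda>t. of_real t powr (z - 1) * exp (- complex_of_real (a * t)))"
  have m: "(\<lambda>t. indicator {0<..} t *\<^sub>R f t) \<in> borel_measurable borel"
    unfolding f_def
    by (rule borel_measurable_continuous_on_indicator) (auto intro!: continuous_intros)
  have "f absolutely_integrable_on {0<..} \<and> integral {0<..} f = Gamma z * of_real a powr (-z)"
    using gamma_integral_scaled_pos[OF assms] 
      has_bochner_integral_indicator_iff_absolutely_integrable[OF m] by (simp add: f_def)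
  moreover have "{0<..} = exp ` (UNIV :: real set)"
    by (auto simp: image_iff) (metis exp_ln)
  ultimately have "(\<lambda>s. \<bar>exp s\<bar> *\<^sub>R f (exp s)) absolutely_integrable_on UNIV \<and>
      integral UNIV (\<lambda>s. \<bar>exp s\<bar> *\<^sub>R f (exp s)) = Gamma z * of_real a powr (-z)"
    by (subst has_absolute_integral_change_of_variables_real) (auto intro!: derivative_eq_intros simp: inj_on_def)
  moreover have "\<bar>exp s\<bar> *\<^sub>R f (exp s) = exp (z * of_real s - of_real (a * exp s))" for s
  proof -
    have "complex_of_real (exp s) powr (z - 1) = exp ((z - 1) * of_real s)"
      by (simp add: powr_def Ln_of_real)
    moreover have "complex_of_real (exp s) = exp (of_real s)" by (simp add: exp_of_real)
    ultimately show ?thesis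
      by (simp add: f_def scaleR_conv_of_real exp_add[symmetric] exp_diff exp_minus field_simps)
  qed
  ultimately have A: "(\<lambda>s. exp (z * of_real s - of_real (a * exp s))) absolutely_integrable_on UNIV \<and>
      integral UNIV (\<lambda>s. exp (z * of_real s - of_real (a * exp s))) = Gamma z * of_real a powr (-z)"
    by simp
  have "(\<lambda>s. indicator UNIV s *\<^sub>R exp (z * of_real s - of_real (a * exp s))) \<in> borel_measurable borel"
    by (intro borel_measurable_continuous_onI) (auto intro!: continuous_intros)
  from has_bochner_integral_indicator_iff_absolutely_integrable[OF this] A show ?thesis by simp
qed

lemma has_bochner_integral_exp_halfline:
  fixes c :: complex
  assumes "Re c > 0"
  shows "has_bochner_integral lborel (\<lambda>s. indicator {0<..} s *\<^sub>R exp (- (c * of_real s))) (1 / c)"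
proof -
  have "c \<noteq> 0" using assms by auto
  have "has_bochner_integral lborel
    (\<lambda>t. indicator {0<..} t *\<^sub>R (of_real t powr (1 - 1) * exp (- (c * of_real t))))
    (Gamma 1 * c powr (-1))"
    using assms by (intro gamma_integral_complex_scaled) auto
  also have "Gamma 1 * c powr (-1) = 1 / c" using \<open>c \<noteq> 0\<close> by (simp add: powr_minus field_simps)
  also have "(\<lambda>t. indicator {0<..} t *\<^sub>R (of_real t powr (1 - 1) * exp (- (c * of_real t)))) = (\<lambda>s. indicator {0<..} s *\<^sub>R exp (- (c * of_real s)))"
    by (auto simp: fun_eq_iff indicator_def)
  finally show ?thesis .
qed

lemma has_bochner_integral_reflect:
  fixes f :: "real \<Rightarrow> 'a :: {banach, second_countable_topology}"
  shows "has_bochner_integral lborel f x \<Longrightarrow> has_bochner_integral lborel (\<lambda>s. f (- s)) x"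
  using lborel_has_bochner_integral_real_affine_iff[of "-1" f x 0] by simp

lemma norm_exp_halfline_integral:
  fixes c :: complex
  assumes "Re c > 0"
  shows "(\<integral>s. norm (indicator {0<..} s *\<^sub>R exp (- (c * of_real s))) \<partial>lborel) = 1 / Re c"
proof -
  have "has_bochner_integral lborel (\<lambda>s. Re (indicator {0<..} s *\<^sub>R exp (- (of_real (Re c) * of_real s)))) (Re (1 / of_real (Re c)))"
    by (intro has_bochner_integral_Re has_bochner_integral_exp_halfline) (use assms in simp)
  also have "(\<lambda>s. Re (indicator {0<..} s *\<^sub>R exp (- (of_real (Re c) * of_real s)))) = (\<lambda>s. norm (indicator {0<..} s *\<^sub>R exp (- (c * complex_of_real s))))"
    by (auto simp: fun_eq_iff indicator_def exp_of_real simp flip: of_real_mult of_real_minus)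
  also have "Re (1 / of_real (Re c)) = 1 / Re c" by (metis Re_complex_of_real of_real_1 of_real_divide)
  finally show ?thesis by (simp add: has_bochner_integral_iff)
qed

text \<open>The series part of the incomplete Gamma function: \<open>inc_gamma a z\<close> is
  \<open>a powr z\<close> times the upper incomplete Gamma function of \<open>-z\<close> at \<open>a\<close>.\<close>

definition inc_gamma_series :: "real \<Rightarrow> complex \<Rightarrow> complex" where
  "inc_gamma_series a z = (\<Sum>j. of_real ((-a)^j / fact j) / (of_nat j - z))"

definition inc_gamma :: "real \<Rightarrow> complex \<Rightarrow> complex" where
  "inc_gamma a z = of_real a powr z * Gamma (-z) - inc_gamma_series a z"

text \<open>The half line \<open>s > 0\<close> is the whole line minus \<open>s < 0\<close>. On
  \<open>s < 0\<close> the factor \<open>exp (- a * exp s)\<close> expands in powers of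
  \<open>exp s\<close>, and termwise integration gives \<open>inc_gamma_series\<close>; the whole
  line gives the Gamma term. Both pieces converge at minus infinity because \<open>Re z < 0\<close>;
  a recurrence lifts this restriction later.\<close>

lemma inc_gamma_integral_base:
  assumes z: "Re z < 0" and a: "a > 0"
  shows "has_bochner_integral lborel
    (\<lambda>s. indicator {0<..} s *\<^sub>R exp (- of_real (a * exp s) - z * of_real s)) (inc_gamma a z)"
proof -
  define f where "f = (\<lambda>(j::nat) s. of_real ((-a)^j / fact j) * (indicator {0<..} s *\<^sub>R exp (- ((of_nat j - z) * complex_of_real s))))"
  have pos: "Re (of_nat j - z) > 0" for j using z by simp
  have hj: "has_bochner_integral lborel (f j) (of_real ((-a)^j / fact j) * (1 / (of_nat j - z)))" for j
    unfolding f_def by (intro has_bochner_integral_mult_right has_bochner_integral_exp_halfline pos)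
  then have ij: "integrable lborel (f j)" "integral\<^sup>L lborel (f j) = of_real ((-a)^j / fact j) / (of_nat j - z)" for j
    by (auto simp: has_bochner_integral_iff)
  have nj: "(\<integral>s. norm (f j s) \<partial>lborel) = (a^j / fact j) * (1 / (real j - Re z))" for j
    using norm_exp_halfline_integral[OF pos[of j]] a
    unfolding f_def norm_mult by (simp add: norm_divide norm_power)
  have sum1: "summable (\<lambda>j. a^j / fact j)"
    using summable_exp[of a] by (simp add: field_simps)
  have sumn: "summable (\<lambda>j. \<integral>s. norm (f j s) \<partial>lborel)"
  proof (rule summable_comparison_test')
    show "summable (\<lambda>j. a^j / fact j * (1 / (- Re z)))" by (intro summable_mult2 sum1)
    fix j :: nat assume "j \<ge> 0"
    show "norm (\<integral>s. norm (f j s) \<partial>lborel) \<le> a^j / fact j * (1 / (- Re z))"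
    proof -
      have "1 / (real j - Re z) \<le> 1 / (- Re z)" by (rule frac_le) (use z in auto)
      moreover have "0 \<le> 1 / (real j - Re z)" using z by simp
      moreover have "0 \<le> a^j / fact j" using a by simp
      ultimately show ?thesis unfolding nj
        by (metis abs_of_nonneg mult_left_mono mult_nonneg_nonneg real_norm_def)
    qed
  qed
  have fs: "(\<lambda>j. f j s) sums (indicator {0<..} s *\<^sub>R exp (- of_real (a * exp (-s)) + z * of_real s))" for s
  proof -
    have e: "exp (- of_real (a * exp (-s)) + z * of_real s) = exp (complex_of_real (- a * exp (-s))) * exp (z * of_real s)"
      by (simp only: exp_add of_real_minus mult_minus_left)
    have "(\<lambda>j. (of_real (- a * exp (-s)))^j /\<^sub>R fact j) sums exp (complex_of_real (- a * exp (-s)))" by (rule exp_converges)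
    from sums_mult[OF this, of "indicator {0<..} s *\<^sub>R exp (z * of_real s)"]
    have "(\<lambda>j. indicator {0<..} s *\<^sub>R exp (z * of_real s) * ((of_real (- a * exp (-s)))^j /\<^sub>R fact j)) sums 
       (indicator {0<..} s *\<^sub>R exp (- of_real (a * exp (-s)) + z * of_real s))"
      unfolding e by (simp add: mult_ac)
    moreover have "indicator {0<..} s *\<^sub>R exp (z * of_real s) * ((of_real (- a * exp (-s)))^j /\<^sub>R fact j) = f j s" for j
    proof -
      have "exp (- ((of_nat j - z) * complex_of_real s)) = exp (z * of_real s) * of_real (exp (-s))^j"
        by (simp add: exp_of_nat_mult[symmetric] exp_of_real[symmetric] exp_add[symmetric] algebra_simps)
      moreover have "complex_of_real (- a * exp (-s))^j = of_real (-a)^j * of_real (exp (-s))^j"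
        by (simp only: of_real_mult power_mult_distrib)
      ultimately show ?thesis unfolding f_def by (simp add: scaleR_conv_of_real field_simps)
    qed
    ultimately show ?thesis by simp
  qed
  have sn: "AE s in lborel. summable (\<lambda>j. norm (f j s))"
  proof (rule AE_I2)
    fix s
    have "summable (\<lambda>j. indicator {0<..} s * norm (exp (z * of_real s)) * ((a * exp (-s))^j / fact j))"
      using summable_exp[of "a * exp (-s)"] by (intro summable_mult) (simp add: field_simps)
    moreover have "norm (f j s) = indicator {0<..} s * norm (exp (z * of_real s)) * ((a * exp (-s))^j / fact j)" for j
    proof -
      have "exp (- ((of_nat j - z) * complex_of_real s)) = exp (z * of_real s) * of_real (exp (-s))^j"
        by (simp add: exp_of_nat_mult[symmetric] exp_of_real[symmetric] exp_add[symmetric] algebra_simps)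
      then show ?thesis using a unfolding f_def norm_mult norm_scaleR by (simp add: norm_mult norm_divide norm_power power_mult_distrib)
    qed
    ultimately show "summable (\<lambda>j. norm (f j s))" by simp
  qed
  have "integrable lborel (\<lambda>s. \<Sum>j. f j s)" "(\<integral>s. (\<Sum>j. f j s) \<partial>lborel) = (\<Sum>j. integral\<^sup>L lborel (f j))"
    using integrable_suminf[OF ij(1) sn sumn] integral_suminf[OF ij(1) sn sumn] .
  then have "has_bochner_integral lborel (\<lambda>s. indicator {0<..} s *\<^sub>R exp (- of_real (a * exp (-s)) + z * of_real s)) (inc_gamma_series a z)"
    using sums_unique[OF fs] by (simp add: has_bochner_integral_iff inc_gamma_series_def ij(2))
  from has_bochner_integral_reflect[OF this]
  have L: "has_bochner_integral lborel (\<lambda>s. indicator {0<..} (-s) *\<^sub>R exp (- of_real (a * exp s) - z * of_real s)) (inc_gamma_series a z)"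
    by simp
  have "has_bochner_integral lborel (\<lambda>s. exp ((-z) * of_real s - of_real (a * exp s))) (Gamma (-z) * of_real a powr (-(-z)))"
    using z a by (intro gamma_integral_exp_line) auto
  from has_bochner_integral_diff[OF this L]
  have D: "has_bochner_integral lborel (\<lambda>s. exp (- z * of_real s - of_real (a * exp s)) - indicator {0<..} (-s) *\<^sub>R exp (- of_real (a * exp s) - z * of_real s)) (inc_gamma a z)"
    by (simp add: inc_gamma_def mult.commute)
  have "AE s in lborel. s \<noteq> (0::real)" by (rule AE_lborel_singleton)
  then have ae: "AE s in lborel. exp (- z * of_real s - of_real (a * exp s)) - indicator {0<..} (-s) *\<^sub>R exp (- of_real (a * exp s) - z * of_real s) = indicator {0<..} s *\<^sub>R exp (- of_real (a * exp s) - z * of_real s)"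
  proof eventually_elim
    case (elim s)
    have "exp (- z * of_real s - of_real (a * exp s)) = exp (- of_real (a * exp s) - z * of_real s)"
    proof -
      have "- z * of_real s - of_real (a * exp s) = - of_real (a * exp s) - z * of_real s"
        by (simp add: algebra_simps)
      then show ?thesis by (rule arg_cong)
    qed
    then show ?case using elim by (auto simp: indicator_def)
  qed
  show ?thesis
    by (subst has_bochner_integral_cong_AE[OF _ _ ae, symmetric])
       (use D in \<open>auto simp: has_bochner_integral_iff intro!: borel_measurable_continuous_onI borel_measurable_diff borel_measurable_scaleR continuous_intros\<close>)
qed

text \<open>On \<open>s > 0\<close>, lowering \<open>Re z\<close> only enlarges the integrand, so a
  sufficiently negative real exponent, covered by the base case, dominates every
  \<open>z\<close>.\<close>

lemma inc_gamma_integrable: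
  fixes z :: complex
  assumes a: "a > 0"
  shows "integrable lborel (\<lambda>s. indicator {0<..} s *\<^sub>R exp (- of_real (a * exp s) - z * of_real s))"
proof -
  define w where "w = - complex_of_real (\<bar>Re z\<bar> + 1)"
  have "integrable lborel (\<lambda>s. indicator {0<..} s *\<^sub>R exp (- of_real (a * exp s) - w * of_real s))"
    using inc_gamma_integral_base[of w a] a by (simp add: w_def has_bochner_integral_iff)
  then show ?thesis
  proof (rule Bochner_Integration.integrable_bound)
    show "(\<lambda>s. indicator {0<..} s *\<^sub>R exp (- complex_of_real (a * exp s) - z * of_real s)) \<in> borel_measurable lborel"
      by (auto intro!: borel_measurable_continuous_onI continuous_intros borel_measurable_scaleR)
    show "AE s in lborel. norm (indicator {0<..} s *\<^sub>R exp (- complex_of_real (a * exp s) - z * of_real s)) \<le> norm (indicator {0<..} s *\<^sub>R exp (- complex_of_real (a * exp s) - w * of_real s))"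
    proof (rule AE_I2)
      fix s :: real
      have "- (Re z * s) \<le> (\<bar>Re z\<bar> + 1) * s" if "s > 0"
        using that by (metis abs_ge_minus_self abs_ge_zero add_increasing2 less_eq_real_def mult_minus_left mult_right_mono zero_le_one)
      then show "norm (indicator {0<..} s *\<^sub>R exp (- complex_of_real (a * exp s) - z * of_real s)) \<le> norm (indicator {0<..} s *\<^sub>R exp (- complex_of_real (a * exp s) - w * of_real s))"
        by (auto simp: indicator_def w_def algebra_simps)
    qed
  qed
qed

text \<open>The function \<open>exp (- a * exp s - z * s)\<close> vanishes at infinity and equals
  \<open>exp (- a)\<close> at 0; its derivative is a combination of the integrands for
  \<open>z\<close> and \<open>z - 1\<close>, since multiplying by \<open>exp s\<close> lowers
  \<open>z\<close> by one.\<close>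

lemma inc_gamma_integral_recurrence:
  fixes z :: complex
  assumes a: "a > 0"
  defines "I \<equiv> (\<lambda>z::complex. integral\<^sup>L lborel (\<lambda>s. indicator {0<..} s *\<^sub>R exp (- of_real (a * exp s) - z * of_real s)))"
  shows "z * I z = exp (- of_real a) - of_real a * I (z - 1)"
proof -
  define E where "E = (\<lambda>z s. exp (- complex_of_real (a * exp s) - z * of_real s))"
  have I: "has_bochner_integral lborel (\<lambda>s. indicator {0<..} s *\<^sub>R E z s) (I z)" for z
    using inc_gamma_integrable[OF a] by (simp add: has_bochner_integral_iff I_def E_def)
  define f where "f = (\<lambda>s. - of_real a * E (z - 1) s - z * E z s)"
  have "has_bochner_integral lborel (\<lambda>s. - of_real a * (indicator {0<..} s *\<^sub>R E (z - 1) s) - z * (indicator {0<..} s *\<^sub>R E z s)) (- of_real a * I (z - 1) - z * I z)"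
    by (intro has_bochner_integral_diff has_bochner_integral_mult_right I)
  then have F: "has_bochner_integral lborel (\<lambda>s. indicator {0<..} s *\<^sub>R f s) (- of_real a * I (z - 1) - z * I z)"
    by (simp add: f_def algebra_simps)
  have ein: "einterval 0 \<infinity> = {0::real<..}"
    by (auto simp: einterval_def)
  have "(LBINT s=0..\<infinity>. f s) = 0 - exp (- of_real a)"
  proof (rule interval_integral_FTC_integrable[where F = "E z"])
    fix s :: real
    have "(E z has_vector_derivative (E z s * (- of_real (a * exp s) - z))) (at s)"
    proof -
      have "((\<lambda>w. exp (- (of_real a * exp w) - z * w)) has_field_derivative
          exp (- (of_real a * exp (of_real s)) - z * of_real s) * (- (of_real a * exp (of_real s)) - z)) (at (of_real s))"
        by (auto intro!: derivative_eq_intros)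
      from has_vector_derivative_real_field[OF this] show ?thesis
        by (simp add: E_def exp_of_real)
    qed
    moreover have "E (z - 1) s = E z s * of_real (exp s)"
      by (simp add: E_def exp_of_real[symmetric] exp_add[symmetric] algebra_simps)
    ultimately show "(E z has_vector_derivative f s) (at s)"
      by (simp add: f_def algebra_simps)
    show "isCont f s" unfolding f_def E_def by (intro continuous_intros)
  next
    show "set_integrable lborel (einterval 0 \<infinity>) f"
      unfolding ein set_integrable_def using F by (simp add: has_bochner_integral_iff)
    have "isCont (E z) 0" unfolding E_def by (intro continuous_intros)
    then have "(E z \<longlongrightarrow> exp (- of_real a)) (at_right 0)"
      by (auto simp: isCont_def E_def intro: tendsto_within_subset filterlim_at_split[THEN iffD1, THEN conjunct2])
    then show "((E z \<circ> real_of_ereal) \<longlongrightarrow> exp (- of_real a)) (at_right 0)"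
      by (simp add: ereal_tendsto_simps zero_ereal_def)
    have "((\<lambda>s. exp (- (a * exp s) - Re z * s)) \<longlongrightarrow> 0) at_top"
      using a by real_asymp
    then have "(E z \<longlongrightarrow> 0) at_top"
      by (rule Lim_null_comparison[rotated]) (simp add: E_def)
    then show "((E z \<circ> real_of_ereal) \<longlongrightarrow> 0) (at_left \<infinity>)"
      by (simp add: ereal_tendsto_simps)
  qed simp
  moreover have "(LBINT s=0..\<infinity>. f s) = - of_real a * I (z - 1) - z * I z"
    using F by (simp add: interval_lebesgue_integral_def ein set_lebesgue_integral_def has_bochner_integral_iff)
  ultimately show ?thesis by (simp add: algebra_simps)
qed

section \<open>Extension of the incomplete Gamma integral to all non-integer parameters\<close>

lemma inc_gamma_series_sums:
  assumes "z \<notin> \<nat>"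
  shows "(\<lambda>j. of_real ((-a)^j / fact j) / (of_nat j - z)) sums inc_gamma_series a z"
proof -
  have "eventually (\<lambda>j. norm (of_real ((-a)^j / fact j) / (of_nat j - z)) \<le> \<bar>a\<bar>^j / fact j) sequentially"
    using eventually_ge_at_top[of "nat \<lceil>norm z + 1\<rceil>"]
  proof eventually_elim
    case (elim j)
    then have "real j \<ge> norm z + 1" by linarith
    then have "norm (of_nat j - z) \<ge> 1"
      using norm_triangle_ineq2[of "of_nat j" z] by simp
    then have "norm (of_real ((-a)^j / fact j) :: complex) / norm (of_nat j - z) \<le> norm (of_real ((-a)^j / fact j) :: complex) / 1"
      by (intro divide_left_mono) auto
    then show ?case unfolding norm_divide by (simp add: norm_divide norm_power)
  qed
  moreover have "summable (\<lambda>j. \<bar>a\<bar>^j / fact j)"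
    using summable_exp[of "\<bar>a\<bar>"] by (simp add: field_simps)
  ultimately have "summable (\<lambda>j. of_real ((-a)^j / fact j) / (of_nat j - z))"
    by (rule summable_comparison_test_ev)
  then show ?thesis by (simp add: inc_gamma_series_def sums_iff)
qed

text \<open>The closed form obeys the same recurrence as the integral: the Gamma part solves the
  homogeneous equation by \<open>Gamma (w + 1) = w * Gamma w\<close>, and the series part supplies
  \<open>exp (- a)\<close> after an index shift.\<close>

lemma inc_gamma_recurrence:
  assumes "z \<notin> \<nat>" "z - 1 \<notin> \<nat>" "a > 0"
  shows "z * inc_gamma a z = exp (- of_real a) - of_real a * inc_gamma a (z - 1)"
proof -
  define c where "c = (\<lambda>j. complex_of_real ((-a)^j / fact j))"
  have S: "(\<lambda>j. c j / (of_nat j - z)) sums inc_gamma_series a z" if "z \<notin> \<nat>" for z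
    using inc_gamma_series_sums[OF that] by (simp add: c_def)
  have E: "c sums exp (- of_real a)"
    using exp_converges[of "- complex_of_real a"] by (simp add: c_def[abs_def] scaleR_conv_of_real field_simps)
  have nz: "of_nat j - z \<noteq> 0" for j using assms(1) by (auto simp: Nats_def)
  have "(\<lambda>j. z * (c j / (of_nat j - z)) + c j) sums (z * inc_gamma_series a z + exp (- of_real a))"
    by (intro sums_add sums_mult S E assms)
  also have "(\<lambda>j. z * (c j / (of_nat j - z)) + c j) = (\<lambda>j. of_nat j * c j / (of_nat j - z))"
  proof
    fix j show "z * (c j / (of_nat j - z)) + c j = of_nat j * c j / (of_nat j - z)"
      using nz[of j] by (simp add: field_simps)
  qed
  finally have 1: "(\<lambda>j. of_nat j * c j / (of_nat j - z)) sums (z * inc_gamma_series a z + exp (- of_real a))" .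
  then have "(\<lambda>j. of_nat (Suc j) * c (Suc j) / (of_nat (Suc j) - z)) sums (z * inc_gamma_series a z + exp (- of_real a))"
    by (subst sums_Suc_iff) simp
  moreover have "of_nat (Suc j) * c (Suc j) / (of_nat (Suc j) - z) = - of_real a * (c j / (of_nat j - (z - 1)))" for j
  proof -
    have "of_nat (Suc j) * c (Suc j) = - of_real a * c j"
      by (simp add: c_def divide_simps del: of_nat_Suc)
    moreover have "of_nat (Suc j) - z = of_nat j - (z - 1)" by simp
    ultimately show ?thesis by simp
  qed
  moreover have "(\<lambda>j. - of_real a * (c j / (of_nat j - (z - 1)))) sums (- of_real a * inc_gamma_series a (z - 1))"
    by (intro sums_mult S assms)
  ultimately have "z * inc_gamma_series a z + exp (- of_real a) = - of_real a * inc_gamma_series a (z - 1)"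
    using sums_unique2 by (simp only:) blast
  then have "z * inc_gamma_series a z = - (of_real a * inc_gamma_series a (z - 1)) - exp (- of_real a)"
    by (simp add: eq_diff_eq)
  moreover have "z * (of_real a powr z * Gamma (- z)) = - of_real a * (of_real a powr (z - 1) * Gamma (- (z - 1)))"
  proof -
    have "Gamma (- z + 1) = - z * Gamma (- z)"
      using assms(1) by (intro Gamma_plus1) (simp add: uminus_in_nonpos_Ints_iff)
    moreover have "of_real a powr z = of_real a * of_real a powr (z - 1)"
      using assms(3) by (simp add: powr_diff)
    ultimately show ?thesis by (simp add: algebra_simps)
  qed
  ultimately show ?thesis unfolding inc_gamma_def right_diff_distrib by simp
qed

lemma inc_gamma_integral:
  assumes "z \<notin> \<int>" "a > 0"
  shows "has_bochner_integral lborel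
    (\<lambda>s. indicator {0<..} s *\<^sub>R exp (- of_real (a * exp s) - z * of_real s)) (inc_gamma a z)"
proof -
  \<comment> \<open>Induction on an integer bound for \<open>Re z\<close>: the two recurrences carry
    equality from \<open>z - 1\<close> to \<open>z\<close>, and dividing by \<open>z\<close> is
    possible because \<open>z\<close>, not being an integer, is non-zero.\<close>
  have "\<forall>z. z \<notin> \<int> \<longrightarrow> Re z < real n \<longrightarrow> has_bochner_integral lborel
    (\<lambda>s. indicator {0<..} s *\<^sub>R exp (- of_real (a * exp s) - z * of_real s)) (inc_gamma a z)" for n
  proof (induction n)
    case 0
    then show ?case using inc_gamma_integral_base assms(2) by simp
  next
    case (Suc n)
    show ?case
    proof (intro allI impI)
      fix z :: complex assume z: "z \<notin> \<int>" "Re z < real (Suc n)"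
      have z1: "z - 1 \<notin> \<int>" using z(1) by (metis Ints_1 Ints_add diff_add_cancel)
      define I where "I = (\<lambda>z::complex. integral\<^sup>L lborel (\<lambda>s. indicator {0<..} s *\<^sub>R exp (- of_real (a * exp s) - z * of_real s)))"
      have "I (z - 1) = inc_gamma a (z - 1)"
        using Suc[rule_format, OF z1] z by (simp add: has_bochner_integral_iff I_def)
      moreover have "z * I z = exp (- of_real a) - of_real a * I (z - 1)"
        unfolding I_def using inc_gamma_integral_recurrence[OF assms(2)] .
      moreover have "z * inc_gamma a z = exp (- of_real a) - of_real a * inc_gamma a (z - 1)"
        using z z1 assms(2) Nats_subset_Ints by (intro inc_gamma_recurrence) auto
      moreover have "z \<noteq> 0" using z by auto
      ultimately have "I z = inc_gamma a z" by (metis mult_left_cancel)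
      then show "has_bochner_integral lborel
          (\<lambda>s. indicator {0<..} s *\<^sub>R exp (- of_real (a * exp s) - z * of_real s)) (inc_gamma a z)"
        using inc_gamma_integrable[OF assms(2)] by (simp add: has_bochner_integral_iff I_def)
    qed
  qed
  moreover obtain n :: nat where "Re z < real n" using reals_Archimedean2 by blast
  ultimately show ?thesis using assms by blast
qed


section \<open>From incomplete Gamma functions to modified Bessel functions\<close>

lemma bessel_halfline_sums:
  fixes \<nu> :: complex
  assumes \<nu>: "\<nu> \<notin> \<int>" and a: "a > 0"
  defines "f \<equiv> (\<lambda>s. indicator {0<..} s *\<^sub>R exp (- of_real (2 * a * cosh s) - \<nu> * of_real s))"
  shows "integrable lborel f"
    and "(\<lambda>k. of_real ((-a)^k / fact k) * inc_gamma a (\<nu> + of_nat k)) sums integral\<^sup>L lborel f"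
proof -
  define g where "g = (\<lambda>k s. complex_of_real ((-a)^k / fact k) * (indicator {0<..} s *\<^sub>R exp (- of_real (a * exp s) - (\<nu> + of_nat k) * of_real s)))"
  have \<nu>k: "\<nu> + of_nat k \<notin> \<int>" for k
    using \<nu> by (metis Ints_diff Ints_of_nat add_diff_cancel_right')
  have gk: "has_bochner_integral lborel (g k) (of_real ((-a)^k / fact k) * inc_gamma a (\<nu> + of_nat k))" for k
    unfolding g_def by (intro has_bochner_integral_mult_right inc_gamma_integral \<nu>k a)
  then have gi: "integrable lborel (g k)" "integral\<^sup>L lborel (g k) = of_real ((-a)^k / fact k) * inc_gamma a (\<nu> + of_nat k)" for k
    by (auto simp: has_bochner_integral_iff)
  \<comment> \<open>Here \<open>2 * a * cosh s = a * exp s + a * exp (- s)\<close>. Only the second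
    summand is expanded: on \<open>s > 0\<close> it stays below \<open>a\<close>, so the series is
    dominated by that of \<open>exp a\<close> times an integrable function.\<close>
  have gshape: "g k s = indicator {0<..} s *\<^sub>R exp (- of_real (a * exp s) - \<nu> * of_real s) * (of_real (- a * exp (-s)) ^ k /\<^sub>R fact k)" for k s
  proof -
    have "exp (- of_real (a * exp s) - (\<nu> + of_nat k) * of_real s)
        = exp (- of_real (a * exp s) - \<nu> * of_real s) * (complex_of_real (exp (-s)))^k"
    proof -
      have "complex_of_real (exp (-s))^k = exp (of_nat k * of_real (-s))"
        by (simp only: exp_of_nat_mult exp_of_real)
      moreover have "- of_real (a * exp s) - (\<nu> + of_nat k) * complex_of_real s = (- of_real (a * exp s) - \<nu> * of_real s) + of_nat k * of_real (-s)"
        by (simp add: algebra_simps)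
      ultimately show ?thesis by (simp only: exp_add)
    qed
    moreover have "complex_of_real (- a * exp (-s))^k = of_real (-a)^k * of_real (exp (-s))^k"
      by (simp only: of_real_mult power_mult_distrib)
    ultimately show ?thesis by (simp add: g_def scaleR_conv_of_real field_simps)
  qed
  define C where "C = (\<integral>s. norm (indicator {0<..} s *\<^sub>R exp (- complex_of_real (a * exp s) - \<nu> * of_real s)) \<partial>lborel)"
  have iC: "integrable lborel (\<lambda>s. norm (indicator {0<..} s *\<^sub>R exp (- complex_of_real (a * exp s) - \<nu> * of_real s)))"
    by (intro integrable_norm inc_gamma_integrable a)
  have ngk: "norm (g k s) \<le> a^k / fact k * norm (indicator {0<..} s *\<^sub>R exp (- complex_of_real (a * exp s) - \<nu> * of_real s))" for k s
  proof -
    have "norm (complex_of_real (- a * exp (-s)) ^ k /\<^sub>R fact k) \<le> a^k / fact k" if "s > 0"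
    proof -
      have "(a * exp (-s))^k \<le> a^k" using that a by (intro power_mono) auto
      then show ?thesis using a by (simp add: norm_power norm_mult field_simps)
    qed
    note b = this
    show ?thesis
    proof (cases "s > 0")
      case True
      show ?thesis unfolding gshape norm_mult
        by (subst mult.commute) (intro mult_right_mono b True norm_ge_zero)
    qed (simp add: gshape)
  qed
  have "summable (\<lambda>k. \<integral>s. norm (g k s) \<partial>lborel)"
  proof (rule summable_comparison_test')
    show "summable (\<lambda>k. a^k / fact k * C)"
      using summable_exp[of a] by (intro summable_mult2) (simp add: field_simps)
    fix k :: nat assume "k \<ge> 0"
    have "(\<integral>s. norm (g k s) \<partial>lborel) \<le> (\<integral>s. a^k / fact k * norm (indicator {0<..} s *\<^sub>R exp (- complex_of_real (a * exp s) - \<nu> * of_real s)) \<partial>lborel)"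
      by (intro integral_mono integrable_norm gi integrable_mult_right iC ngk)
    then show "norm (\<integral>s. norm (g k s) \<partial>lborel) \<le> a^k / fact k * C"
      by (simp add: C_def)
  qed
  note sumn = this
  have gs: "(\<lambda>k. g k s) sums f s" for s
  proof -
    have e: "f s = indicator {0<..} s *\<^sub>R exp (- complex_of_real (a * exp s) - \<nu> * of_real s) * exp (of_real (- a * exp (-s)))"
      by (simp add: f_def exp_add[symmetric] cosh_def scaleR_conv_of_real algebra_simps)
    show ?thesis unfolding gshape e by (intro sums_mult exp_converges)
  qed
  have sn: "AE s in lborel. summable (\<lambda>k. norm (g k s))"
  proof (rule AE_I2)
    fix s
    have "summable (\<lambda>k. a^k / fact k * norm (indicator {0<..} s *\<^sub>R exp (- complex_of_real (a * exp s) - \<nu> * of_real s)))"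
      using summable_exp[of a] by (intro summable_mult2) (simp add: field_simps)
    then show "summable (\<lambda>k. norm (g k s))"
      by (rule summable_comparison_test'[of _ 0]) (use ngk in auto)
  qed
  show "integrable lborel f" 
    using integrable_suminf[OF gi(1) sn sumn] unfolding sums_unique[OF gs, symmetric] .
  show "(\<lambda>k. of_real ((-a)^k / fact k) * inc_gamma a (\<nu> + of_nat k)) sums integral\<^sup>L lborel f"
    using sums_integral[OF gi(1) sn sumn] unfolding sums_unique[OF gs, symmetric] gi .
qed

text \<open>Supplies the uniform lower bound for the denominators \<open>j - k - \<nu>\<close> of
  the double series that follows.\<close>

lemma norm_minus_Ints_bound:
  fixes \<nu> :: complex
  assumes "\<nu> \<notin> \<int>"
  obtains \<delta> where "\<delta> > 0" "\<And>m. m \<in> \<int> \<Longrightarrow> \<delta> \<le> norm (m - \<nu>)"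
proof -
  have "closed (\<int> :: complex set)" by (rule closed_Ints)
  then obtain d where "d > 0" "\<forall>x\<in>\<int>. d \<le> dist \<nu> x"
    using separate_point_closed[of \<int> \<nu>] assms by blast
  then show ?thesis by (intro that[of d]) (auto simp: dist_norm norm_minus_commute)
qed

text \<open>The summand is antisymmetric under \<open>\<nu> \<mapsto> - \<nu>\<close> combined with \<open>j \<leftrightarrow> k\<close>.\<close>

lemma inc_gamma_series_cancel:
  fixes \<nu> :: complex
  assumes \<nu>: "\<nu> \<notin> \<int>" and a: "a > 0"
  defines "c \<equiv> (\<lambda>k. complex_of_real ((-a)^k / fact k))"
  obtains S where "(\<lambda>k. c k * inc_gamma_series a (\<nu> + of_nat k)) sums S"
    "(\<lambda>k. c k * inc_gamma_series a (- \<nu> + of_nat k)) sums (- S)"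
proof -
  define T where "T = (\<lambda>\<mu> k j. c k * (c j / (of_nat j - (\<mu> + of_nat k))))"
  have cs: "(\<lambda>k. norm (c k)) summable_on UNIV"
  proof -
    have "summable (\<lambda>k. norm (c k))" using summable_exp[of a] a
      by (simp add: c_def norm_divide norm_power field_simps)
    then show ?thesis by (intro norm_summable_imp_summable_on) simp
  qed
  \<comment> \<open>Denominators stay away from 0 by \<delta>, so the double series is dominated by
    a product of two exponential series. This absolute summability permits the exchange of the
    summations over \<open>j\<close> and \<open>k\<close>.\<close>
  have Tsum: "(\<lambda>(k, j). T \<mu> k j) summable_on UNIV \<times> UNIV" if \<mu>: "\<mu> \<notin> \<int>" for \<mu>
  proof -
    obtain \<delta> where \<delta>: "\<delta> > 0" "\<And>m. m \<in> \<int> \<Longrightarrow> \<delta> \<le> norm (m - \<mu>)"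
      using norm_minus_Ints_bound[OF \<mu>] by blast
    have "(\<lambda>(k, j). norm (c k) * norm (c j)) summable_on UNIV \<times> UNIV"
    proof (rule summable_on_SigmaI)
      show "((\<lambda>j. case (k, j) of (k, j) \<Rightarrow> norm (c k) * norm (c j)) has_sum norm (c k) * infsum (\<lambda>j. norm (c j)) UNIV) UNIV" for k
        using has_sum_cmult_right[OF has_sum_infsum[OF cs]] by simp
      show "(\<lambda>k. norm (c k) * infsum (\<lambda>j. norm (c j)) UNIV) summable_on UNIV"
        by (intro summable_on_cmult_left cs)
    qed auto
    then have "(\<lambda>x. (case x of (k, j) \<Rightarrow> norm (c k) * norm (c j)) * (1 / \<delta>)) summable_on UNIV \<times> UNIV"
      by (rule summable_on_cmult_left)
    then have "(\<lambda>x. norm (case x of (k, j) \<Rightarrow> T \<mu> k j)) summable_on UNIV \<times> UNIV"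
    proof (rule Infinite_Sum.abs_summable_on_comparison_test')
      fix x :: "nat \<times> nat" 
      obtain k j where x: "x = (k, j)" by (cases x)
      have "of_nat j - (\<mu> + of_nat k) = (of_nat j - of_nat k) - \<mu>" by simp
      then have "\<delta> \<le> norm (of_nat j - (\<mu> + of_nat k))"
        using \<delta>(2)[of "of_nat j - of_nat k"] by (simp only:) (simp add: Ints_diff)
      then have "norm (c k) * (norm (c j) / norm (of_nat j - (\<mu> + of_nat k))) \<le> norm (c k) * (norm (c j) / \<delta>)"
        using \<delta>(1) by (intro mult_left_mono divide_left_mono mult_pos_pos) auto
      then show "norm (case x of (k, j) \<Rightarrow> T \<mu> k j) \<le> (case x of (k, j) \<Rightarrow> norm (c k) * norm (c j)) * (1 / \<delta>)"
        by (simp add: x T_def norm_mult norm_divide)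
    qed
    then show ?thesis using abs_summable_summable by blast
  qed
  have row: "(\<Sum>\<^sub>\<infinity>j. T \<mu> k j) = c k * inc_gamma_series a (\<mu> + of_nat k)" if \<mu>: "\<mu> \<notin> \<int>" for \<mu> k
  proof -
    have "\<mu> + of_nat k \<notin> \<int>"
      using \<mu> by (metis Ints_diff Ints_of_nat add_diff_cancel_right')
    then have "\<mu> + of_nat k \<notin> \<nat>" using Nats_subset_Ints by blast
    from sums_mult[OF inc_gamma_series_sums[OF this, of a], of "c k"]
    have 1: "T \<mu> k sums (c k * inc_gamma_series a (\<mu> + of_nat k))" unfolding T_def c_def .
    have "(\<lambda>j. T \<mu> k j) summable_on UNIV"
      using summable_on_SigmaD1[OF Tsum[OF \<mu>], of k] by simp
    then have "T \<mu> k sums (\<Sum>\<^sub>\<infinity>j. T \<mu> k j)"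
      using has_sum_imp_sums has_sum_infsum by blast
    with 1 show ?thesis using sums_unique2 by blast
  qed
  have rs: "(\<lambda>k. c k * inc_gamma_series a (\<mu> + of_nat k)) sums (\<Sum>\<^sub>\<infinity>k. \<Sum>\<^sub>\<infinity>j. T \<mu> k j)" if \<mu>: "\<mu> \<notin> \<int>" for \<mu>
  proof -
    have "(\<lambda>k. \<Sum>\<^sub>\<infinity>j. T \<mu> k j) summable_on UNIV"
      using summable_on_Sigma_banach[OF Tsum[OF \<mu>]] by simp
    then show ?thesis using has_sum_imp_sums has_sum_infsum row[OF \<mu>] by (metis (no_types, lifting) sums_cong)
  qed
  have "(\<Sum>\<^sub>\<infinity>k. \<Sum>\<^sub>\<infinity>j. T (-\<nu>) k j) = (\<Sum>\<^sub>\<infinity>j. \<Sum>\<^sub>\<infinity>k. T (-\<nu>) k j)"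
    using \<nu> by (intro infsum_swap_banach Tsum) simp
  also have "\<dots> = (\<Sum>\<^sub>\<infinity>j. \<Sum>\<^sub>\<infinity>k. - T \<nu> j k)"
  proof -
    have "T (-\<nu>) k j = - T \<nu> j k" for j k
    proof -
      have e: "of_nat j - (- \<nu> + of_nat k) = - (of_nat k - (\<nu> + of_nat j))" by simp
      show ?thesis unfolding T_def e by (simp only: divide_minus_right mult_minus_right times_divide_eq_right mult.commute)
    qed
    then show ?thesis by simp
  qed
  also have "\<dots> = - (\<Sum>\<^sub>\<infinity>k. \<Sum>\<^sub>\<infinity>j. T \<nu> k j)"
    by (simp add: infsum_uminus)
  finally have "(\<Sum>\<^sub>\<infinity>k. \<Sum>\<^sub>\<infinity>j. T (-\<nu>) k j) = - (\<Sum>\<^sub>\<infinity>k. \<Sum>\<^sub>\<infinity>j. T \<nu> k j)" .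
  note sw = this
  have \<nu>': "- \<nu> \<notin> \<int>" using \<nu> by simp
  show ?thesis by (rule that[OF rs[OF \<nu>] rs[OF \<nu>', unfolded sw]])
qed

text \<open>\<open>I\<close> is the modified Bessel function of the first kind, and the value is
  twice the function of the second kind, 2 K_\<nu>(x). The halves \<open>s > 0\<close> and
  \<open>s < 0\<close> are half-line integrals with parameters \<nu> and - \<nu>; their leftover
  double series are \<open>S\<close> and \<open>- S\<close> and cancel.\<close>

lemma bessel_I_minus_bessel_I_integral:
  fixes \<nu> :: complex
  assumes \<nu>: "\<nu> \<notin> \<int>" and x: "x > 0"
  defines "I \<equiv> (\<lambda>\<mu>. of_real (x / 2) powr \<mu> *
     (\<Sum>k. of_real ((x\<^sup>2 / 4) ^ k / fact k) * rGamma (\<mu> + of_nat k + 1)))"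
  shows "has_bochner_integral lborel (\<lambda>s. exp (- of_real (x * cosh s) - \<nu> * of_real s))
    (of_real pi / sin (of_real pi * \<nu>) * (I (-\<nu>) - I \<nu>))"
proof -
  define a where "a = x / 2"
  have a: "a > 0" and xa: "x = 2 * a" using x by (auto simp: a_def)
  define c where "c = (\<lambda>k. complex_of_real ((-a)^k / fact k))"
  define f where "f = (\<lambda>\<mu> s. indicator {0<..} s *\<^sub>R exp (- complex_of_real (2 * a * cosh s) - \<mu> * of_real s))"
  have sin0: "sin (of_real pi * \<mu>) \<noteq> 0" if "\<mu> \<notin> \<int>" for \<mu> :: complex
    using that by (auto simp: sin_eq_0 mult.commute)
  obtain S where S: "(\<lambda>k. c k * inc_gamma_series a (\<nu> + of_nat k)) sums S"
    "(\<lambda>k. c k * inc_gamma_series a (- \<nu> + of_nat k)) sums (- S)"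
    using inc_gamma_series_cancel[OF \<nu> a] unfolding c_def by blast
  \<comment> \<open>The Gamma parts are summed here. Reflection turns
    \<open>Gamma (- (\<mu> + k))\<close> into a multiple of \<open>rGamma (\<mu> + k + 1)\<close>
    with sign \<open>(- 1) ^ k\<close>, which offsets the sign of \<open>(- a) ^ k\<close>; the
    all-positive series of \<open>I \<mu>\<close> results.\<close>
  have half: "integral\<^sup>L lborel (f \<mu>) = - (of_real pi / sin (of_real pi * \<mu>)) * I \<mu> - T"
    if \<mu>: "\<mu> \<notin> \<int>" and T: "(\<lambda>k. c k * inc_gamma_series a (\<mu> + of_nat k)) sums T" for \<mu> T
  proof -
    have "(\<lambda>k. c k * inc_gamma a (\<mu> + of_nat k)) sums integral\<^sup>L lborel (f \<mu>)"
      using bessel_halfline_sums(2)[OF \<mu> a] unfolding c_def f_def .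
    from sums_add[OF this T] have "(\<lambda>k. c k * (of_real a powr (\<mu> + of_nat k) * Gamma (- (\<mu> + of_nat k)))) sums (integral\<^sup>L lborel (f \<mu>) + T)"
      by (simp add: inc_gamma_def algebra_simps)
    from sums_mult[OF this, of "sin (of_real pi * \<mu>) / (- of_real pi * of_real a powr \<mu>)"]
    have "(\<lambda>k. sin (of_real pi * \<mu>) / (- of_real pi * of_real a powr \<mu>) * (c k * (of_real a powr (\<mu> + of_nat k) * Gamma (- (\<mu> + of_nat k)))))
       sums (sin (of_real pi * \<mu>) / (- of_real pi * of_real a powr \<mu>) * (integral\<^sup>L lborel (f \<mu>) + T))" .
    moreover have "sin (of_real pi * \<mu>) / (- of_real pi * of_real a powr \<mu>) * (c k * (of_real a powr (\<mu> + of_nat k) * Gamma (- (\<mu> + of_nat k))))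
        = of_real ((x\<^sup>2 / 4) ^ k / fact k) * rGamma (\<mu> + of_nat k + 1)" for k
    proof -
      define w where "w = - (\<mu> + of_nat k)"
      have "w \<notin> \<int>" using \<mu> unfolding w_def
        by (metis Ints_diff Ints_minus Ints_of_nat add_diff_cancel_right' minus_minus)
      then have "rGamma w \<noteq> 0" by (metis nonpos_Ints_Int rGamma_eq_zero_iff)
      have "rGamma w * rGamma (1 - w) = sin (of_real pi * w) / of_real pi"
        by (rule rGamma_reflection_complex)
      moreover have "sin (of_real pi * w) = - ((-1)^k * sin (of_real pi * \<mu>))"
      proof -
        have "sin (of_real pi * w) = - sin (of_real pi * \<mu> + of_nat k * of_real pi)"
        proof -
          have "of_real pi * w = - (of_real pi * \<mu> + of_nat k * of_real pi)"
            by (simp add: w_def algebra_simps)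
          then show ?thesis by (simp only: sin_minus)
        qed
        also have "\<dots> = - (sin (of_real pi * \<mu>) * cos (of_nat k * of_real pi) + cos (of_real pi * \<mu>) * sin (of_nat k * of_real pi))"
          by (simp add: sin_add)
        also have "cos (of_nat k * of_real pi) = ((-1)^k :: complex)"
          by (metis cos_npi cos_of_real of_real_minus of_real_1 of_real_mult of_real_of_nat_eq of_real_power)
        also have "sin (of_nat k * of_real pi) = (0 :: complex)"
          by (metis sin_npi sin_of_real of_real_0 of_real_mult of_real_of_nat_eq)
        finally show ?thesis by simp
      qed
      ultimately have e1: "rGamma (\<mu> + of_nat k + 1) = - ((-1)^k * sin (of_real pi * \<mu>)) / of_real pi * Gamma w"
        using \<open>rGamma w \<noteq> 0\<close> by (simp add: Gamma_def w_def field_simps)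
      have e2: "of_real a powr (\<mu> + of_nat k) = of_real a powr \<mu> * complex_of_real a ^ k"
        using a by (simp add: powr_add powr_nat')
      have "(-a)^k * a^k = (-1)^k * (x\<^sup>2 / 4)^k"
        by (simp add: xa power_mult_distrib[symmetric] power2_eq_square)
      then have "(-a)^k / fact k * a^k = (-1)^k * ((x\<^sup>2 / 4)^k / fact k)" by simp
      then have "complex_of_real ((-a)^k / fact k * a^k) = of_real ((-1)^k * ((x\<^sup>2 / 4)^k / fact k))" by (rule arg_cong)
      then have e3: "c k * complex_of_real a ^ k = (-1)^k * of_real ((x\<^sup>2 / 4) ^ k / fact k)"
        unfolding c_def of_real_mult[symmetric] of_real_power[symmetric] by simp
      have P: "complex_of_real a powr \<mu> \<noteq> 0" using a by simp
      have "sin (of_real pi * \<mu>) / (- of_real pi * of_real a powr \<mu>) * (c k * (of_real a powr (\<mu> + of_nat k) * Gamma w))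
        = sin (of_real pi * \<mu>) / (- of_real pi * of_real a powr \<mu>) * (of_real a powr \<mu> * ((c k * of_real a ^ k) * Gamma w))"
        unfolding e2 by (simp only: mult_ac)
      also have "\<dots> = of_real ((x\<^sup>2 / 4) ^ k / fact k) * rGamma (\<mu> + of_nat k + 1)"
        unfolding e3 e1 using P by (simp del: of_real_divide of_real_power of_real_mult add: field_simps)
      finally show ?thesis unfolding w_def .
    qed
    ultimately have "(\<lambda>k. of_real ((x\<^sup>2 / 4) ^ k / fact k) * rGamma (\<mu> + of_nat k + 1)) sums (sin (of_real pi * \<mu>) / (- of_real pi * of_real a powr \<mu>) * (integral\<^sup>L lborel (f \<mu>) + T))"
      by (simp only:)
    note sums_unique[OF this, symmetric]
    then have "I \<mu> = sin (of_real pi * \<mu>) / (- of_real pi) * (integral\<^sup>L lborel (f \<mu>) + T)"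
      using a by (simp add: I_def a_def[symmetric])
    then have "integral\<^sup>L lborel (f \<mu>) + T = - (of_real pi / sin (of_real pi * \<mu>)) * I \<mu>"
      using sin0[OF \<mu>] by simp
    then show ?thesis by (simp only: eq_diff_eq)
  qed
  have fi: "integrable lborel (f \<mu>)" if "\<mu> \<notin> \<int>" for \<mu>
    using bessel_halfline_sums(1)[OF that a] unfolding f_def .
  have h1: "has_bochner_integral lborel (f \<nu>) (- (of_real pi / sin (of_real pi * \<nu>)) * I \<nu> - S)"
    using fi[OF \<nu>] half[OF \<nu> S(1)] by (simp add: has_bochner_integral_iff)
  have \<nu>': "- \<nu> \<notin> \<int>" using \<nu> by simp
  have "has_bochner_integral lborel (f (-\<nu>)) (- (of_real pi / sin (of_real pi * (-\<nu>))) * I (-\<nu>) - (- S))"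
    using fi[OF \<nu>'] half[OF \<nu>' S(2)] by (simp add: has_bochner_integral_iff)
  from has_bochner_integral_add[OF h1 has_bochner_integral_reflect[OF this]]
  have H: "has_bochner_integral lborel (\<lambda>s. f \<nu> s + f (-\<nu>) (-s)) (of_real pi / sin (of_real pi * \<nu>) * (I (-\<nu>) - I \<nu>))"
    by (simp add: right_diff_distrib)
  have "AE s in lborel. s \<noteq> (0::real)" by (rule AE_lborel_singleton)
  then have ae: "AE s in lborel. f \<nu> s + f (-\<nu>) (-s) = exp (- of_real (x * cosh s) - \<nu> * of_real s)"
  proof eventually_elim
    case (elim s)
    have "- complex_of_real (2 * a * cosh s) - (-\<nu>) * of_real (-s) = - of_real (x * cosh s) - \<nu> * of_real s"
      by (simp add: xa)
    then have "s < 0 \<Longrightarrow> ?case" unfolding f_def xa using elim by (simp only: cosh_minus) simp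
    moreover have "s > 0 \<Longrightarrow> ?case" unfolding f_def xa by simp
    ultimately show ?case using elim by linarith
  qed
  have m1: "(\<lambda>s. f \<nu> s + f (-\<nu>) (-s)) \<in> borel_measurable lborel"
    using H borel_measurable_integrable unfolding has_bochner_integral_iff by blast
  have m2: "(\<lambda>s. exp (- of_real (x * cosh s) - \<nu> * of_real s)) \<in> borel_measurable lborel"
  proof -
    have "(\<lambda>s. exp (- of_real (x * cosh s) - \<nu> * of_real s)) \<in> borel_measurable borel"
      by (rule borel_measurable_continuous_onI) (intro continuous_intros)
    then show ?thesis by simp
  qed
  show ?thesis
    using H has_bochner_integral_cong_AE[OF m1 m2 ae] by blast
qed

section \<open>The Hankel function on the imaginary axis\<close>


text \<open>The classical relation between J at an imaginary argument and the modified Bessel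
  function I. The phase is the principal power of \<open>\<i>\<close>, in accordance with arg (i t)
  = \<pi> / 2.\<close>

lemma bessel_J_imaginary:
  assumes t: "t > 0"
  shows "bessel_J \<nu> (\<i> * of_real t) = exp (\<i> * of_real pi * \<nu> / 2) *
    (of_real (t / 2) powr \<nu> * (\<Sum>k. of_real ((t\<^sup>2 / 4) ^ k / fact k) * rGamma (\<nu> + of_nat k + 1)))"
proof -
  have "(- 1) ^ k * ((\<i> * complex_of_real t)\<^sup>2 / 4) ^ k / fact k = of_real ((t\<^sup>2 / 4) ^ k / fact k)" for k
  proof -
    have "(- 1) ^ k * ((\<i> * complex_of_real t)\<^sup>2 / 4) ^ k = ((- 1) * ((\<i> * complex_of_real t)\<^sup>2 / 4)) ^ k"
      by (simp only: power_mult_distrib)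
    also have "(- 1) * ((\<i> * complex_of_real t)\<^sup>2 / 4) = of_real (t\<^sup>2 / 4)"
      by (simp add: power_mult_distrib)
    finally show ?thesis by simp
  qed
  moreover have "(\<i> * complex_of_real t / 2) powr \<nu> = exp (\<i> * of_real pi * \<nu> / 2) * of_real (t / 2) powr \<nu>"
  proof -
    have "(\<i> * complex_of_real t / 2) = of_real (t / 2) * \<i>" by simp
    then have "(\<i> * complex_of_real t / 2) powr \<nu> = of_real (t / 2) powr \<nu> * \<i> powr \<nu>"
      using t by (simp only:) (simp add: powr_times_real_left del: of_real_divide)
    also have "\<i> powr \<nu> = exp (\<i> * of_real pi * \<nu> / 2)"
      by (simp add: powr_def mult_ac)
    finally show ?thesis by simp
  qed
  ultimately show ?thesis by (simp add: bessel_J_def)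
qed

text \<open>The Schlaefli integrand \<open>exp (\<i> * t * (sinh u - u) + \<kappa> * u)\<close> on
  the line \<open>u = s + \<i> * pi / 2\<close>, where
  \<open>sinh u = \<i> * cosh s\<close>.\<close>

definition hankel_integrand :: "complex \<Rightarrow> real \<Rightarrow> real \<Rightarrow> complex" where
  "hankel_integrand \<kappa> t s = exp (- of_real t * (of_real (cosh s) + \<i> * of_real s - of_real (pi / 2))
     + \<kappa> * (of_real s + \<i> * of_real (pi / 2)))"

definition hankel_integral :: "complex \<Rightarrow> real \<Rightarrow> complex" where
  "hankel_integral \<kappa> t = 1 / (of_real pi * \<i>) * integral\<^sup>L lborel (hankel_integrand \<kappa> t)"

text \<open>At a non-integer order \<open>bessel_Y\<close> is its defining quotient, and the Hankel
  function reduces to a multiple of K with factor \<open>exp (- \<i> * pi * \<nu> / 2)\<close>. For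
  the order \<open>\<nu> = \<i> * t - \<kappa>\<close> this factor produces the summands
  \<open>t * pi / 2\<close> and \<open>\<kappa> * \<i> * pi / 2\<close> in the exponent of
  \<open>hankel_integrand\<close>.\<close>

lemma hankel1_imaginary:
  assumes t: "t > 0" and \<nu>: "\<i> * of_real t - \<kappa> \<notin> \<int>"
  shows "hankel1 (\<i> * of_real t - \<kappa>) (\<i> * of_real t) = hankel_integral \<kappa> t"
proof -
  define \<nu> where "\<nu> = \<i> * of_real t - \<kappa>"
  define I where "I = (\<lambda>\<mu>::complex. of_real (t / 2) powr \<mu> *
     (\<Sum>k. of_real ((t\<^sup>2 / 4) ^ k / fact k) * rGamma (\<mu> + of_nat k + 1)))"
  have \<nu>': "\<nu> \<notin> \<int>" using \<nu> by (simp add: \<nu>_def)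
  have J: "bessel_J \<mu> (\<i> * of_real t) = exp (\<i> * of_real pi * \<mu> / 2) * I \<mu>" for \<mu>
    unfolding I_def by (rule bessel_J_imaginary[OF t])
  have "sin (\<nu> * of_real pi) \<noteq> 0"
    using \<nu>' by (auto simp: sin_eq_0)
  define E where "E = exp (\<i> * of_real pi * \<nu> / 2)"
  have E0: "E \<noteq> 0" and E': "exp (\<i> * of_real pi * (-\<nu>) / 2) = 1 / E"
    by (auto simp: E_def exp_minus field_simps)
  have E2: "cos (\<nu> * of_real pi) - \<i> * sin (\<nu> * of_real pi) = 1 / E\<^sup>2"
  proof -
    have "E\<^sup>2 = exp (\<i> * (\<nu> * of_real pi))"
      by (simp add: E_def power2_eq_square exp_add[symmetric] mult_ac)
    then have "1 / E\<^sup>2 = exp (\<i> * (- (\<nu> * of_real pi)))" by (simp add: exp_minus field_simps)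
    also have "\<dots> = cos (\<nu> * of_real pi) - \<i> * sin (\<nu> * of_real pi)"
      unfolding exp_Euler by simp
    finally show ?thesis by simp
  qed
  have "hankel1 \<nu> (\<i> * of_real t) = E * I \<nu> + \<i> * ((E * I \<nu> * cos (\<nu> * of_real pi) - I (-\<nu>) / E) / sin (\<nu> * of_real pi))"
    using \<nu>' by (simp add: hankel1_def bessel_Y_def bessel_Y_quot_def J E_def[symmetric] E'[simplified])
  also have "\<dots> = \<i> * (E * I \<nu> * (cos (\<nu> * of_real pi) - \<i> * sin (\<nu> * of_real pi)) - I (-\<nu>) / E) / sin (\<nu> * of_real pi)"
    using \<open>sin (\<nu> * of_real pi) \<noteq> 0\<close> by (simp add: field_simps)
  also have "\<dots> = \<i> * (I \<nu> - I (-\<nu>)) / (E * sin (\<nu> * of_real pi))"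
    unfolding E2 using \<open>sin (\<nu> * of_real pi) \<noteq> 0\<close> E0 by (simp add: field_simps power2_eq_square)
  finally have 1: "hankel1 \<nu> (\<i> * of_real t) = \<i> * (I \<nu> - I (-\<nu>)) / (E * sin (\<nu> * of_real pi))" .
  have B: "has_bochner_integral lborel (\<lambda>s. exp (- of_real (t * cosh s) - \<nu> * of_real s))
    (of_real pi / sin (of_real pi * \<nu>) * (I (-\<nu>) - I \<nu>))"
    unfolding I_def by (rule bessel_I_minus_bessel_I_integral[OF \<nu>' t])
  have "has_bochner_integral lborel (\<lambda>s. 1 / E * exp (- of_real (t * cosh s) - \<nu> * of_real s))
    (1 / E * (of_real pi / sin (of_real pi * \<nu>) * (I (-\<nu>) - I \<nu>)))"
    by (rule has_bochner_integral_mult_right[OF B])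
  moreover have "1 / E * exp (- of_real (t * cosh s) - \<nu> * of_real s)
     = hankel_integrand \<kappa> t s" for s
  proof -
    have "- (\<i> * of_real pi * \<nu> / 2) + (- of_real (t * cosh s) - \<nu> * of_real s)
       = - of_real t * (of_real (cosh s) + \<i> * of_real s - of_real (pi / 2))
        + \<kappa> * (of_real s + \<i> * of_real (pi / 2))"
      unfolding \<nu>_def by (simp add: field_simps)
    moreover have "1 / E = exp (- (\<i> * of_real pi * \<nu> / 2))" by (simp add: E_def exp_minus field_simps)
    ultimately show ?thesis by (simp only: hankel_integrand_def exp_add[symmetric])
  qed
  ultimately have B': "has_bochner_integral lborel (hankel_integrand \<kappa> t) (1 / E * (of_real pi / sin (of_real pi * \<nu>) * (I (-\<nu>) - I \<nu>)))"
    by simp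
  have "hankel_integral \<kappa> t = 1 / (of_real pi * \<i>) * (1 / E * (of_real pi / sin (of_real pi * \<nu>) * (I (-\<nu>) - I \<nu>)))"
    unfolding hankel_integral_def using has_bochner_integral_integral_eq[OF B'] by simp
  also have "\<dots> = \<i> * (I \<nu> - I (-\<nu>)) / (E * sin (\<nu> * of_real pi))"
  proof -
    have "1 / (p * \<i>) * (1 / E * (p / s * (X - Y))) = \<i> * (Y - X) / (E * s)"
      if "p \<noteq> 0" "s \<noteq> 0" for p s X Y :: complex
      using that E0 by (simp add: field_simps)
    from this[of "of_real pi" "sin (\<nu> * of_real pi)"] show ?thesis
      using \<open>sin (\<nu> * of_real pi) \<noteq> 0\<close> by (simp only: mult.commute[of "of_real pi" \<nu>]) simp
  qed
  finally show "hankel1 (\<i> * of_real t - \<kappa>) (\<i> * of_real t) = hankel_integral \<kappa> t"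
    using 1 by (simp add: \<nu>_def)
qed

section \<open>The cube root of 6 (sinh t - t)\<close>


lemma Re_sinh: "Re (sinh z) = sinh (Re z) * cos (Im z)"
  and Im_sinh: "Im (sinh z) = cosh (Re z) * sin (Im z)"
  by (simp_all add: sinh_def cosh_def Re_exp Im_exp field_simps)

lemma sinh_le_mult_cosh: "sinh x \<le> x * cosh x" if "x \<ge> 0" for x :: real
proof -
  have "(\<lambda>x. x * cosh x - sinh x) 0 \<le> (\<lambda>x. x * cosh x - sinh x) x"
  proof (rule DERIV_nonneg_imp_nondecreasing[OF that])
    fix y :: real assume "0 \<le> y" "y \<le> x"
    then show "\<exists>d. ((\<lambda>x. x * cosh x - sinh x) has_real_derivative d) (at y) \<and> 0 \<le> d"
      by (intro exI[of _ "y * sinh y"]) (auto intro!: derivative_eq_intros)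
  qed
  then show ?thesis by simp
qed

lemma mult_cos_less_sin: "x * cos x < sin x" if "0 < x" "x < pi" for x :: real
proof -
  have "(\<lambda>x. sin x - x * cos x) 0 < (\<lambda>x. sin x - x * cos x) x"
  proof (rule DERIV_pos_imp_increasing_open[OF that(1)])
    fix y :: real assume "0 < y" "y < x"
    then show "\<exists>d. ((\<lambda>x. sin x - x * cos x) has_real_derivative d) (at y) \<and> 0 < d"
      using that by (intro exI[of _ "y * sin y"]) (auto intro!: derivative_eq_intros mult_pos_pos sin_gt_zero)
  qed (auto intro!: continuous_intros)
  then show ?thesis by simp
qed

lemma sin_less_self: "sin x < x" if "0 < x" "x < 2 * pi" for x :: real
proof -
  have "(\<lambda>x. x - sin x) 0 < (\<lambda>x. x - sin x) x"
  proof (rule DERIV_pos_imp_increasing_open[OF that(1)])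
    fix y :: real assume y: "0 < y" "y < x"
    have "sin (y / 2) > 0" using y that by (intro sin_gt_zero) auto
    then have "cos (2 * (y / 2)) < 1" unfolding cos_double_sin by simp
    then show "\<exists>d. ((\<lambda>x. x - sin x) has_real_derivative d) (at y) \<and> 0 < d"
      by (intro exI[of _ "1 - cos y"]) (auto intro!: derivative_eq_intros)
  qed (auto intro!: continuous_intros)
  then show ?thesis by simp
qed

lemma self_less_sinh: "x < sinh x" if "0 < x" for x :: real
proof -
  have "(\<lambda>x. sinh x - x) 0 < (\<lambda>x. sinh x - x) x"
  proof (rule DERIV_pos_imp_increasing_open[OF that(1)])
    fix y :: real assume y: "0 < y" "y < x"
    have "cosh 0 < cosh y" using y by (subst cosh_real_nonneg_less_iff) auto
    then show "\<exists>d. ((\<lambda>x. sinh x - x) has_real_derivative d) (at y) \<and> 0 < d"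
      by (intro exI[of _ "cosh y - 1"]) (auto intro!: derivative_eq_intros)
  qed (auto intro!: continuous_intros)
  then show ?thesis by simp
qed

text \<open>Wide enough for the lines at height 3 \<pi> / 2, and within the range
  \<open>0 < y < 2 * pi\<close> where \<open>sin y < y\<close> is available to exclude zeros on the
  imaginary axis.\<close>

definition strip :: "complex set" where
  "strip = {z. \<bar>Im z\<bar> < 2 * pi}"

lemma strip_open: "open strip" and strip_convex: "convex strip" and zero_in_strip: "0 \<in> strip"
proof -
  have e: "strip = {z. Im z < 2 * pi} \<inter> {z. Im z > - (2 * pi)}" by (auto simp: strip_def)
  show "open strip" unfolding e by (intro open_Int open_halfspace_Im_lt open_halfspace_Im_gt)
  show "convex strip" unfolding e by (intro convex_Int convex_halfspace_Im_lt convex_halfspace_Im_gt)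
qed (simp add: strip_def)

text \<open>With \<open>x\<close> and \<open>y\<close> the absolute values of the two parts, a zero
  satisfies \<open>sinh x * cos y = x\<close> and \<open>cosh x * sin y = y\<close>. If both are
  positive, then \<open>y < pi\<close>, and the quantity \<open>cosh x * cos y\<close> is at least 1
  by \<open>sinh x \<le> x * cosh x\<close> but below 1 by \<open>y * cos y < sin y\<close>. The
  axes are settled by \<open>sin y < y\<close> and \<open>x < sinh x\<close>.\<close>

lemma sinh_neq_self:
  assumes "z \<in> strip" "z \<noteq> 0"
  shows "sinh z \<noteq> z"
proof
  assume eq: "sinh z = z"
  define x y where "x = \<bar>Re z\<bar>" and "y = \<bar>Im z\<bar>"
  have "sinh (Re z) * cos (Im z) = Re z" "cosh (Re z) * sin (Im z) = Im z"
    using eq Re_sinh[of z] Im_sinh[of z] by simp_all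
  then have 1: "sinh x * cos y = x" "cosh x * sin y = y"
    unfolding x_def y_def by (auto simp: abs_if)
  have y2: "y < 2 * pi" "x \<ge> 0" "y \<ge> 0" using assms by (auto simp: strip_def x_def y_def)
  have "cosh x \<ge> 1" by (rule cosh_real_ge_1)
  have "x \<noteq> 0"
  proof
    assume "x = 0"
    then have "sin y = y" using 1 by simp
    then have "y = 0" using y2 sin_less_self[of y] by force
    with \<open>x = 0\<close> assms(2) show False by (simp add: x_def y_def complex_eq_iff)
  qed
  then have x: "x > 0" using y2 by simp
  then have "sinh x > 0" by simp
  then have c: "cos y > 0" using 1(1) x by (metis zero_less_mult_pos)
  show False
  proof (cases "y = 0")
    case True
    then have "sinh x = x" using 1 by simp
    moreover have "x < sinh x" using x by (rule self_less_sinh)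
    ultimately show False by simp
  next
    case False
    then have y: "y > 0" using y2 by simp
    then have s: "sin y > 0" using 1(2) by (metis cosh_real_pos zero_less_mult_pos)
    have "y < pi"
    proof (rule ccontr)
      assume "\<not> y < pi"
      then have "sin y \<le> 0" using y2 sin_le_zero[of y] by simp
      with s show False by simp
    qed
    then have "y * cos y < sin y" using mult_cos_less_sin y by blast
    then have "cosh x * (y * cos y) < y" using 1(2) \<open>cosh x \<ge> 1\<close>
      by (metis cosh_real_pos mult_strict_left_mono)
    then have "cosh x * cos y < 1" using y by (simp add: mult.left_commute)
    moreover have "cosh x * cos y \<ge> 1"
    proof -
      have "sinh x * (cosh x * cos y) = (sinh x * cos y) * cosh x" by simp
      also have "\<dots> = x * cosh x" using 1(1) by simp
      finally have "sinh x * 1 \<le> sinh x * (cosh x * cos y)" using sinh_le_mult_cosh[of x] x by linarith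
      then show ?thesis using \<open>sinh x > 0\<close> mult_le_cancel_left_pos by blast
    qed
    ultimately show False by simp
  qed
qed

section \<open>The holomorphic branch on the strip\<close>

lemma sinh_minus_self_over_cube_holomorphic:
  "(\<lambda>t::complex. if t = 0 then 1 / 6 else (sinh t - t) / t ^ 3) holomorphic_on S"
proof -
  define a :: "nat \<Rightarrow> complex" where "a = (\<lambda>n. if even n then 1 / fact (n + 3) else 0)"
  let ?g = "\<lambda>t::complex. if t = 0 then 1 / 6 else (sinh t - t) / t ^ 3"
  have sums: "(\<lambda>n. a n * t ^ n) sums ?g t" for t :: complex
  proof (cases "t = 0")
    case True
    have "(\<lambda>n. a n * 0 ^ n) sums a 0" by (rule powser_sums_zero)
    then show ?thesis using True by (simp add: a_def fact_numeral)
  next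
    case False
    have "(\<lambda>n. if even (n + 3) then 0 else t ^ (n + 3) /\<^sub>R fact (n + 3)) sums
       (sinh t - (\<Sum>n<3. if even n then 0 else t ^ n /\<^sub>R fact n))"
      using sums_split_initial_segment[OF sinh_converges[of t], of 3] by simp
    also have "(\<Sum>n<3. if even n then 0 else t ^ n /\<^sub>R fact n) = t"
      by (simp add: numeral_3_eq_3)
    finally have "(\<lambda>n. (if even (n + 3) then 0 else t ^ (n + 3) /\<^sub>R fact (n + 3)) / t ^ 3) sums ((sinh t - t) / t ^ 3)"
      by (rule sums_divide)
    moreover have "(if even (n + 3) then 0 else t ^ (n + 3) /\<^sub>R fact (n + 3)) / t ^ 3 = a n * t ^ n" for n
      using False by (auto simp: a_def power_add scaleR_conv_of_real field_simps)
    ultimately show ?thesis using False by simp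
  qed
  have "?g holomorphic_on ball 0 r" for r
    by (rule power_series_holomorphic[where a = a]) (use sums in simp)
  then have "?g holomorphic_on (\<Union>r. ball 0 r)"
    by (intro holomorphic_on_UN_open) auto
  moreover have "(\<Union>r. ball 0 r) = (UNIV :: complex set)"
    by (auto intro: gt_ex)
  ultimately show ?thesis by (metis holomorphic_on_subset subset_UNIV)
qed

lemma B_base_holomorphic: "B_base holomorphic_on strip"
  and B_base_nonzero: "t \<in> strip \<Longrightarrow> B_base t \<noteq> 0"
proof -
  let ?g = "\<lambda>t::complex. if t = 0 then 1 / 6 else (sinh t - t) / t ^ 3"
  have nz: "?g t \<noteq> 0" if "t \<in> strip" for t using sinh_neq_self that by auto
  have "(\<lambda>t. 1 / (6 * ?g t)) holomorphic_on strip"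
    by (intro holomorphic_intros sinh_minus_self_over_cube_holomorphic) (use nz in auto)
  moreover have "B_base = (\<lambda>t. 1 / (6 * ?g t))" by (auto simp: B_base_def)
  ultimately show "B_base holomorphic_on strip" by simp
  show "B_base t \<noteq> 0" if "t \<in> strip"
    using nz[OF that] by (auto simp: B_base_def)
qed

lemma B_base_minus: "B_base (- t) = B_base t"
proof -
  have "(- t) ^ 3 / (sinh (- t) - (- t)) = (- (t ^ 3)) / (- (sinh t - t))"
    by (simp add: power3_eq_cube)
  also have "\<dots> = t ^ 3 / (sinh t - t)" by (simp only: divide_minus_left divide_minus_right minus_minus)
  finally show ?thesis unfolding B_base_def by simp
qed

text \<open>A zero-free holomorphic function on a convex set has a logarithm. Subtracting its value
  at 0, whose exponential is 1, leaves the exponential unchanged and selects the branch that is 1 at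
  the origin.\<close>

lemma B_base_log_exists:
  "\<exists>L. L holomorphic_on strip \<and> L 0 = 0 \<and> (\<forall>t\<in>strip. B_base t = exp (L t))"
proof -
  obtain g where g: "g holomorphic_on strip" "\<And>z. z \<in> strip \<Longrightarrow> B_base z = exp (g z)"
    using contractible_imp_holomorphic_log[OF B_base_holomorphic convex_imp_contractible[OF strip_convex] B_base_nonzero]
    by blast
  have "exp (g 0) = 1" using g(2)[OF zero_in_strip] by (simp add: B_base_def)
  then show ?thesis using g
    by (intro exI[of _ "\<lambda>t. g t - g 0"]) (auto intro!: holomorphic_intros simp: exp_diff)
qed

definition B_log :: "complex \<Rightarrow> complex" where
  "B_log = (SOME L. L holomorphic_on strip \<and> L 0 = 0 \<and> (\<forall>t\<in>strip. B_base t = exp (L t)))"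

lemma B_log: "B_log holomorphic_on strip" "B_log 0 = 0" "t \<in> strip \<Longrightarrow> B_base t = exp (B_log t)"
  using someI_ex[OF B_base_log_exists, folded B_log_def] by auto

text \<open>\<open>cbrt_sinh\<close> is the branch of \<open>(6 (sinh t - t)) powr (1 / 3)\<close> with derivative \<open>1\<close> at the origin.\<close>

definition cbrt_base :: "complex \<Rightarrow> complex" where "cbrt_base t = exp (B_log t / 3)"
definition cbrt_sinh :: "complex \<Rightarrow> complex" where "cbrt_sinh t = t / cbrt_base t"

lemma cbrt_base_holomorphic: "cbrt_base holomorphic_on strip"
  unfolding cbrt_base_def by (intro holomorphic_intros B_log)  simp

lemma cbrt_base_nonzero [simp]: "cbrt_base t \<noteq> 0" by (simp add: cbrt_base_def)
lemma cbrt_base_0 [simp]: "cbrt_base 0 = 1" by (simp add: cbrt_base_def B_log)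
lemma cbrt_sinh_0 [simp]: "cbrt_sinh 0 = 0" by (simp add: cbrt_sinh_def)
lemma cbrt_sinh_eq_0_iff [simp]: "cbrt_sinh t = 0 \<longleftrightarrow> t = 0" by (simp add: cbrt_sinh_def)

lemma cbrt_base_cube: "t \<in> strip \<Longrightarrow> cbrt_base t ^ 3 = B_base t"
  by (simp add: cbrt_base_def B_log exp_of_nat_mult[symmetric])

lemma cbrt_sinh_cube: 
  assumes "t \<in> strip"
  shows "cbrt_sinh t ^ 3 = 6 * (sinh t - t)"
  using assms sinh_neq_self[OF assms] by (auto simp: cbrt_sinh_def power_divide cbrt_base_cube B_base_def)

lemma cbrt_sinh_holomorphic: "cbrt_sinh holomorphic_on strip"
  unfolding cbrt_sinh_def by (intro holomorphic_intros cbrt_base_holomorphic) simp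

lemma deriv_cbrt_sinh_0: "deriv cbrt_sinh 0 = 1"
proof -
  have "(cbrt_base has_field_derivative deriv cbrt_base 0) (at 0)"
    using cbrt_base_holomorphic strip_open zero_in_strip holomorphic_derivI by blast
  then have "(cbrt_sinh has_field_derivative 1) (at 0)"
    unfolding cbrt_sinh_def by (auto intro!: derivative_eq_intros)
  then show ?thesis by (rule DERIV_imp_deriv)
qed

text \<open>The quotient takes values among the finitely many roots of unity and is continuous, so
  it is constant. This identifies the branch \<open>cbrt_base\<close>, obtained from an abstract
  logarithm, with explicit principal powers along segments, lines and rays, given agreement at one
  point.\<close>

lemma powers_eq_on_connected:
  fixes f g :: "'a :: topological_space \<Rightarrow> complex"
  assumes "connected S" "continuous_on S f" "continuous_on S g" 
    and "\<And>z. z \<in> S \<Longrightarrow> g z \<noteq> 0" "\<And>z. z \<in> S \<Longrightarrow> f z ^ n = g z ^ n" "n > 0"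
    and "a \<in> S" "f a = g a" "z \<in> S"
  shows "f z = g z"
proof -
  have "(\<lambda>z. f z / g z) constant_on S"
  proof (rule continuous_finite_range_constant[OF assms(1)])
    show "continuous_on S (\<lambda>z. f z / g z)" using assms by (intro continuous_intros) auto
    have "(\<lambda>z. f z / g z) ` S \<subseteq> {w. w ^ n = 1}"
      using assms(4,5) by (auto simp: power_divide)
    then show "finite ((\<lambda>z. f z / g z) ` S)"
      by (rule finite_subset) (use assms(6) in \<open>intro finite_roots_unity, auto\<close>)
  qed
  then have "f z / g z = f a / g a" using assms unfolding constant_on_def by metis
  then show ?thesis using assms by (simp add: field_simps)
qed

lemma cbrt_base_minus:
  assumes "t \<in> strip"
  shows "cbrt_base (- t) = cbrt_base t"
proof (rule powers_eq_on_connected[where f = "\<lambda>t. cbrt_base (-t)" and g = cbrt_base and S = strip and n = 3 and a = 0])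
  have m: "uminus ` strip \<subseteq> strip" by (auto simp: strip_def)
  show "continuous_on strip (\<lambda>t. cbrt_base (- t))"
    by (rule continuous_on_compose2[OF holomorphic_on_imp_continuous_on[OF cbrt_base_holomorphic] _ m])
       (intro continuous_intros)
  show "cbrt_base (- z) ^ 3 = cbrt_base z ^ 3" if "z \<in> strip" for z
    using that by (simp add: cbrt_base_cube B_base_minus strip_def)
qed (use assms zero_in_strip in \<open>auto intro: convex_connected strip_convex holomorphic_on_imp_continuous_on cbrt_base_holomorphic\<close>)

lemma cbrt_sinh_minus: "t \<in> strip \<Longrightarrow> cbrt_sinh (- t) = - cbrt_sinh t"
  by (simp add: cbrt_sinh_def cbrt_base_minus)

text \<open>Near 0 the imaginary part of \<open>B_log\<close> is below \<pi> in absolute value, so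
  \<open>Ln\<close> inverts \<open>exp\<close> there and the principal power in the definition of
  \<open>B\<close> is a power of \<open>cbrt_base\<close>. Derivatives at 0 see only this
  neighbourhood.\<close>

lemma B_eq_higher_deriv:
  "B n \<kappa> = (deriv ^^ n) (\<lambda>t. exp (\<kappa> * t) * cbrt_base t ^ (n + 1)) 0 / fact n"
proof -
  have "isCont B_log 0"
    using B_log(1) strip_open zero_in_strip holomorphic_on_imp_continuous_on continuous_on_eq_continuous_at by blast
  then have "(B_log \<longlongrightarrow> 0) (nhds 0)"
    unfolding isCont_def using B_log(2) tendsto_at_iff_tendsto_nhds by (metis)
  then have "\<forall>\<^sub>F t in nhds 0. B_log t \<in> ball 0 pi"
    by (rule topological_tendstoD) auto
  moreover have "\<forall>\<^sub>F t in nhds 0. t \<in> strip"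
    using strip_open zero_in_strip by (rule eventually_nhds_in_open)
  ultimately have "\<forall>\<^sub>F t in nhds 0. exp (\<kappa> * t) * B_base t powr (of_nat (n + 1) / 3) = exp (\<kappa> * t) * cbrt_base t ^ (n + 1)"
  proof eventually_elim
    case (elim t)
    have "\<bar>Im (B_log t)\<bar> < pi" using elim(1) abs_Im_le_cmod[of "B_log t"] by simp
    then have "Ln (exp (B_log t)) = B_log t" by (intro Ln_exp) auto
    then have "B_base t powr (of_nat (n + 1) / 3) = exp (of_nat (n + 1) / 3 * B_log t)"
      using B_log(3)[OF elim(2)] by (simp add: powr_def)
    also have "\<dots> = cbrt_base t ^ (n + 1)"
      unfolding cbrt_base_def exp_of_nat_mult[symmetric] by simp
    finally show ?case by simp
  qed
  then show ?thesis unfolding B_def by (subst higher_deriv_cong_ev[OF _ refl]) auto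
qed

text \<open>Consequence of \<open>cbrt_base\<close> being even. The sign is what later lets the
  contributions of \<kappa> and - \<kappa> merge into one cosine.\<close>

lemma B_minus: "B n (- \<kappa>) = (- 1) ^ n * B n \<kappa>"
proof -
  define f where "f = (\<lambda>t. exp (\<kappa> * t) * cbrt_base t ^ (n + 1))"
  have f: "f holomorphic_on strip" unfolding f_def
    by (intro holomorphic_intros cbrt_base_holomorphic)
  have "(deriv ^^ n) (\<lambda>t. exp (- \<kappa> * t) * cbrt_base t ^ (n + 1)) 0 = (deriv ^^ n) (\<lambda>t. f ((- 1) * t)) 0"
  proof (rule higher_deriv_cong_ev)
    have "\<forall>\<^sub>F t in nhds 0. t \<in> strip"
      using strip_open zero_in_strip by (rule eventually_nhds_in_open)
    then show "\<forall>\<^sub>F t in nhds 0. exp (- \<kappa> * t) * cbrt_base t ^ (n + 1) = f (- 1 * t)"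
      by eventually_elim (simp add: f_def cbrt_base_minus)
  qed simp
  also have "\<dots> = (- 1) ^ n * (deriv ^^ n) f ((- 1) * 0)"
    by (rule higher_deriv_compose_linear[OF f strip_open strip_open zero_in_strip]) (auto simp: strip_def)
  finally show ?thesis by (simp add: B_eq_higher_deriv f_def)
qed

section \<open>Contour integrals for B\<close>


definition B_kernel :: "nat \<Rightarrow> complex \<Rightarrow> complex \<Rightarrow> complex" where
  "B_kernel n \<kappa> t = exp (\<kappa> * t) / cbrt_sinh t ^ (n + 1)"

lemma B_kernel_holomorphic: "B_kernel n \<kappa> holomorphic_on strip - {0}"
  unfolding B_kernel_def
  by (intro holomorphic_intros holomorphic_on_subset[OF cbrt_sinh_holomorphic]) auto

lemma residue_B_kernel: "residue (B_kernel n \<kappa>) 0 = B n \<kappa>"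
proof -
  have "(\<lambda>t. exp (\<kappa> * t) * cbrt_base t ^ (n + 1)) holomorphic_on strip"
    by (intro holomorphic_intros cbrt_base_holomorphic)
  from residue_holomorphic_over_power'[OF strip_open zero_in_strip this, of n]
  have "residue (\<lambda>z. exp (\<kappa> * z) * cbrt_base z ^ (n + 1) / z ^ Suc n) 0 = B n \<kappa>"
    by (simp only: B_eq_higher_deriv)
  moreover have "B_kernel n \<kappa> = (\<lambda>z. exp (\<kappa> * z) * cbrt_base z ^ (n + 1) / z ^ Suc n)"
    by (simp add: B_kernel_def cbrt_sinh_def power_divide fun_eq_iff)
  ultimately show ?thesis by simp
qed

lemma contour_integral_horizontal:
  fixes f :: "complex \<Rightarrow> complex" and R y :: real
  assumes "R > 0"
  shows "contour_integral (linepath (Complex (- R) y) (Complex R y)) f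
    = integral {- R..R} (\<lambda>x. f (Complex x y))"
proof -
  have "contour_integral (linepath (Complex (- R) y) (Complex R y)) f
      = contour_integral (linepath (of_real (- R)) (of_real R)) (\<lambda>z. f (z + \<i> * of_real y))"
  proof -
    have 1: "linepath (Complex (- R) y) (Complex R y) x = linepath (of_real (- R)) (of_real R) x + \<i> * of_real y" for x
      by (simp add: linepath_def complex_eq_iff algebra_simps)
    have 2: "Complex R y - Complex (- R) y = of_real R - of_real (- R)"
      by (simp add: complex_eq_iff)
    show ?thesis
      unfolding contour_integral_integral vector_derivative_linepath_at 1 2 ..
  qed
  also have "\<dots> = integral {- R..R} (\<lambda>x. f (of_real x + \<i> * of_real y))"
    using assms by (subst contour_integral_linepath_Reals_eq) auto
  finally show ?thesis by (simp add: Complex_eq)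
qed

lemma B_kernel_rectangle:
  fixes R y :: real
  assumes R: "R > 0" and y: "0 < y" "y < 2 * pi"
  shows "integral {-R..R} (\<lambda>x. B_kernel n \<kappa> (Complex x (-y))) - integral {-R..R} (\<lambda>x. B_kernel n \<kappa> (Complex x y))
     + contour_integral (linepath (Complex R (-y)) (Complex R y)) (B_kernel n \<kappa>)
     + contour_integral (linepath (Complex (-R) y) (Complex (-R) (-y))) (B_kernel n \<kappa>)
     = 2 * of_real pi * \<i> * B n \<kappa>"
proof -
  define a1 a2 a3 a4 where a: "a1 = Complex (-R) (-y)" "a2 = Complex R (-y)" "a3 = Complex R y" "a4 = Complex (-R) y"
  define f where "f = B_kernel n \<kappa>"
  have rp: "rectpath a1 a3 = linepath a1 a2 +++ linepath a2 a3 +++ linepath a3 a4 +++ linepath a4 a1"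
    by (simp add: rectpath_def a Let_def)
  have pim: "path_image (rectpath a1 a3) \<subseteq> strip - {0}"
    using R y by (auto simp: path_image_rectpath a strip_def)
  have box: "0 \<in> box a1 a3" using R y by (simp add: a in_box_complex_iff)
  have out: "winding_number (rectpath a1 a3) z = 0" if "z \<notin> strip" for z
    using R y that by (intro winding_number_rectpath_outside) (auto simp: a strip_def in_cbox_complex_iff)
  have "contour_integral (rectpath a1 a3) f = 2 * pi * \<i> * (\<Sum>p\<in>{0}. winding_number (rectpath a1 a3) p * residue f p)"
    by (rule Residue_theorem[OF strip_open convex_connected[OF strip_convex]])
       (use pim out in \<open>auto simp: f_def intro!: B_kernel_holomorphic\<close>)
  also have "\<dots> = 2 * of_real pi * \<i> * B n \<kappa>"
    using winding_number_rectpath[OF box] by (simp add: f_def residue_B_kernel)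
  finally have 1: "contour_integral (rectpath a1 a3) f = 2 * of_real pi * \<i> * B n \<kappa>" .
  have cont: "continuous_on (strip - {0}) f"
    unfolding f_def using B_kernel_holomorphic holomorphic_on_imp_continuous_on by blast
  have segs: "closed_segment a1 a2 \<subseteq> strip - {0}" "closed_segment a2 a3 \<subseteq> strip - {0}"
     "closed_segment a3 a4 \<subseteq> strip - {0}" "closed_segment a4 a1 \<subseteq> strip - {0}"
    using pim unfolding rp by (simp_all add: path_image_join a)
  have ints: "f contour_integrable_on linepath a1 a2" "f contour_integrable_on linepath a2 a3"
     "f contour_integrable_on linepath a3 a4" "f contour_integrable_on linepath a4 a1"
    using segs by (auto intro!: contour_integrable_continuous_linepath continuous_on_subset[OF cont])
  have 2: "contour_integral (rectpath a1 a3) f = contour_integral (linepath a1 a2) f + contour_integral (linepath a2 a3) f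
      + contour_integral (linepath a3 a4) f + contour_integral (linepath a4 a1) f"
    unfolding rp using ints by (simp add: contour_integral_join contour_integrable_joinI add.assoc)
  \<comment> \<open>The top edge is traversed from right to left, hence the minus sign between the
    two horizontal integrals.\<close>
  have 3: "contour_integral (linepath a3 a4) f = - contour_integral (linepath a4 a3) f"
    using contour_integral_reverse_linepath[of a4 a3 f] segs(3) continuous_on_subset[OF cont]
    by (simp add: closed_segment_commute)
  show ?thesis using 1 unfolding 2 3 unfolding a contour_integral_horizontal[OF R] f_def
    by (simp add: algebra_simps)
qed

section \<open>Decay of the kernel and the vertical sides\<close>

lemma norm_sinh_ge: "sinh \<bar>Re z\<bar> \<le> norm (sinh z)" for z :: complex
proof -
  have "(norm (sinh z))\<^sup>2 = (sinh (Re z))\<^sup>2 * (cos (Im z))\<^sup>2 + (cosh (Re z))\<^sup>2 * (sin (Im z))\<^sup>2"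
    by (simp add: cmod_power2 Re_sinh Im_sinh power_mult_distrib)
  also have "(cosh (Re z))\<^sup>2 = (sinh (Re z))\<^sup>2 + 1"
    by (simp add: cosh_square_eq)
  also have "(sinh (Re z))\<^sup>2 * (cos (Im z))\<^sup>2 + ((sinh (Re z))\<^sup>2 + 1) * (sin (Im z))\<^sup>2 = 
      (sinh (Re z))\<^sup>2 * ((cos (Im z))\<^sup>2 + (sin (Im z))\<^sup>2) + (sin (Im z))\<^sup>2" by (simp only: algebra_simps)
  also have "\<dots> \<ge> (sinh \<bar>Re z\<bar>)\<^sup>2" by simp
  finally show ?thesis by (rule power2_le_imp_le) simp
qed

lemma norm_cbrt_sinh_eq:
  assumes "t \<in> strip" "t \<noteq> 0"
  shows "norm (cbrt_sinh t) = norm (6 * (sinh t - t)) powr (1 / 3)"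
proof -
  have "norm (cbrt_sinh t) ^ 3 = norm (6 * (sinh t - t))"
    by (metis assms(1) cbrt_sinh_cube norm_power)
  then have "norm (6 * (sinh t - t)) powr (1 / 3) = (norm (cbrt_sinh t) powr 3) powr (1 / 3)"
    using assms by (simp add: powr_numeral)
  also have "\<dots> = norm (cbrt_sinh t)" using assms by (simp only: powr_powr) simp
  finally show ?thesis by simp
qed

text \<open>The factor 6 leaves room: \<open>6 * sinh r\<close> grows like \<open>3 * exp r\<close>,
  which exceeds \<open>exp r\<close> by more than the linear contribution of
  \<open>t\<close>.\<close>

lemma norm_sinh_minus_self_large:
  "\<forall>\<^sub>F r in at_top. \<forall>t. \<bar>Re t\<bar> = r \<longrightarrow> \<bar>Im t\<bar> \<le> 3 * pi / 2 \<longrightarrow> exp r \<le> norm (6 * (sinh t - t))"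
proof -
  have "\<forall>\<^sub>F r in at_top. exp r \<le> 6 * (sinh r - (r + 3 * pi / 2)) \<and> r > (0::real)"
    unfolding sinh_field_def by (intro eventually_conj; real_asymp)
  then show ?thesis
  proof (eventually_elim, intro allI impI)
    fix r :: real and t :: complex
    assume r: "exp r \<le> 6 * (sinh r - (r + 3 * pi / 2)) \<and> r > 0" and t: "\<bar>Re t\<bar> = r" "\<bar>Im t\<bar> \<le> 3 * pi / 2"
    have "norm t \<le> r + 3 * pi / 2" using cmod_le[of t] t by linarith
    moreover have "norm (sinh t - t) \<ge> norm (sinh t) - norm t" by (rule norm_triangle_ineq2)
    moreover have "norm (sinh t) \<ge> sinh r" using norm_sinh_ge[of t] t by simp
    ultimately have "norm (sinh t - t) \<ge> sinh r - (r + 3 * pi / 2)" by linarith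
    then show "exp r \<le> norm (6 * (sinh t - t))" using r unfolding norm_mult by simp
  qed
qed

lemma norm_B_kernel_large:
  "\<forall>\<^sub>F r in at_top. \<forall>t. \<bar>Re t\<bar> = r \<longrightarrow> \<bar>Im t\<bar> \<le> 3 * pi / 2 \<longrightarrow>
     norm (B_kernel n \<kappa> t) \<le> exp (\<bar>Im \<kappa>\<bar> * (3 * pi / 2)) * exp (- ((real (n + 1) / 3 - \<bar>Re \<kappa>\<bar>) * r))"
  using norm_sinh_minus_self_large eventually_gt_at_top[of 0]
proof (eventually_elim, intro allI impI)
  fix r :: real and t :: complex
  assume A: "\<forall>t. \<bar>Re t\<bar> = r \<longrightarrow> \<bar>Im t\<bar> \<le> 3 * pi / 2 \<longrightarrow> exp r \<le> norm (6 * (sinh t - t))"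
    and r: "r > 0" and t: "\<bar>Re t\<bar> = r" "\<bar>Im t\<bar> \<le> 3 * pi / 2"
  have "\<bar>Im t\<bar> < 2 * pi" using t(2) pi_gt_zero by linarith
  then have ts: "t \<in> strip" "t \<noteq> 0" using t(1) r by (auto simp: strip_def)
  have "exp r powr (1 / 3) \<le> norm (cbrt_sinh t)"
    unfolding norm_cbrt_sinh_eq[OF ts] using A t by (intro powr_mono2) auto
  then have "exp (r / 3) \<le> norm (cbrt_sinh t)" by (simp add: powr_def)
  then have "exp (r / 3) ^ (n + 1) \<le> norm (cbrt_sinh t) ^ (n + 1)" by (intro power_mono) auto
  then have c: "exp (real (n + 1) / 3 * r) \<le> norm (cbrt_sinh t) ^ (n + 1)"
    unfolding exp_of_nat_mult[symmetric] by simp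
  have "Re (\<kappa> * t) \<le> \<bar>Re \<kappa>\<bar> * r + \<bar>Im \<kappa>\<bar> * (3 * pi / 2)"
  proof -
    have "Re (\<kappa> * t) \<le> \<bar>Re \<kappa> * Re t\<bar> + \<bar>Im \<kappa> * Im t\<bar>" by simp
    also have "\<dots> \<le> \<bar>Re \<kappa>\<bar> * r + \<bar>Im \<kappa>\<bar> * (3 * pi / 2)"
      unfolding abs_mult t(1) using t by (intro add_mono mult_left_mono) auto
    finally show ?thesis .
  qed
  then have "norm (exp (\<kappa> * t)) \<le> exp (\<bar>Im \<kappa>\<bar> * (3 * pi / 2)) * exp (\<bar>Re \<kappa>\<bar> * r)"
    by (simp add: exp_add[symmetric] add.commute)
  then have "norm (B_kernel n \<kappa> t) \<le> (exp (\<bar>Im \<kappa>\<bar> * (3 * pi / 2)) * exp (\<bar>Re \<kappa>\<bar> * r)) / exp (real (n + 1) / 3 * r)"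
    unfolding B_kernel_def norm_divide norm_power using c by (intro frac_le) auto
  also have "\<dots> = exp (\<bar>Im \<kappa>\<bar> * (3 * pi / 2)) * exp (- ((real (n + 1) / 3 - \<bar>Re \<kappa>\<bar>) * r))"
    by (simp add: exp_diff[symmetric] exp_add[symmetric] algebra_simps)
  finally show "norm (B_kernel n \<kappa> t) \<le> exp (\<bar>Im \<kappa>\<bar> * (3 * pi / 2)) * exp (- ((real (n + 1) / 3 - \<bar>Re \<kappa>\<bar>) * r))" .
qed

lemma vertical_B_kernel_tendsto_0:
  assumes \<kappa>: "\<bar>Re \<kappa>\<bar> < (real n + 1) / 3" and s: "\<bar>s\<bar> = 1" and u: "\<bar>u\<bar> = 3 * pi / 2"
  shows "((\<lambda>R. contour_integral (linepath (Complex (s * R) u) (Complex (s * R) (- u))) (B_kernel n \<kappa>)) \<longlongrightarrow> 0) at_top"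
proof (rule Lim_null_comparison)
  let ?C = "\<lambda>R. exp (\<bar>Im \<kappa>\<bar> * (3 * pi / 2)) * exp (- ((real (n + 1) / 3 - \<bar>Re \<kappa>\<bar>) * R))"
  show "\<forall>\<^sub>F R in at_top. norm (contour_integral (linepath (Complex (s * R) u) (Complex (s * R) (- u))) (B_kernel n \<kappa>))
      \<le> ?C R * (3 * pi)"
    using norm_B_kernel_large[of n \<kappa>] eventually_gt_at_top[of 0]
  proof eventually_elim
    case (elim R)
    have seg: "\<bar>Re t\<bar> = R \<and> \<bar>Im t\<bar> \<le> 3 * pi / 2" if "t \<in> closed_segment (Complex (s * R) u) (Complex (s * R) (- u))" for t
      using that elim(2) s u
      by (auto simp: closed_segment_same_Re abs_mult closed_segment_eq_real_ivl split: if_splits)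
    have "continuous_on (strip - {0}) (B_kernel n \<kappa>)"
      using B_kernel_holomorphic holomorphic_on_imp_continuous_on by blast
    moreover have "closed_segment (Complex (s * R) u) (Complex (s * R) (- u)) \<subseteq> strip - {0}"
    proof
      fix t assume "t \<in> closed_segment (Complex (s * R) u) (Complex (s * R) (- u))"
      from seg[OF this] have "\<bar>Re t\<bar> = R" "\<bar>Im t\<bar> < 2 * pi" using pi_gt_zero by linarith+
      then show "t \<in> strip - {0}" using elim(2) by (auto simp: strip_def)
    qed
    ultimately have "B_kernel n \<kappa> contour_integrable_on (linepath (Complex (s * R) u) (Complex (s * R) (- u)))"
      by (intro contour_integrable_continuous_linepath) (rule continuous_on_subset)
    then have "norm (contour_integral (linepath (Complex (s * R) u) (Complex (s * R) (- u))) (B_kernel n \<kappa>))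
       \<le> ?C R * norm (Complex (s * R) (- u) - Complex (s * R) u)"
      using elim seg by (intro contour_integral_bound_linepath) auto
    also have "Complex (s * R) (- u) - Complex (s * R) u = of_real (-2 * u) * \<i>"
      by (simp add: complex_eq_iff)
    also have "norm \<dots> = 3 * pi" using u by (simp add: norm_mult)
    finally show ?case .
  qed
  have "real (n + 1) / 3 - \<bar>Re \<kappa>\<bar> > 0" using \<kappa> by (simp add: add.commute)
  then show "((\<lambda>R. ?C R * (3 * pi)) \<longlongrightarrow> 0) at_top" by real_asymp
qed


section \<open>The kernel on the line at height 3 \<pi> / 2\<close>

lemma integrable_exp_minus_abs:
  assumes "\<delta> > (0::real)"
  shows "integrable lborel (\<lambda>x::real. exp (- (\<delta> * \<bar>x\<bar>)))"
proof -
  have h: "has_bochner_integral lborel (\<lambda>s. indicator {0<..} s *\<^sub>R exp (- (complex_of_real \<delta> * of_real s))) (1 / of_real \<delta>)"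
    by (rule has_bochner_integral_exp_halfline) (use assms in simp)
  have "integrable lborel (\<lambda>s. norm (indicator {0<..} s *\<^sub>R exp (- (complex_of_real \<delta> * of_real s)))
     + norm (indicator {0<..} (-s) *\<^sub>R exp (- (complex_of_real \<delta> * of_real (-s)))))"
    using h has_bochner_integral_reflect[OF h] by (intro Bochner_Integration.integrable_add integrable_norm) (auto simp: has_bochner_integral_iff)
  moreover have "AE s in lborel. s \<noteq> (0::real)" by (rule AE_lborel_singleton)
  then have "AE s in lborel. norm (indicator {0<..} s *\<^sub>R exp (- (complex_of_real \<delta> * of_real s)))
     + norm (indicator {0<..} (-s) *\<^sub>R exp (- (complex_of_real \<delta> * of_real (-s)))) = exp (- (\<delta> * \<bar>s\<bar>))"
    by eventually_elim (auto simp: indicator_def)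
  moreover have "(\<lambda>x::real. exp (- (\<delta> * \<bar>x\<bar>))) \<in> borel_measurable lborel"
    by simp
  ultimately show ?thesis
    by (subst integrable_cong_AE[symmetric]) auto
qed

lemma continuous_on_powr_Re_pos:
  fixes f g :: "'a :: topological_space \<Rightarrow> complex"
  assumes "continuous_on S f" "continuous_on S g" "\<And>x. x \<in> S \<Longrightarrow> Re (f x) > 0"
  shows "continuous_on S (\<lambda>x. f x powr g x)"
proof -
  have nz: "f x \<noteq> 0" if "x \<in> S" for x using assms(3)[OF that] by auto
  have "f x \<notin> \<real>\<^sub>\<le>\<^sub>0" if "x \<in> S" for x
    using assms(3)[OF that] by (auto simp: complex_nonpos_Reals_iff)
  then have "continuous_on S (\<lambda>x. exp (g x * Ln (f x)))"
    by (intro continuous_intros assms) auto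
  then show ?thesis
    using nz by (simp add: powr_def cong: continuous_on_cong)
qed

lemma powr_third_cube: "(w powr (1 / 3)) ^ 3 = w" if "w \<noteq> 0" for w :: complex
  using that by (simp add: powr_def exp_of_nat_mult[symmetric])

lemma tendsto_integral_symmetric:
  fixes g :: "real \<Rightarrow> complex"
  assumes g: "integrable lborel g"
  shows "((\<lambda>R. integral {-R..R} g) \<longlongrightarrow> integral\<^sup>L lborel g) at_top"
proof -
  have "((\<lambda>R. LINT x|lborel. indicator {-R..R} x *\<^sub>R g x) \<longlongrightarrow> integral\<^sup>L lborel g) at_top"
  proof (rule integral_dominated_convergence_at_top[where w = "\<lambda>x. norm (g x)"])
    show "AE x in lborel. ((\<lambda>R. indicator {-R..R} x *\<^sub>R g x) \<longlongrightarrow> g x) at_top"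
    proof (rule AE_I2)
      fix x :: real
      have "\<forall>\<^sub>F R in at_top. indicator {-R..R} x *\<^sub>R g x = g x"
        using eventually_ge_at_top[of "\<bar>x\<bar>"] by eventually_elim (auto simp: indicator_def)
      then show "((\<lambda>R. indicator {-R..R} x *\<^sub>R g x) \<longlongrightarrow> g x) at_top"
        by (rule tendsto_eventually)
    qed
    show "\<forall>\<^sub>F R in at_top. AE x in lborel. norm (indicator {-R..R} x *\<^sub>R g x) \<le> norm (g x)"
      by (intro always_eventually allI AE_I2) (auto simp: indicator_def)
  qed (use g in auto)
  moreover have "(LINT x|lborel. indicator {-R..R} x *\<^sub>R g x) = integral {-R..R} g" for R
  proof -
    have "set_integrable lborel {-R..R} g"
      unfolding set_integrable_def using g by (intro integrable_mult_indicator) auto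
    from set_borel_integral_eq_integral(2)[OF this] show ?thesis
      by (simp add: set_lebesgue_integral_def)
  qed
  ultimately show ?thesis by simp
qed

text \<open>On the imaginary axis \<open>B_base\<close> is a positive real number, so the principal
  cube root is continuous there and must be the chosen branch. The point at height 3 \<pi> / 2 then
  anchors the branch on the whole horizontal line.\<close>

lemma cbrt_base_imaginary:
  assumes "0 \<le> y" "y < 2 * pi"
  shows "cbrt_base (\<i> * of_real y) = B_base (\<i> * of_real y) powr (1 / 3)"
    and "0 < y \<Longrightarrow> B_base (\<i> * of_real y) = of_real (y ^ 3 / (6 * (y - sin y)))"
proof -
  have val: "B_base (\<i> * of_real y) = of_real (y ^ 3 / (6 * (y - sin y)))" if "0 < y" for y
  proof -
    have "sinh (\<i> * of_real y) = \<i> * of_real (sin y)"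
      by (simp add: complex_eq_iff Re_sinh Im_sinh)
    then have "B_base (\<i> * of_real y) = 1 / 6 * ((\<i> * of_real y) ^ 3 / (\<i> * of_real (sin y) - \<i> * of_real y))"
      using that by (simp add: B_base_def)
    also have "(\<i> * of_real y) ^ 3 / (\<i> * of_real (sin y) - \<i> * of_real y) = (- \<i> * of_real y ^ 3) / (- \<i> * (of_real y - of_real (sin y)))"
      by (simp add: power_mult_distrib power3_eq_cube algebra_simps)
    also have "\<dots> = of_real y ^ 3 / (of_real y - of_real (sin y))"
      by (subst mult_divide_mult_cancel_left) auto
    finally show ?thesis by simp
  qed
  then show "0 < y \<Longrightarrow> B_base (\<i> * of_real y) = of_real (y ^ 3 / (6 * (y - sin y)))" .
  have pos: "\<exists>r>0. B_base (\<i> * of_real y) = of_real r" if "y \<in> {0..<2 * pi}" for y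
  proof (cases "y = 0")
    case True then show ?thesis by (intro exI[of _ 1]) (simp add: B_base_def)
  next
    case False
    then have "sin y < y" using that by (intro sin_less_self) auto
    then show ?thesis using val[of y] that False
      by (intro exI[of _ "y ^ 3 / (6 * (y - sin y))"]) auto
  qed
  show "cbrt_base (\<i> * of_real y) = B_base (\<i> * of_real y) powr (1 / 3)"
  proof (rule powers_eq_on_connected[where S = "{0..<2 * pi}" and n = 3 and a = 0
        and f = "\<lambda>y. cbrt_base (\<i> * of_real y)" and g = "\<lambda>y. B_base (\<i> * of_real y) powr (1 / 3)"])
    have im: "(\<lambda>y. \<i> * complex_of_real y) ` {0..<2 * pi} \<subseteq> strip" by (auto simp: strip_def)
    show "continuous_on {0..<2 * pi} (\<lambda>y. cbrt_base (\<i> * of_real y))"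
      by (rule continuous_on_compose2[OF holomorphic_on_imp_continuous_on[OF cbrt_base_holomorphic] _ im])
         (intro continuous_intros)
    have "continuous_on {0..<2 * pi} (\<lambda>y. B_base (\<i> * of_real y))"
      by (rule continuous_on_compose2[OF holomorphic_on_imp_continuous_on[OF B_base_holomorphic] _ im])
         (intro continuous_intros)
    then show "continuous_on {0..<2 * pi} (\<lambda>y. B_base (\<i> * of_real y) powr (1 / 3))"
      using pos by (intro continuous_on_powr_Re_pos continuous_intros) force+
    fix z assume z: "z \<in> {0..<2 * pi}"
    show "B_base (\<i> * of_real z) powr (1 / 3) \<noteq> 0" using pos[OF z] by auto
    have "\<i> * of_real z \<in> strip" using z im by blast
    then show "cbrt_base (\<i> * of_real z) ^ 3 = (B_base (\<i> * of_real z) powr (1 / 3)) ^ 3"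
      using B_base_nonzero by (simp only: cbrt_base_cube powr_third_cube not_False_eq_True)
  qed (use assms in \<open>auto simp: B_base_def\<close>)
qed

text \<open>The vanishing of \<open>cos\<close> at 3 \<pi> / 2 removes the \<open>sinh x\<close>
  part; what remains is \<open>- \<i>\<close> times a number in the right half plane, where
  principal powers are continuous.\<close>

lemma sinh_minus_self_line:
  "sinh (Complex x (3 * pi / 2)) - Complex x (3 * pi / 2) = - \<i> * (of_real (3 * pi / 2 + cosh x) - \<i> * of_real x)"
proof -
  have "sin (3 * pi / 2) = -1" "cos (3 * pi / 2) = 0"
    using sin_3over2_pi cos_3over2_pi by simp_all
  then show ?thesis by (simp add: complex_eq_iff Re_sinh Im_sinh)
qed

lemma line_in_strip: "Complex x (3 * pi / 2) \<in> strip" "Complex x (3 * pi / 2) \<noteq> 0"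
  using pi_gt_zero by (auto simp: strip_def complex_eq_iff)

text \<open>The cubes agree because the cube of \<open>\<i>\<close> is \<open>- \<i>\<close>, and
  both sides are continuous in \<open>x\<close>. Which of the three roots occurs is decided at
  \<open>x = 0\<close>, where the value is known from the imaginary axis.\<close>

lemma cbrt_sinh_line:
  "cbrt_sinh (Complex x (3 * pi / 2)) = \<i> * (6 * (of_real (3 * pi / 2 + cosh x) - \<i> * of_real x)) powr (1 / 3)"
proof (rule powers_eq_on_connected[where S = UNIV and n = 3 and a = 0
      and f = "\<lambda>x. cbrt_sinh (Complex x (3 * pi / 2))"
      and g = "\<lambda>x. \<i> * (6 * (of_real (3 * pi / 2 + cosh x) - \<i> * of_real x)) powr (1 / 3)"])
  have re: "Re (6 * (of_real (3 * pi / 2 + cosh x) - \<i> * of_real x)) > 0" for x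
    using cosh_real_pos[of x] pi_gt_zero by (simp add: add_pos_pos)
  have nz: "6 * (of_real (3 * pi / 2 + cosh x) - \<i> * of_real x) \<noteq> 0" for x
    using re[of x] by (metis less_irrefl zero_complex.sel(1))
  have "continuous_on UNIV (\<lambda>x. Complex x (3 * pi / 2))"
    unfolding Complex_eq by (intro continuous_intros)
  then show "continuous_on UNIV (\<lambda>x. cbrt_sinh (Complex x (3 * pi / 2)))"
    by (rule continuous_on_compose2[OF holomorphic_on_imp_continuous_on[OF cbrt_sinh_holomorphic]])
       (use line_in_strip in auto)
  show "continuous_on UNIV (\<lambda>x. \<i> * (6 * (of_real (3 * pi / 2 + cosh x) - \<i> * of_real x)) powr (1 / 3))"
    by (intro continuous_intros continuous_on_powr_Re_pos re)
  show "cbrt_sinh (Complex x (3 * pi / 2)) ^ 3 = (\<i> * (6 * (of_real (3 * pi / 2 + cosh x) - \<i> * of_real x)) powr (1 / 3)) ^ 3" for x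
  proof -
    define w where "w = 6 * (of_real (3 * pi / 2 + cosh x) - \<i> * of_real x)"
    have "w \<noteq> 0" using nz[of x] unfolding w_def .
    then have "(w powr (1 / 3)) ^ 3 = w" by (rule powr_third_cube)
    moreover have "\<i> ^ 3 = - \<i>" by (simp add: power3_eq_cube)
    then have "(\<i> * v) ^ 3 = - \<i> * v ^ 3" for v by (simp only: power_mult_distrib)
    ultimately have "(\<i> * w powr (1 / 3)) ^ 3 = - \<i> * w" by (simp only:)
    then show ?thesis unfolding cbrt_sinh_cube[OF line_in_strip(1)] sinh_minus_self_line w_def by simp
  qed
  show "\<i> * (6 * (of_real (3 * pi / 2 + cosh x) - \<i> * of_real x)) powr (1 / 3) \<noteq> 0" for x
    using nz[of x] by (simp only: mult_eq_0_iff powr_eq_0_iff complex_i_not_zero simp_thms not_False_eq_True)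
  show "cbrt_sinh (Complex 0 (3 * pi / 2)) = \<i> * (6 * (of_real (3 * pi / 2 + cosh 0) - \<i> * of_real 0)) powr (1 / 3)"
  proof -
    define y where "y = 3 * pi / 2"
    have y: "0 < y" "y < 2 * pi" and sy: "sin y = -1" using pi_gt_zero sin_3over2_pi by (auto simp: y_def)
    have c: "Complex 0 (3 * pi / 2) = \<i> * of_real y" by (simp add: complex_eq_iff y_def)
    define r where "r = y ^ 3 / (6 * (y + 1))"
    have r: "r > 0" using y by (simp add: r_def)
    have "B_base (\<i> * of_real y) = of_real r"
      using cbrt_base_imaginary(2)[of y] y unfolding sy r_def by simp
    then have "cbrt_base (\<i> * of_real y) = of_real r powr (1 / 3)"
      using cbrt_base_imaginary(1)[of y] y by simp
    also have "\<dots> = of_real (r powr (1 / 3))"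
      using powr_of_real[of r "1 / 3"] r by simp
    also have "r powr (1 / 3) = (y ^ 3) powr (1 / 3) / (6 * (y + 1)) powr (1 / 3)"
      unfolding r_def by (rule powr_divide)
    also have "(y ^ 3) powr (1 / 3) = y"
    proof -
      have "(y ^ 3) powr (1 / 3) = (y powr 3) powr (1 / 3)" using y by (simp only: powr_numeral)
      also have "\<dots> = y" unfolding powr_powr using y by simp
      finally show ?thesis .
    qed
    finally have "cbrt_sinh (\<i> * of_real y) = \<i> * of_real ((6 * (y + 1)) powr (1 / 3))"
      using y by (simp add: cbrt_sinh_def)
    also have "of_real ((6 * (y + 1)) powr (1 / 3)) = complex_of_real (6 * (y + 1)) powr (1 / 3)"
      using y powr_of_real[of "6 * (y + 1)" "1 / 3"] by simp
    finally show ?thesis unfolding c by (simp add: y_def)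
  qed
qed auto

definition line_integrand :: "nat \<Rightarrow> complex \<Rightarrow> real \<Rightarrow> complex" where
  "line_integrand n \<kappa> x = (of_real (3 * pi / 2 + cosh x) - \<i> * of_real x) powr (- (of_nat (n + 1) / 3))
     * exp (\<kappa> * (of_real x + \<i> * of_real (3 * pi / 2)))"

lemma B_kernel_line:
  "B_kernel n \<kappa> (Complex x (3 * pi / 2)) = (- \<i>) ^ (n + 1) * of_real (6 powr (- (real (n + 1) / 3))) * line_integrand n \<kappa> x"
proof -
  define c where "c = of_real (3 * pi / 2 + cosh x) - \<i> * of_real x"
  have "Re c > 0" using cosh_real_pos[of x] pi_gt_zero by (simp add: c_def add_pos_pos)
  then have c0: "c \<noteq> 0" by auto
  have p: "(w powr (1 / 3)) ^ m = w powr (of_nat m / 3)" if "w \<noteq> 0" for w :: complex and m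
    using that by (simp add: powr_def exp_of_nat_mult[symmetric])
  have "cbrt_sinh (Complex x (3 * pi / 2)) ^ (n + 1) = \<i> ^ (n + 1) * (6 * c) powr (of_nat (n + 1) / 3)"
    unfolding cbrt_sinh_line c_def[symmetric] power_mult_distrib using c0 by (subst p) auto
  also have "(6 * c) powr (of_nat (n + 1) / 3) = of_real (6 powr (real (n + 1) / 3)) * c powr (of_nat (n + 1) / 3)"
    using powr_of_real[of 6 "real (n + 1) / 3"] by (subst powr_times_real_left) auto
  finally have "1 / cbrt_sinh (Complex x (3 * pi / 2)) ^ (n + 1) = (1 / \<i> ^ (n + 1)) * (1 / of_real (6 powr (real (n + 1) / 3))) * (1 / c powr (of_nat (n + 1) / 3))"
    by simp
  also have "1 / \<i> ^ (n + 1) = (- \<i>) ^ (n + 1)" 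
    by (metis divide_i inverse_eq_divide inverse_i power_inverse)
  also have "1 / c powr (of_nat (n + 1) / 3) = c powr (- (of_nat (n + 1) / 3))"
    by (simp only: powr_minus inverse_eq_divide)
  also have "1 / complex_of_real (6 powr (real (n + 1) / 3)) = of_real (6 powr (- (real (n + 1) / 3)))"
    by (simp add: powr_minus inverse_eq_divide)
  finally have f: "1 / cbrt_sinh (Complex x (3 * pi / 2)) ^ (n + 1) = (- \<i>) ^ (n + 1) * of_real (6 powr (- (real (n + 1) / 3))) * c powr (- (of_nat (n + 1) / 3))" .
  have "B_kernel n \<kappa> (Complex x (3 * pi / 2)) = exp (\<kappa> * Complex x (3 * pi / 2)) * (1 / cbrt_sinh (Complex x (3 * pi / 2)) ^ (n + 1))"
    by (simp add: B_kernel_def)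
  also have "\<dots> = (- \<i>) ^ (n + 1) * of_real (6 powr (- (real (n + 1) / 3))) * line_integrand n \<kappa> x"
    unfolding f unfolding line_integrand_def c_def[symmetric] Complex_eq by (simp only: mult_ac)
  finally show ?thesis .
qed

lemma add_cosh_powr_le:
  fixes a c x :: real
  assumes "0 \<le> a" "0 \<le> c"
  shows "(c + cosh x) powr (- a) \<le> 2 powr a * exp (- (a * \<bar>x\<bar>))"
proof -
  have "exp \<bar>x\<bar> / 2 \<le> cosh x" by (simp add: cosh_def abs_if)
  then have "exp \<bar>x\<bar> / 2 \<le> c + cosh x" using assms by linarith
  then have "(c + cosh x) powr (- a) \<le> (exp \<bar>x\<bar> / 2) powr (- a)"
    using assms by (intro powr_mono2') auto
  also have "\<dots> = 2 powr a * exp (- (a * \<bar>x\<bar>))"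
    by (simp add: powr_divide powr_minus powr_def[of "exp _"] exp_minus field_simps)
  finally show ?thesis .
qed

lemma norm_line_integrand_le:
  "norm (line_integrand n \<kappa> x) \<le> 2 powr ((real n + 1) / 3) * exp (\<bar>Im \<kappa>\<bar> * (3 * pi / 2)) * exp (- (((real n + 1) / 3 - \<bar>Re \<kappa>\<bar>) * \<bar>x\<bar>))"
proof -
  define c where "c = of_real (3 * pi / 2 + cosh x) - \<i> * of_real x"
  have Rec: "Re c = 3 * pi / 2 + cosh x" by (simp add: c_def)
  have "Re c > 0" using cosh_real_pos[of x] pi_gt_zero by (simp add: Rec add_pos_pos)
  then have c0: "c \<noteq> 0" by auto
  have "norm (c powr (- (of_nat (n + 1) / 3))) = norm c powr (- ((real n + 1) / 3))"
    using norm_powr_real_powr'[of "- (of_nat (n + 1) / 3)" c] by (simp add: add.commute)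
  also have "\<dots> \<le> (3 * pi / 2 + cosh x) powr (- ((real n + 1) / 3))"
    using complex_Re_le_cmod[of c] \<open>Re c > 0\<close> unfolding Rec by (intro powr_mono2') auto
  also have "\<dots> \<le> 2 powr ((real n + 1) / 3) * exp (- ((real n + 1) / 3 * \<bar>x\<bar>))"
    by (rule add_cosh_powr_le) auto
  finally have 1: "norm (c powr (- (of_nat (n + 1) / 3))) \<le> 2 powr ((real n + 1) / 3) * exp (- ((real n + 1) / 3 * \<bar>x\<bar>))" .
  have "Re (\<kappa> * (of_real x + \<i> * of_real (3 * pi / 2))) \<le> \<bar>Re \<kappa>\<bar> * \<bar>x\<bar> + \<bar>Im \<kappa>\<bar> * (3 * pi / 2)"
  proof -
    have "Re \<kappa> * x \<le> \<bar>Re \<kappa>\<bar> * \<bar>x\<bar>" by (metis abs_ge_self abs_mult)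
    moreover have "- (Im \<kappa> * (3 * pi / 2)) \<le> \<bar>Im \<kappa>\<bar> * (3 * pi / 2)"
      unfolding mult_minus_left[symmetric] by (intro mult_right_mono) auto
    moreover have "Re (\<kappa> * (of_real x + \<i> * of_real (3 * pi / 2))) = Re \<kappa> * x - Im \<kappa> * (3 * pi / 2)" by simp
    ultimately show ?thesis by linarith
  qed
  then have 2: "norm (exp (\<kappa> * (of_real x + \<i> * of_real (3 * pi / 2)))) \<le> exp (\<bar>Re \<kappa>\<bar> * \<bar>x\<bar> + \<bar>Im \<kappa>\<bar> * (3 * pi / 2))"
    unfolding norm_exp_eq_Re by (simp only: exp_le_cancel_iff)
  have "norm (line_integrand n \<kappa> x) \<le> (2 powr ((real n + 1) / 3) * exp (- ((real n + 1) / 3 * \<bar>x\<bar>))) * exp (\<bar>Re \<kappa>\<bar> * \<bar>x\<bar> + \<bar>Im \<kappa>\<bar> * (3 * pi / 2))"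
    unfolding line_integrand_def c_def[symmetric] norm_mult using 1 2 by (intro mult_mono) auto
  also have "\<dots> = 2 powr ((real n + 1) / 3) * exp (\<bar>Im \<kappa>\<bar> * (3 * pi / 2)) * exp (- (((real n + 1) / 3 - \<bar>Re \<kappa>\<bar>) * \<bar>x\<bar>))"
    unfolding mult.assoc exp_add[symmetric] by (simp add: algebra_simps)
  finally show ?thesis .
qed

lemma continuous_line_integrand: "continuous_on UNIV (line_integrand n \<kappa>)"
proof -
  have re: "Re (of_real (3 * pi / 2 + cosh x) - \<i> * of_real x) > 0" for x
    using cosh_real_pos[of x] pi_gt_zero by (simp add: add_pos_pos)
  show ?thesis unfolding line_integrand_def
    by (intro continuous_intros continuous_on_powr_Re_pos re)
qed

lemma integrable_line_integrand:
  assumes "\<bar>Re \<kappa>\<bar> < (real n + 1) / 3"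
  shows "integrable lborel (line_integrand n \<kappa>)"
proof (rule Bochner_Integration.integrable_bound)
  show "integrable lborel (\<lambda>x. 2 powr ((real n + 1) / 3) * exp (\<bar>Im \<kappa>\<bar> * (3 * pi / 2)) * exp (- (((real n + 1) / 3 - \<bar>Re \<kappa>\<bar>) * \<bar>x\<bar>)))"
    using assms by (intro integrable_mult_right integrable_exp_minus_abs) simp
  show "line_integrand n \<kappa> \<in> borel_measurable lborel"
    using borel_measurable_continuous_onI[OF continuous_line_integrand] by simp
  show "AE x in lborel. norm (line_integrand n \<kappa> x) \<le> norm (2 powr ((real n + 1) / 3) * exp (\<bar>Im \<kappa>\<bar> * (3 * pi / 2)) * exp (- (((real n + 1) / 3 - \<bar>Re \<kappa>\<bar>) * \<bar>x\<bar>)))"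
    using norm_line_integrand_le by (intro AE_I2) (auto simp: abs_mult)
qed

lemma B_kernel_minus:
  assumes "t \<in> strip"
  shows "B_kernel n \<kappa> (- t) = (- 1) ^ (n + 1) * B_kernel n (- \<kappa>) t"
proof -
  define m where "m = n + 1"
  have e: "cbrt_sinh (- t) ^ m = (- 1) ^ m * cbrt_sinh t ^ m"
    using assms by (metis cbrt_sinh_minus power_minus)
  show ?thesis
    unfolding B_kernel_def m_def[symmetric] e by (cases "even m") auto
qed

text \<open>Limit of the rectangle identity; the bound on \<kappa> makes the vertical sides vanish
  and the horizontal integrals converge. Oddness of \<open>cbrt_sinh\<close> maps the lower line to
  the upper one with \<kappa> replaced by - \<kappa>, so both integrals have the same form.\<close>

lemma B_eq_line_integrals:
  assumes \<kappa>: "\<bar>Re \<kappa>\<bar> < (real n + 1) / 3"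
  shows "2 * of_real (pi * 6 powr (real (n + 1) / 3)) * B n \<kappa> =
    \<i> ^ n * integral\<^sup>L lborel (line_integrand n (- \<kappa>)) + (- \<i>) ^ n * integral\<^sup>L lborel (line_integrand n \<kappa>)"
proof -
  define C where "C = of_real (6 powr (- (real (n + 1) / 3))) * (- \<i>) ^ (n + 1)"
  define u where "u = 3 * pi / 2"
  have u: "u > 0" "u < 2 * pi" using pi_gt_zero by (auto simp: u_def)
  have up: "B_kernel n \<kappa> (Complex x u) = C * line_integrand n \<kappa> x" for x \<kappa>
    unfolding C_def u_def B_kernel_line by simp
  have low: "B_kernel n \<kappa> (Complex x (- u)) = (- 1) ^ (n + 1) * C * line_integrand n (- \<kappa>) (- x)" for x
  proof -
    have t: "Complex x (- u) = - Complex (- x) u" by (simp add: complex_eq_iff)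
    have "Complex (- x) u \<in> strip" unfolding u_def by (rule line_in_strip)
    then have "B_kernel n \<kappa> (Complex x (- u)) = (- 1) ^ (n + 1) * B_kernel n (- \<kappa>) (Complex (- x) u)"
      unfolding t by (rule B_kernel_minus)
    then show ?thesis unfolding up by simp
  qed
  have \<kappa>': "\<bar>Re (- \<kappa>)\<bar> < (real n + 1) / 3" using \<kappa> by simp
  note il = integrable_line_integrand[OF \<kappa>] integrable_line_integrand[OF \<kappa>']
  have i1: "has_bochner_integral lborel (\<lambda>x. B_kernel n \<kappa> (Complex x u)) (C * integral\<^sup>L lborel (line_integrand n \<kappa>))"
    unfolding up by (intro has_bochner_integral_mult_right has_bochner_integral_integrable il)
  have i2: "has_bochner_integral lborel (\<lambda>x. B_kernel n \<kappa> (Complex x (- u))) ((- 1) ^ (n + 1) * C * integral\<^sup>L lborel (line_integrand n (- \<kappa>)))"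
    unfolding low by (intro has_bochner_integral_mult_right has_bochner_integral_reflect has_bochner_integral_integrable il)
  define V1 V2 where "V1 = (\<lambda>R. contour_integral (linepath (Complex R (-u)) (Complex R u)) (B_kernel n \<kappa>))"
    and "V2 = (\<lambda>R. contour_integral (linepath (Complex (-R) u) (Complex (-R) (-u))) (B_kernel n \<kappa>))"
  have "(V1 \<longlongrightarrow> 0) at_top" "(V2 \<longlongrightarrow> 0) at_top"
    using vertical_B_kernel_tendsto_0[OF \<kappa>, of 1 "-u"] vertical_B_kernel_tendsto_0[OF \<kappa>, of "-1" u] u
    by (auto simp: V1_def V2_def u_def)
  then have A: "((\<lambda>R. integral {-R..R} (\<lambda>x. B_kernel n \<kappa> (Complex x (-u))) - integral {-R..R} (\<lambda>x. B_kernel n \<kappa> (Complex x u)) + V1 R + V2 R)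
     \<longlongrightarrow> integral\<^sup>L lborel (\<lambda>x. B_kernel n \<kappa> (Complex x (-u))) - integral\<^sup>L lborel (\<lambda>x. B_kernel n \<kappa> (Complex x u)) + 0 + 0) at_top"
    using i1 i2 by (intro tendsto_intros tendsto_integral_symmetric) (auto simp: has_bochner_integral_iff)
  have "\<forall>\<^sub>F R in at_top. integral {-R..R} (\<lambda>x. B_kernel n \<kappa> (Complex x (-u))) - integral {-R..R} (\<lambda>x. B_kernel n \<kappa> (Complex x u)) + V1 R + V2 R = 2 * of_real pi * \<i> * B n \<kappa>"
    using eventually_gt_at_top[of 0] unfolding V1_def V2_def
    by eventually_elim (intro B_kernel_rectangle u)
  then have "((\<lambda>R. integral {-R..R} (\<lambda>x. B_kernel n \<kappa> (Complex x (-u))) - integral {-R..R} (\<lambda>x. B_kernel n \<kappa> (Complex x u)) + V1 R + V2 R)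
     \<longlongrightarrow> 2 * of_real pi * \<i> * B n \<kappa>) at_top"
    by (rule tendsto_eventually)
  from tendsto_unique[OF trivial_limit_at_top_linorder this A] have e: "2 * of_real pi * \<i> * B n \<kappa> = (- 1) ^ (n + 1) * C * integral\<^sup>L lborel (line_integrand n (- \<kappa>)) - C * integral\<^sup>L lborel (line_integrand n \<kappa>)"
    using has_bochner_integral_integral_eq[OF i1] has_bochner_integral_integral_eq[OF i2] by simp
  have C1: "of_real (6 powr (real (n + 1) / 3)) * C = (- \<i>) ^ (n + 1)"
    by (simp add: C_def powr_minus)
  have 3: "(- \<i>) ^ (n + 1) * (- 1) ^ (n + 1) = \<i> ^ (n + 1)"
    unfolding power_mult_distrib[symmetric] by simp
  define S where "S = complex_of_real (6 powr (real (n + 1) / 3))"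
  define I1 I2 where "I1 = integral\<^sup>L lborel (line_integrand n (- \<kappa>))" and "I2 = integral\<^sup>L lborel (line_integrand n \<kappa>)"
  have "2 * of_real (pi * 6 powr (real (n + 1) / 3)) * B n \<kappa> = - \<i> * S * (2 * of_real pi * \<i> * B n \<kappa>)"
  proof -
    have "- \<i> * S * (2 * p * \<i> * b) = - (\<i> * \<i>) * (2 * (p * S) * b)" for p b
      by algebra
    then show ?thesis unfolding of_real_mult S_def[symmetric] by (simp only: i_squared minus_minus mult_1)
  qed
  also have "\<dots> = - \<i> * ((S * C) * (- 1) ^ (n + 1) * I1 - (S * C) * I2)"
    unfolding e I1_def[symmetric] I2_def[symmetric] by (simp only: right_diff_distrib mult_ac)
  also have "\<dots> = - \<i> * (\<i> ^ (n + 1) * I1 - (- \<i>) ^ (n + 1) * I2)"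
    unfolding C1[folded S_def] 3 ..
  also have "\<dots> = \<i> ^ n * I1 + (- \<i>) ^ n * I2"
    by (simp add: right_diff_distrib distrib_left mult.assoc)
  finally show ?thesis unfolding I1_def I2_def .
qed

section \<open>The Mellin transform of the Hankel integral\<close>


text \<open>The weight adds \<open>2 * pi * t\<close> to the exponent, so
  \<open>cosh s - pi / 2\<close> becomes \<open>cosh s + 3 * pi / 2\<close>, and integrating over
  \<open>t\<close> first yields a Gamma factor times a power of the base of
  \<open>line_integrand\<close>. Fubini exchanges this with the integral over
  \<open>s\<close>.\<close>

lemma hankel_integral_mellin:
  assumes \<kappa>: "\<bar>Re \<kappa>\<bar> < (real n + 1) / 3"
  shows "has_bochner_integral lborel
    (\<lambda>t. indicator {0<..} t *\<^sub>R (of_real (t powr ((real n - 2) / 3) * exp (- 2 * pi * t)) * hankel_integral \<kappa> t))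
    (1 / (of_real pi * \<i>) * of_real (Gamma (real (n + 1) / 3)) * exp (2 * of_real pi * \<i> * \<kappa>) * integral\<^sup>L lborel (line_integrand n (- \<kappa>)))"
proof -
  define a where "a = (real n + 1) / 3"
  have a: "a > 0" by (simp add: a_def)
  define b where "b = (\<lambda>s. of_real (3 * pi / 2 + cosh s) + \<i> * complex_of_real s)"
  define e where "e = (\<lambda>s. exp (\<kappa> * (complex_of_real s + \<i> * of_real (pi / 2))))"
  have Reb: "Re (b s) = 3 * pi / 2 + cosh s" "Re (b s) > 0" for s
    using cosh_real_pos[of s] pi_gt_zero by (simp_all add: b_def add_pos_pos)
  define g where "g = (\<lambda>s t. e s * (indicator {0<..} t *\<^sub>R (of_real t powr (of_real a - 1) * exp (- (b s * of_real t)))))"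
  have inner: "has_bochner_integral lborel (g s) (e s * (Gamma (of_real a) * b s powr (- of_real a)))" for s
    unfolding g_def by (intro has_bochner_integral_mult_right gamma_integral_complex_scaled) (use a Reb in auto)
  have g_alt: "g s t = (indicator {0<..} t *\<^sub>R of_real (t powr ((real n - 2) / 3) * exp (- 2 * pi * t))) *
      hankel_integrand \<kappa> t s" for s t
  proof (cases "t > 0")
    case True
    have "of_real t powr (of_real a - 1) = complex_of_real (t powr ((real n - 2) / 3))"
      using True powr_of_real[of t "(real n - 2) / 3"] by (simp add: a_def field_simps)
    moreover have "- (b s * of_real t) = of_real (- 2 * pi * t) + - of_real t * (of_real (cosh s) + \<i> * of_real s - of_real (pi / 2))"
      by (simp add: b_def field_simps)
    ultimately show ?thesis using True
      by (simp only: g_def e_def hankel_integrand_def exp_add exp_of_real of_real_mult[of "_ powr _"] of_real_mult[of "exp _" "_ powr _"] indicator_simps greaterThan_iff scaleR_one mult_ac)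
  qed (simp add: g_def)
  have outer: "(LINT s|lborel. g s t) = (indicator {0<..} t *\<^sub>R of_real (t powr ((real n - 2) / 3) * exp (- 2 * pi * t))) * (of_real pi * \<i> * hankel_integral \<kappa> t)" for t
    unfolding g_alt hankel_integral_def by simp
  have meas: "case_prod g \<in> borel_measurable (lborel \<Otimes>\<^sub>M lborel)"
    unfolding g_alt hankel_integrand_def by (simp add: case_prod_beta' cosh_def)
  \<comment> \<open>Taking norms replaces the complex rate by its real part, so the inner integral
    is again a Gamma integral. The power of \<open>3 * pi / 2 + cosh s\<close> decays like
    \<open>exp (- a * \<bar>s\<bar>)\<close> and outweighs the growth
    \<open>exp (\<bar>Re \<kappa>\<bar> * \<bar>s\<bar>)\<close>.\<close>
  have normint: "(LINT t|lborel. norm (g s t)) \<le> (norm (Gamma (complex_of_real a)) * 2 powr a * exp (\<bar>Im \<kappa>\<bar> * (pi / 2))) * exp (- ((a - \<bar>Re \<kappa>\<bar>) * \<bar>s\<bar>))" for s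
  proof -
    have "has_bochner_integral lborel (\<lambda>t. norm (e s) * Re (indicator {0<..} t *\<^sub>R (of_real t powr (of_real a - 1) * exp (- (of_real (Re (b s)) * of_real t)))))
       (norm (e s) * Re (Gamma (of_real a) * of_real (Re (b s)) powr (- of_real a)))"
      by (intro has_bochner_integral_mult_right has_bochner_integral_Re gamma_integral_complex_scaled) (use a Reb in auto)
    moreover have "norm (e s) * Re (indicator {0<..} t *\<^sub>R (of_real t powr (of_real a - 1) * exp (- (of_real (Re (b s)) * of_real t)))) = norm (g s t)" for t
    proof (cases "t > 0")
      case True
      have p: "of_real t powr (of_real a - 1) = complex_of_real (t powr (a - 1))"
        using True powr_of_real[of t "a - 1"] by simp
      have "exp (- (of_real (Re (b s)) * of_real t)) = complex_of_real (exp (- (Re (b s) * t)))"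
        by (simp add: exp_of_real[symmetric])
      then show ?thesis using True unfolding g_def norm_mult p by (simp add: norm_mult)
    qed (simp add: g_def)
    ultimately have "(LINT t|lborel. norm (g s t)) = norm (e s) * Re (Gamma (of_real a) * of_real (Re (b s)) powr (- of_real a))"
      by (simp only: has_bochner_integral_iff)
    also have "\<dots> \<le> norm (e s) * norm (Gamma (complex_of_real a) * of_real (Re (b s)) powr (- of_real a))"
      by (intro mult_left_mono complex_Re_le_cmod) auto
    also have "norm (Gamma (complex_of_real a) * of_real (Re (b s)) powr (- of_real a)) = norm (Gamma (complex_of_real a)) * (3 * pi / 2 + cosh s) powr (- a)"
    proof -
      have "of_real (Re (b s)) powr (- complex_of_real a) = complex_of_real (Re (b s) powr (- a))"
        using powr_of_real[of "Re (b s)" "- a"] Reb(2)[of s] by simp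
      then show ?thesis by (simp add: norm_mult Reb(1))
    qed
    also have "norm (e s) * (norm (Gamma (complex_of_real a)) * (3 * pi / 2 + cosh s) powr (- a))
       \<le> (exp (\<bar>Re \<kappa>\<bar> * \<bar>s\<bar>) * exp (\<bar>Im \<kappa>\<bar> * (pi / 2))) * (norm (Gamma (complex_of_real a)) * (2 powr a * exp (- (a * \<bar>s\<bar>))))"
    proof (intro mult_mono add_cosh_powr_le order_refl)
      have "Re \<kappa> * s \<le> \<bar>Re \<kappa>\<bar> * \<bar>s\<bar>" by (metis abs_ge_self abs_mult)
      moreover have "- (Im \<kappa> * (pi / 2)) \<le> \<bar>Im \<kappa>\<bar> * (pi / 2)"
        unfolding mult_minus_left[symmetric] by (intro mult_right_mono) auto
      moreover have "Re (\<kappa> * (complex_of_real s + \<i> * of_real (pi / 2))) = Re \<kappa> * s - Im \<kappa> * (pi / 2)" by simp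
      ultimately show "norm (e s) \<le> exp (\<bar>Re \<kappa>\<bar> * \<bar>s\<bar>) * exp (\<bar>Im \<kappa>\<bar> * (pi / 2))"
        unfolding e_def norm_exp_eq_Re exp_add[symmetric] exp_le_cancel_iff by linarith
    qed (use a in auto)
    also have "\<dots> = (norm (Gamma (complex_of_real a)) * 2 powr a * exp (\<bar>Im \<kappa>\<bar> * (pi / 2))) * (exp (\<bar>Re \<kappa>\<bar> * \<bar>s\<bar>) * exp (- (a * \<bar>s\<bar>)))"
      by (simp only: mult_ac)
    also have "exp (\<bar>Re \<kappa>\<bar> * \<bar>s\<bar>) * exp (- (a * \<bar>s\<bar>)) = exp (- ((a - \<bar>Re \<kappa>\<bar>) * \<bar>s\<bar>))"
      by (simp add: exp_add[symmetric] left_diff_distrib)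
    finally show ?thesis .
  qed
  have int: "integrable (lborel \<Otimes>\<^sub>M lborel) (case_prod g)"
  proof (rule lborel_pair.Fubini_integrable[OF meas])
    show "AE s in lborel. integrable lborel (\<lambda>t. case (s, t) of (s, t) \<Rightarrow> g s t)"
      using inner by (auto simp: has_bochner_integral_iff)
    show "integrable lborel (\<lambda>s. LINT t|lborel. norm (case (s, t) of (s, t) \<Rightarrow> g s t))"
    proof (rule Bochner_Integration.integrable_bound)
      show "integrable lborel (\<lambda>s. (norm (Gamma (complex_of_real a)) * 2 powr a * exp (\<bar>Im \<kappa>\<bar> * (pi / 2))) * exp (- ((a - \<bar>Re \<kappa>\<bar>) * \<bar>s\<bar>)))"
        using \<kappa> by (intro integrable_mult_right integrable_exp_minus_abs) (simp add: a_def)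
      show "(\<lambda>s. LINT t|lborel. norm (case (s, t) of (s, t) \<Rightarrow> g s t)) \<in> borel_measurable lborel"
        using meas by (intro lborel.borel_measurable_lebesgue_integral) (simp add: case_prod_beta')
      show "AE s in lborel. norm (LINT t|lborel. norm (case (s, t) of (s, t) \<Rightarrow> g s t)) \<le> norm ((norm (Gamma (complex_of_real a)) * 2 powr a * exp (\<bar>Im \<kappa>\<bar> * (pi / 2))) * exp (- ((a - \<bar>Re \<kappa>\<bar>) * \<bar>s\<bar>)))"
        using normint by (intro AE_I2) (simp add: abs_mult)
    qed
  qed
  have "integrable lborel (\<lambda>t. LINT s|lborel. g s t)"
    by (rule lborel_pair.integrable_snd[OF int])
  moreover have "(LINT t|lborel. LINT s|lborel. g s t) = (LINT s|lborel. LINT t|lborel. g s t)"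
    by (rule lborel_pair.Fubini_integral[OF int])
  moreover have "(LINT t|lborel. g s t) = exp (2 * of_real pi * \<i> * \<kappa>) * Gamma (of_real a) * line_integrand n (- \<kappa>) (- s)" for s
  proof -
    \<comment> \<open>The phase comes from \<kappa> \<pi> / 2 = 2 \<pi> \<kappa> - 3 \<pi> \<kappa>
      / 2: passing from height \<pi> / 2 with \<kappa> to height 3 \<pi> / 2 with - \<kappa> leaves
      \<open>exp (2 * pi * \<i> * \<kappa>)\<close>. The sign of \<open>s\<close> is reversed to
      match \<open>line_integrand\<close>.\<close>
    have "e s = exp (2 * of_real pi * \<i> * \<kappa>) * exp (- \<kappa> * (of_real (- s) + \<i> * of_real (3 * pi / 2)))"
      unfolding e_def exp_add[symmetric] by (rule arg_cong[where f = exp]) (simp add: field_simps)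
    moreover have "b s = of_real (3 * pi / 2 + cosh (- s)) - \<i> * of_real (- s)" by (simp add: b_def)
    moreover have "- complex_of_real a = - (of_nat (n + 1) / 3)" by (simp add: a_def add.commute)
    ultimately show ?thesis using has_bochner_integral_integral_eq[OF inner[of s]]
      unfolding line_integrand_def by (simp only: mult_ac)
  qed
  moreover have "(LINT s|lborel. exp (2 * of_real pi * \<i> * \<kappa>) * Gamma (complex_of_real a) * line_integrand n (- \<kappa>) (- s)) = exp (2 * of_real pi * \<i> * \<kappa>) * Gamma (complex_of_real a) * integral\<^sup>L lborel (line_integrand n (- \<kappa>))"
  proof -
    have "integrable lborel (line_integrand n (- \<kappa>))" using \<kappa> by (intro integrable_line_integrand) simp
    from has_bochner_integral_mult_right[OF has_bochner_integral_reflect[OF has_bochner_integral_integrable[OF this]]]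
    show ?thesis by (rule has_bochner_integral_integral_eq)
  qed
  ultimately have "has_bochner_integral lborel (\<lambda>t. LINT s|lborel. g s t) (exp (2 * of_real pi * \<i> * \<kappa>) * Gamma (complex_of_real a) * integral\<^sup>L lborel (line_integrand n (- \<kappa>)))"
    by (simp only: has_bochner_integral_iff)
  from has_bochner_integral_mult_right[OF this, of "1 / (of_real pi * \<i>)"]
  have "has_bochner_integral lborel (\<lambda>t. 1 / (of_real pi * \<i>) * (LINT s|lborel. g s t)) (1 / (of_real pi * \<i>) * (exp (2 * of_real pi * \<i> * \<kappa>) * Gamma (complex_of_real a) * integral\<^sup>L lborel (line_integrand n (- \<kappa>))))" by simp
  moreover have "1 / (of_real pi * \<i>) * (LINT s|lborel. g s t) = indicator {0<..} t *\<^sub>R (of_real (t powr ((real n - 2) / 3) * exp (- 2 * pi * t)) * hankel_integral \<kappa> t)" for t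
    unfolding outer by (simp add: field_simps)
  moreover have "Gamma (complex_of_real a) = of_real (Gamma (real (n + 1) / 3))"
    using Gamma_complex_of_real[of a] by (simp add: a_def add.commute)
  ultimately show ?thesis by (simp add: mult_ac)
qed

section \<open>Expansion along steepest descent rays\<close>


text \<open>Lagrange inversion done by repeated division, so that the remainder \<open>g\<close> is
  holomorphic on the whole strip; the rays have length \<pi>, beyond a mere neighbourhood of 0. In
  the step \<open>g 0\<close> must be the coefficient \<open>B N \<kappa>\<close>, which is found by
  dividing by \<open>cbrt_sinh u ^ (N + 1)\<close> and integrating over the unit circle. Then
  \<open>g - B N \<kappa> * deriv cbrt_sinh\<close> vanishes at 0 and is divisible by
  \<open>cbrt_sinh\<close>.\<close>

lemma exp_expansion:
  "\<exists>g. g holomorphic_on strip \<and> (\<forall>u\<in>strip. exp (\<kappa> * u) =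
     (\<Sum>m<N. B m \<kappa> * cbrt_sinh u ^ m * deriv cbrt_sinh u) + cbrt_sinh u ^ N * g u)"
proof (induction N)
  case 0
  show ?case by (intro exI[of _ "\<lambda>u. exp (\<kappa> * u)"]) (auto intro!: holomorphic_intros)
next
  case (Suc N)
  let ?W = cbrt_sinh
  obtain g where g: "g holomorphic_on strip"
    and eq: "\<And>u. u \<in> strip \<Longrightarrow> exp (\<kappa> * u) = (\<Sum>m<N. B m \<kappa> * ?W u ^ m * deriv ?W u) + ?W u ^ N * g u"
    using Suc by blast
  have W': "deriv ?W holomorphic_on strip"
    by (rule holomorphic_deriv[OF cbrt_sinh_holomorphic strip_open])
  have cb: "cball 0 1 \<subseteq> strip"
  proof
    fix z :: complex assume "z \<in> cball 0 1"
    then have "\<bar>Im z\<bar> \<le> 1" using abs_Im_le_cmod[of z] by simp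
    then show "z \<in> strip" using pi_gt3 by (simp add: strip_def)
  qed
  have sph: "path_image (circlepath 0 1) \<subseteq> strip - {0}" using cb by auto
  have i1: "(B_kernel N \<kappa> has_contour_integral 2 * pi * \<i> * B N \<kappa>) (circlepath 0 1)"
    using base_residue[OF strip_open zero_in_strip _ B_kernel_holomorphic cb] by (simp add: residue_B_kernel)
  \<comment> \<open>For \<open>m < N\<close> the quotient is the derivative of a negative power of
    \<open>cbrt_sinh\<close>, so it integrates to 0 around the circle; no logarithm arises because
    the exponent \<open>k = N - m\<close> is positive.\<close>
  have i2: "((\<lambda>u. B m \<kappa> * (?W u ^ m * deriv ?W u / ?W u ^ (N + 1))) has_contour_integral B m \<kappa> * 0) (circlepath 0 1)"
    if m: "m < N" for m
  proof (rule has_contour_integral_lmul)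
    define k where "k = N - m"
    have k: "k > 0" "N = m + k" using m by (auto simp: k_def)
    show "((\<lambda>u. ?W u ^ m * deriv ?W u / ?W u ^ (N + 1)) has_contour_integral 0) (circlepath 0 1)"
    proof (rule Cauchy_theorem_primitive[where S = "strip - {0}" and f = "\<lambda>u. - (inverse (?W u) ^ k / of_nat k)"])
      fix u assume u: "u \<in> strip - {0}"
      have W: "(?W has_field_derivative deriv ?W u) (at u within strip - {0})"
        using cbrt_sinh_holomorphic strip_open u holomorphic_derivI by blast
      have nz: "?W u \<noteq> 0" using u by simp
      obtain j where j: "k = Suc j" using k by (cases k) auto
      have "((\<lambda>w. - (inverse w ^ k / of_nat k)) has_field_derivative inverse (?W u) ^ (k + 1)) (at (?W u))"
      proof -
        have "((\<lambda>w. - (inverse w ^ Suc j / of_nat (Suc j))) has_field_derivative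
           - (((1 + of_nat j) * (- (inverse (?W u) ^ Suc (Suc 0)) * inverse (?W u) ^ j)) / of_nat (Suc j))) (at (?W u))"
          by (intro DERIV_minus DERIV_cdivide DERIV_power_Suc DERIV_inverse nz)
        moreover have "- ((c * (- (v ^ Suc (Suc 0)) * v ^ j)) / c) = v ^ (Suc j + 1)" if "c \<noteq> 0" for c v :: complex
          using that by simp
        ultimately show ?thesis unfolding j by (simp only: of_nat_Suc[symmetric] of_nat_neq_0 not_False_eq_True)
      qed
      from DERIV_chain2[OF this W]
      show "((\<lambda>u. - (inverse (?W u) ^ k / of_nat k)) has_field_derivative ?W u ^ m * deriv ?W u / ?W u ^ (N + 1)) (at u within strip - {0})"
        using nz k by (simp add: power_add divide_simps)
    qed (use sph in auto)
  qed
  have i3: "((\<lambda>u. g u / ?W u) has_contour_integral 2 * pi * \<i> * g 0) (circlepath 0 1)"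
  proof -
    have h: "(\<lambda>u. g u * cbrt_base u) holomorphic_on strip"
      by (intro holomorphic_intros g cbrt_base_holomorphic)
    have "(\<lambda>u. g u * cbrt_base u / (u - 0)) holomorphic_on strip - {0}"
      by (intro holomorphic_intros holomorphic_on_subset[OF g] holomorphic_on_subset[OF cbrt_base_holomorphic]) auto
    from base_residue[OF strip_open zero_in_strip _ this cb]
    have "((\<lambda>u. g u * cbrt_base u / (u - 0)) has_contour_integral 2 * pi * \<i> * g 0) (circlepath 0 1)"
      by (simp add: residue_simple[OF strip_open zero_in_strip h, simplified])
    moreover have "(\<lambda>u. g u * cbrt_base u / (u - 0)) = (\<lambda>u. g u / ?W u)"
      by (simp add: cbrt_sinh_def fun_eq_iff)
    ultimately show ?thesis by simp
  qed
  have "((\<lambda>u. (\<Sum>m<N. B m \<kappa> * (?W u ^ m * deriv ?W u / ?W u ^ (N + 1))) + g u / ?W u) has_contour_integral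
     ((\<Sum>m<N. B m \<kappa> * 0) + 2 * pi * \<i> * g 0)) (circlepath 0 1)"
    by (intro has_contour_integral_add has_contour_integral_sum i2 i3) auto
  moreover have "(\<Sum>m<N. B m \<kappa> * (?W u ^ m * deriv ?W u / ?W u ^ (N + 1))) + g u / ?W u = B_kernel N \<kappa> u"
    if "u \<in> path_image (circlepath 0 1)" for u
  proof -
    have u: "u \<in> strip" "u \<noteq> 0" using that sph by auto
    have "B_kernel N \<kappa> u = ((\<Sum>m<N. B m \<kappa> * ?W u ^ m * deriv ?W u) + ?W u ^ N * g u) / ?W u ^ (N + 1)"
      unfolding B_kernel_def eq[OF u(1)] ..
    also have "\<dots> = (\<Sum>m<N. B m \<kappa> * (?W u ^ m * deriv ?W u / ?W u ^ (N + 1))) + g u / ?W u"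
      using u by (simp add: add_divide_distrib sum_divide_distrib mult.assoc)
    finally show ?thesis by simp
  qed
  ultimately have "(B_kernel N \<kappa> has_contour_integral ((\<Sum>m<N. B m \<kappa> * 0) + 2 * pi * \<i> * g 0)) (circlepath 0 1)"
    by (rule has_contour_integral_eq)
  from has_contour_integral_unique[OF this i1] have g0: "g 0 = B N \<kappa>" by simp
  define k where "k = (\<lambda>u. g u - B N \<kappa> * deriv ?W u)"
  have k: "k holomorphic_on strip" unfolding k_def by (intro holomorphic_intros g W')
  have k0: "k 0 = 0" by (simp add: k_def g0 deriv_cbrt_sinh_0)
  \<comment> \<open>The zero of \<open>k\<close> at 0 is removed by a difference quotient; since
    \<open>u = cbrt_sinh u * cbrt_base u\<close>, division by \<open>u\<close> amounts to division
    by \<open>cbrt_sinh u\<close> up to the factor \<open>cbrt_base u\<close>.\<close>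
  define k1 where "k1 = (\<lambda>z. if z = 0 then deriv k 0 else (k z - k 0) / (z - 0))"
  have k1: "k1 holomorphic_on strip" unfolding k1_def by (rule pole_lemma_open[OF k strip_open])
  have kk: "k u = ?W u * (k1 u * cbrt_base u)" for u
    by (auto simp: k1_def k0 cbrt_sinh_def)
  show ?case
  proof (intro exI[of _ "\<lambda>u. k1 u * cbrt_base u"] conjI ballI)
    show "(\<lambda>u. k1 u * cbrt_base u) holomorphic_on strip" by (intro holomorphic_intros k1 cbrt_base_holomorphic)
    fix u assume u: "u \<in> strip"
    have "g u = B N \<kappa> * deriv ?W u + ?W u * (k1 u * cbrt_base u)"
      using kk[of u] by (simp add: k_def algebra_simps)
    then show "exp (\<kappa> * u) = (\<Sum>m<Suc N. B m \<kappa> * ?W u ^ m * deriv ?W u) + ?W u ^ Suc N * (k1 u * cbrt_base u)"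
      unfolding eq[OF u] by (simp add: algebra_simps)
  qed
qed

section \<open>Cubic decay and the branch on the rays\<close>

lemma one_plus_half_square_le_cosh: "1 + x\<^sup>2 / 2 \<le> cosh x" for x :: real
proof -
  have "1 + x\<^sup>2 / 2 \<le> cosh x" if "x \<ge> 0" for x :: real
  proof -
    have "(\<lambda>x. cosh x - (1 + x\<^sup>2 / 2)) 0 \<le> (\<lambda>x. cosh x - (1 + x\<^sup>2 / 2)) x"
    proof (rule DERIV_nonneg_imp_nondecreasing[OF that])
      fix y :: real assume "0 \<le> y" "y \<le> x"
      then show "\<exists>d. ((\<lambda>x. cosh x - (1 + x\<^sup>2 / 2)) has_real_derivative d) (at y) \<and> 0 \<le> d"
        by (intro exI[of _ "sinh y - y"]) (use self_less_sinh[of y] in \<open>cases "y = 0"; auto intro!: derivative_eq_intros\<close>)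
    qed
    then show ?thesis by simp
  qed
  from this[of "\<bar>x\<bar>"] show ?thesis by simp
qed

lemma sin_ge_cubic: "x - x ^ 3 / 6 \<le> sin x" if "x \<ge> 0" for x :: real
proof -
  have "(\<lambda>x. sin x - (x - x ^ 3 / 6)) 0 \<le> (\<lambda>x. sin x - (x - x ^ 3 / 6)) x"
  proof (rule DERIV_nonneg_imp_nondecreasing[OF that])
    fix y :: real assume "0 \<le> y" "y \<le> x"
    have "(sin (y / 2))\<^sup>2 \<le> (y / 2)\<^sup>2"
      using abs_sin_x_le_abs_x[of "y / 2"] by (metis abs_le_square_iff)
    then have "cos (2 * (y / 2)) \<ge> 1 - y\<^sup>2 / 2" unfolding cos_double_sin by (simp add: power_divide)
    then show "\<exists>d. ((\<lambda>x. sin x - (x - x ^ 3 / 6)) has_real_derivative d) (at y) \<and> 0 \<le> d"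
      by (intro exI[of _ "cos y - (1 - y\<^sup>2 / 2)"]) (auto intro!: derivative_eq_intros)
  qed
  then show ?thesis by simp
qed

text \<open>On the two rays with \<open>e ^ 3 = \<i>\<close> in the upper half plane the exponent
  \<open>\<i> t (sinh u - u)\<close> decays at the cubic rate of its leading term.\<close>

lemma Im_sinh_minus_self_ray:
  assumes "\<bar>Re e\<bar> = sqrt 3 / 2" "Im e = 1 / 2" "0 \<le> r" "r \<le> 1"
  shows "r ^ 3 \<le> Im (sinh (of_real (r * pi) * e) - of_real (r * pi) * e)"
proof -
  \<comment> \<open>\<open>b\<close> is the imaginary part of the point on the ray, at most \<pi> /
    2 and hence at most 1.6; the squared real part is then three times the square of
    \<open>b\<close>.\<close>
  define b where "b = r * pi / 2"
  have "r * pi \<le> 1 * pi" using assms by (intro mult_right_mono) auto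
  moreover have "pi \<le> 3.2" using pi_approx by simp
  ultimately have "b \<le> 1.6" unfolding b_def by linarith
  then have b: "0 \<le> b" "b \<le> 1.6" using assms by (auto simp: b_def)
  have a2: "(r * pi * Re e)\<^sup>2 = 3 * b\<^sup>2"
  proof -
    have "(Re e)\<^sup>2 = \<bar>Re e\<bar>\<^sup>2" by simp
    then have "(Re e)\<^sup>2 = 3 / 4" unfolding assms(1) by (simp add: power_divide)
    then show ?thesis by (simp add: b_def power_mult_distrib power_divide)
  qed
  have c: "1 + 3 * b\<^sup>2 / 2 \<le> cosh (r * pi * Re e)"
    using one_plus_half_square_le_cosh[of "r * pi * Re e"] a2 by simp
  have b2: "b\<^sup>2 \<le> 2.56" using power_mono[OF b(2) b(1), of 2] by (simp add: power2_eq_square)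
  have s0: "0 \<le> b - b ^ 3 / 6" 
  proof -
    have "b - b ^ 3 / 6 = b * (1 - b\<^sup>2 / 6)" by (simp add: algebra_simps power2_eq_square power3_eq_cube)
    then show ?thesis using b b2 by simp
  qed
  have "(1 + 3 * b\<^sup>2 / 2) * (b - b ^ 3 / 6) \<le> cosh (r * pi * Re e) * sin b"
    using c sin_ge_cubic[OF b(1)] s0 by (intro mult_mono) auto
  \<comment> \<open>The linear terms cancel, and 3 / 2 - 1 / 6 = 4 / 3 is the cubic coefficient. As
    the square of \<open>b\<close> is at most 2.56, the bracket exceeds 1 / 2, and the cube of \<pi>
    / 2 exceeds 2, which absorbs that half.\<close>
  moreover have "(1 + 3 * b\<^sup>2 / 2) * (b - b ^ 3 / 6) - b = b ^ 3 * (4 / 3 - b\<^sup>2 / 4)"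
    by (simp add: algebra_simps power2_eq_square power3_eq_cube)
  moreover have "b ^ 3 * (1 / 2) \<le> b ^ 3 * (4 / 3 - b\<^sup>2 / 4)"
    using b b2 by (intro mult_left_mono) auto
  moreover have "r ^ 3 \<le> b ^ 3 * (1 / 2)"
  proof -
    have "(3 / 2) ^ 3 \<le> (pi / 2) ^ 3" using pi_gt3 by (intro power_mono) auto
    then have "2 \<le> (pi / 2) ^ 3" by (simp add: power3_eq_cube)
    then have "r ^ 3 * 2 \<le> r ^ 3 * (pi / 2) ^ 3" using assms by (intro mult_left_mono) auto
    also have "\<dots> = b ^ 3" by (simp add: b_def power_mult_distrib[symmetric])
    finally show ?thesis by simp
  qed
  moreover have "Im (sinh (of_real (r * pi) * e) - of_real (r * pi) * e) = cosh (r * pi * Re e) * sin b - b"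
  proof -
    have "Im (of_real (r * pi) * e) = r * pi * Im e" by simp
    also have "\<dots> = b" unfolding assms(2) b_def by simp
    finally show ?thesis by (simp only: minus_complex.sel Im_sinh) simp
  qed
  ultimately show ?thesis by linarith
qed


text \<open>The unit vectors of argument \<pi> / 6 and 5 \<pi> / 6. The estimates see the real part
  only through its absolute value, so one predicate treats both rays.\<close>

definition ray_direction :: "complex \<Rightarrow> bool" where
  "ray_direction e \<longleftrightarrow> \<bar>Re e\<bar> = sqrt 3 / 2 \<and> Im e = 1 / 2"

lemma ray_direction_cube: "e ^ 3 = \<i>" and ray_direction_norm: "norm e = 1"
  if "ray_direction e"
proof -
  have r: "(Re e)\<^sup>2 = 3 / 4"
  proof -
    have "(Re e)\<^sup>2 = \<bar>Re e\<bar>\<^sup>2" by simp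
    also have "\<dots> = 3 / 4" unfolding that[unfolded ray_direction_def, THEN conjunct1] by (simp add: power_divide)
    finally show ?thesis .
  qed
  have i: "Im e = 1 / 2" using that by (simp add: ray_direction_def)
  have "Re e * Re e = 3 / 4" using r by (simp add: power2_eq_square)
  then have rr: "Re e * (Re e * x) = 3 / 4 * x" for x by (metis mult.assoc)
  show "e ^ 3 = \<i>"
    using r by (simp add: complex_eq_iff power3_eq_cube i algebra_simps rr power2_eq_square)
  show "norm e = 1" unfolding cmod_def r i by (simp add: power_divide)
qed

lemma ray_in_strip:
  assumes "ray_direction e" "0 \<le> r" "r \<le> 1"
  shows "of_real (r * pi) * e \<in> strip"
proof -
  have "r * pi \<le> 1 * pi" using assms by (intro mult_right_mono) auto
  moreover have "0 \<le> r * pi" using assms by simp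
  ultimately have "\<bar>r * pi * (1 / 2)\<bar> < 2 * pi" using pi_gt_zero by linarith
  moreover have "Im (of_real (r * pi) * e) = r * pi * (1 / 2)"
  proof -
    have "Im e = 1 / 2" using assms(1) by (simp add: ray_direction_def)
    then show ?thesis by (simp only: times_complex.sel Im_complex_of_real Re_complex_of_real mult_zero_left add_0_right)
  qed
  ultimately show ?thesis by (simp only: strip_def mem_Collect_eq)
qed

text \<open>As the cube of the point is \<open>\<i>\<close> times a positive number, the real part
  of \<open>1 / B_base\<close> is a positive multiple of \<open>Im (sinh u - u)\<close>, which the
  cubic estimate bounds below. In the right half plane the principal root is continuous and hence is
  the branch.\<close>

lemma cbrt_sinh_ray:
  assumes e: "ray_direction e" and r: "0 \<le> r" "r \<le> 1"
  shows "cbrt_sinh (of_real (r * pi) * e) = of_real (r * pi) * e / (B_base (of_real (r * pi) * e)) powr (1 / 3)"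
    and "Re (1 / B_base (of_real (r * pi) * e)) > 0"
proof -
  define p where "p = (\<lambda>r. complex_of_real (r * pi) * e)"
  have pos: "Re (1 / B_base (p r)) > 0" if "0 \<le> r" "r \<le> 1" for r
  proof (cases "r = 0")
    case True then show ?thesis by (simp add: p_def B_base_def)
  next
    case False
    then have r: "r > 0" using that by simp
    have "p r \<noteq> 0" using r ray_direction_norm[OF e] pi_gt_zero by (auto simp: p_def)
    then have "1 / B_base (p r) = 6 * (sinh (p r) - p r) / p r ^ 3" by (simp add: B_base_def)
    also have "p r ^ 3 = \<i> * of_real ((r * pi) ^ 3)"
      by (simp add: p_def power_mult_distrib ray_direction_cube[OF e])
    also have "6 * (sinh (p r) - p r) / (\<i> * of_real ((r * pi) ^ 3)) = - \<i> * (sinh (p r) - p r) * of_real (6 / (r * pi) ^ 3)"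
      using r by (simp add: field_simps)
    also have "Re \<dots> = Im (sinh (p r) - p r) * (6 / (r * pi) ^ 3)"
    proof -
      have "Re (- \<i> * z * of_real c) = Im z * c" for z c by simp
      then show ?thesis .
    qed
    finally have 1: "Re (1 / B_base (p r)) = Im (sinh (p r) - p r) * (6 / (r * pi) ^ 3)" .
    have "r ^ 3 \<le> Im (sinh (p r) - p r)"
      unfolding p_def using e that by (intro Im_sinh_minus_self_ray) (auto simp: ray_direction_def)
    moreover have "r ^ 3 > 0" using r by simp
    ultimately have "Im (sinh (p r) - p r) > 0" by linarith
    then show ?thesis unfolding 1 using r by (intro mult_pos_pos divide_pos_pos) auto
  qed
  show "Re (1 / B_base (of_real (r * pi) * e)) > 0" using pos[OF r] by (simp add: p_def)
  have pos': "Re (B_base (p r)) > 0" if "0 \<le> r" "r \<le> 1" for r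
    using pos[OF that] by (auto simp: Re_divide zero_less_divide_iff not_sum_power2_lt_zero)
  have "cbrt_base (p r) = B_base (p r) powr (1 / 3)"
  proof (rule powers_eq_on_connected[where S = "{0..1}" and n = 3 and a = 0
        and f = "\<lambda>r. cbrt_base (p r)" and g = "\<lambda>r. B_base (p r) powr (1 / 3)"])
    have im: "p ` {0..1} \<subseteq> strip" using ray_in_strip[OF e] by (auto simp: p_def)
    have cp: "continuous_on {0..1} p" unfolding p_def by (intro continuous_intros)
    show "continuous_on {0..1} (\<lambda>r. cbrt_base (p r))"
      by (rule continuous_on_compose2[OF holomorphic_on_imp_continuous_on[OF cbrt_base_holomorphic] cp im])
    have "continuous_on {0..1} (\<lambda>r. B_base (p r))"
      by (rule continuous_on_compose2[OF holomorphic_on_imp_continuous_on[OF B_base_holomorphic] cp im])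
    then show "continuous_on {0..1} (\<lambda>r. B_base (p r) powr (1 / 3))"
      using pos' by (intro continuous_on_powr_Re_pos continuous_intros) auto
    fix z :: real assume "z \<in> {0..1}"
    then have z: "p z \<in> strip" using im by blast
    show "B_base (p z) powr (1 / 3) \<noteq> 0" using B_base_nonzero[OF z] by simp
    show "cbrt_base (p z) ^ 3 = (B_base (p z) powr (1 / 3)) ^ 3"
      using B_base_nonzero[OF z] by (simp only: cbrt_base_cube[OF z] powr_third_cube not_False_eq_True)
  qed (use r in \<open>auto simp: p_def B_base_def\<close>)
  then show "cbrt_sinh (of_real (r * pi) * e) = of_real (r * pi) * e / (B_base (of_real (r * pi) * e)) powr (1 / 3)"
    by (simp add: cbrt_sinh_def p_def)
qed

text \<open>At the end of the ray the cube of \<open>cbrt_sinh\<close> is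
  \<open>6 * \<i> * b\<close>, so the powers of \<open>b\<close> cancel. This makes the leading
  Gamma term of the ray integral independent of where the ray is cut, while
  \<open>1 \<le> Re b\<close> makes the cut cost only \<open>exp (1 - t)\<close>.\<close>

lemma cbrt_sinh_ray_end:
  assumes e: "ray_direction e"
  defines "b \<equiv> - \<i> * (sinh (of_real pi * e) - of_real pi * e)"
  shows "1 \<le> Re b" and "cbrt_sinh (of_real pi * e) ^ m * b powr (- (of_nat m / 3)) = e ^ m * of_real (6 powr (real m / 3))"
proof -
  define u where "u = of_real pi * e"
  have s: "u \<in> strip" using ray_in_strip[OF e, of 1] by (simp add: u_def)
  show b1: "1 \<le> Re b" 
    using Im_sinh_minus_self_ray[of e 1] e by (simp add: b_def ray_direction_def)
  then have b0: "b \<noteq> 0" by auto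
  have u0: "u \<noteq> 0" using ray_direction_norm[OF e] by (auto simp: u_def)
  define k where "k = 1 / B_base u"
  have k: "Re k > 0" using cbrt_sinh_ray(2)[OF e, of 1] by (simp add: k_def u_def)
  then have k0: "k \<noteq> 0" by auto
  have "k = 6 * (sinh u - u) / u ^ 3" using u0 by (simp add: k_def B_base_def)
  also have "u ^ 3 = \<i> * of_real (pi ^ 3)" by (simp add: u_def power_mult_distrib ray_direction_cube[OF e])
  also have "6 * (sinh u - u) / (\<i> * of_real (pi ^ 3)) = of_real (6 / pi ^ 3) * b"
  proof -
    have "6 * x / (\<i> * p) = 6 / p * (- \<i> * x)" if "p \<noteq> 0" for x p :: complex
      using that by (simp add: field_simps)
    note alg = this[of "of_real (pi ^ 3)" "sinh u - u"]
    have "b = - \<i> * (sinh u - u)" by (simp add: b_def u_def)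
    then show ?thesis unfolding of_real_divide of_real_numeral by (simp only:) (rule alg, simp)
  qed
  finally have kb: "k = of_real (6 / pi ^ 3) * b" .
  have "Ln (1 / k) = - Ln k"
    using k by (simp add: inverse_eq_divide[symmetric] Ln_inverse complex_nonpos_Reals_iff)
  then have "(1 / k) powr (1 / 3) = 1 / (k powr (1 / 3))"
    using k0 by (simp add: powr_def exp_minus inverse_eq_divide)
  then have W: "cbrt_sinh u = u * k powr (1 / 3)"
    using cbrt_sinh_ray(1)[OF e, of 1] by (simp add: u_def[symmetric] k_def)
  have "of_real pi * complex_of_real ((6 / pi ^ 3) powr (1 / 3)) = of_real (6 powr (1 / 3))"
  proof -
    have "(pi ^ 3) powr (1 / 3) = (pi powr 3) powr (1 / 3)" by simp
    also have "\<dots> = pi" unfolding powr_powr by simp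
    finally have "pi * (6 / pi ^ 3) powr (1 / 3) = 6 powr (1 / 3)"
      by (simp add: powr_divide)
    then show ?thesis by (metis of_real_mult)
  qed
  moreover have "k powr (1 / 3) = of_real ((6 / pi ^ 3) powr (1 / 3)) * b powr (1 / 3)"
    unfolding kb using powr_of_real[of "6 / pi ^ 3" "1 / 3"] by (subst powr_times_real_left) auto
  moreover have "cbrt_sinh u = e * (of_real pi * x) * y" if "k powr (1 / 3) = x * y" for x y
    unfolding W that unfolding u_def by (simp only: mult_ac)
  ultimately have W2: "cbrt_sinh u = e * of_real (6 powr (1 / 3)) * b powr (1 / 3)"
    by (simp only:)
  have "(b powr (1 / 3)) ^ m * b powr (- (of_nat m / 3)) = 1"
  proof -
    have "(b powr (1 / 3)) ^ m = b powr (of_nat m / 3)"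
      using b0 by (simp add: powr_def exp_of_nat_mult[symmetric])
    then show ?thesis using b0 by (simp add: powr_minus)
  qed
  moreover have "complex_of_real (6 powr (1 / 3)) ^ m = of_real (6 powr (real m / 3))"
    unfolding of_real_power[symmetric] by (simp add: powr_power)
  ultimately show "cbrt_sinh (of_real pi * e) ^ m * b powr (- (of_nat m / 3)) = e ^ m * of_real (6 powr (real m / 3))"
    unfolding u_def[symmetric] W2 power_mult_distrib by (simp add: mult.assoc)
qed


text \<open>Truncating the Gamma integral at 1 leaves an exponentially small tail, negligible
  against every power of \<open>t\<close>.\<close>

lemma gamma_integral_unit_interval:
  fixes b :: complex and a t :: real
  assumes a: "a > 0" and t: "1 \<le> t" "t \<le> Re b"
    and I: "((\<lambda>\<tau>. of_real \<tau> powr (of_real a - 1) * exp (- (b * of_real \<tau>))) has_integral I) {0..1}"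
  shows "norm (Gamma (of_real a) * b powr (- of_real a) - I) \<le> Gamma a * exp (1 - t)"
proof -
  define f where "f = (\<lambda>\<tau>. of_real \<tau> powr (of_real a - 1) * exp (- (b * complex_of_real \<tau>)))"
  have H: "has_bochner_integral lborel (\<lambda>\<tau>. indicator {0<..} \<tau> *\<^sub>R f \<tau>) (Gamma (of_real a) * b powr (- of_real a))"
    unfolding f_def by (rule gamma_integral_complex_scaled) (use a t in auto)
  then have int: "set_integrable lborel {0<..} f"
    unfolding set_integrable_def by (simp add: has_bochner_integral_iff)
  have i1: "set_integrable lborel {0<..1} f" and i2: "set_integrable lborel {1<..} f"
    by (rule set_integrable_subset[OF int]; auto)+
  have "(LINT \<tau>:{0<..}|lborel. f \<tau>) = (LINT \<tau>:{0<..1}|lborel. f \<tau>) + (LINT \<tau>:{1<..}|lborel. f \<tau>)"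
  proof -
    have u: "{0::real<..} = {0<..1} \<union> {1<..}" by auto
    show ?thesis unfolding u by (rule set_integral_Un) (use i1 i2 in auto)
  qed
  moreover have "(LINT \<tau>:{0<..}|lborel. f \<tau>) = Gamma (of_real a) * b powr (- of_real a)"
    unfolding set_lebesgue_integral_def using H by (rule has_bochner_integral_integral_eq)
  moreover have "(LINT \<tau>:{0<..1}|lborel. f \<tau>) = I"
  proof -
    have "(LINT \<tau>:{0<..1}|lborel. f \<tau>) = integral {0<..1} f"
      by (rule set_borel_integral_eq_integral(2)[OF i1])
    also have "\<dots> = integral {0..1} f"
      by (rule integral_subset_negligible) (auto intro: negligible_subset[of "{0}"])
    also have "\<dots> = I" using I unfolding f_def by (rule integral_unique)
    finally show ?thesis .
  qed
  ultimately have e: "Gamma (of_real a) * b powr (- of_real a) - I = (LINT \<tau>:{1<..}|lborel. f \<tau>)"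
    by simp
  have G: "has_bochner_integral lborel (\<lambda>\<tau>. exp (1 - t) * Re (indicator {0<..} \<tau> *\<^sub>R (of_real \<tau> powr (of_real a - 1) * exp (- (1 * complex_of_real \<tau>)))))
      (exp (1 - t) * Re (Gamma (of_real a) * 1 powr (- of_real a)))"
    by (intro has_bochner_integral_mult_right has_bochner_integral_Re gamma_integral_complex_scaled) (use a in auto)
  have "norm (LINT \<tau>:{1<..}|lborel. f \<tau>) \<le> (LINT \<tau>|lborel. norm (indicator {1<..} \<tau> *\<^sub>R f \<tau>))"
    unfolding set_lebesgue_integral_def by (rule integral_norm_bound)
  also have "\<dots> \<le> (LINT \<tau>|lborel. exp (1 - t) * Re (indicator {0<..} \<tau> *\<^sub>R (of_real \<tau> powr (of_real a - 1) * exp (- (1 * complex_of_real \<tau>)))))"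
  proof (rule integral_mono)
    show "integrable lborel (\<lambda>\<tau>. norm (indicator {1<..} \<tau> *\<^sub>R f \<tau>))"
      using i2 unfolding set_integrable_def by (rule integrable_norm)
    show "integrable lborel (\<lambda>\<tau>. exp (1 - t) * Re (indicator {0<..} \<tau> *\<^sub>R (of_real \<tau> powr (of_real a - 1) * exp (- (1 * complex_of_real \<tau>)))))"
      using G by (rule integrable.intros)
    fix \<tau> :: real
    show "norm (indicator {1<..} \<tau> *\<^sub>R f \<tau>) \<le> exp (1 - t) * Re (indicator {0<..} \<tau> *\<^sub>R (of_real \<tau> powr (of_real a - 1) * exp (- (1 * complex_of_real \<tau>))))"
    proof (cases "\<tau> > 0")
      case True
      have p: "of_real \<tau> powr (of_real a - 1) = complex_of_real (\<tau> powr (a - 1))"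
        using True powr_of_real[of \<tau> "a - 1"] by simp
      have q: "exp (- (1 * complex_of_real \<tau>)) = of_real (exp (- \<tau>))"
        by (simp add: exp_of_real[symmetric])
      have "norm (f \<tau>) \<le> exp (1 - t) * (\<tau> powr (a - 1) * exp (- \<tau>))" if "\<tau> > 1"
      proof -
        \<comment> \<open>One unit of the decay rate is kept for the dominating Gamma integrand; the
          remaining rate \<open>Re b - 1 \<ge> t - 1\<close>, used at its weakest point 1, yields
          \<open>exp (1 - t)\<close>.\<close>
        have "(Re b - 1) * 1 \<le> (Re b - 1) * \<tau>" using t that by (intro mult_left_mono) auto
        then have "- (Re b * \<tau>) \<le> (1 - t) + - \<tau>" using t by (simp add: algebra_simps)
        then have "exp (- (Re b * \<tau>)) \<le> exp (1 - t) * exp (- \<tau>)" unfolding exp_add[symmetric] by (simp only: exp_le_cancel_iff)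
        then have "\<tau> powr (a - 1) * exp (- (Re b * \<tau>)) \<le> \<tau> powr (a - 1) * (exp (1 - t) * exp (- \<tau>))"
          by (rule mult_left_mono) simp
        then show ?thesis by (simp add: f_def norm_mult p mult_ac)
      qed
      then show ?thesis using True unfolding p q by (cases "\<tau> > 1") auto
    qed simp
  qed
  also have "\<dots> = exp (1 - t) * Re (Gamma (of_real a) * 1 powr (- of_real a))"
    using G by (rule has_bochner_integral_integral_eq)
  also have "\<dots> = Gamma a * exp (1 - t)" by (simp add: Gamma_complex_of_real)
  finally show ?thesis unfolding e .
qed

section \<open>Exact integration of the terms of the expansion\<close>

lemma entire_has_primitive:
  assumes "f holomorphic_on UNIV"
  shows "\<exists>F. \<forall>z. (F has_field_derivative f z) (at z)"
  using holomorphic_convex_primitive'[OF convex_UNIV open_UNIV assms] by auto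

text \<open>With \<open>w = cbrt_sinh u\<close> the integrand becomes \<phi> with exponent
  \<open>\<i> * t * w ^ 3 / 6\<close>, which is entire, so the integral depends only on the image
  \<open>w1\<close> of the end point. The same difference of primitives, taken along the path
  \<sigma>, is a truncated Gamma integral.\<close>

lemma ray_power_integral:
  fixes t :: real and m :: nat
  assumes e: "ray_direction e" and t: "t \<ge> 1"
  defines "p \<equiv> (\<lambda>r. of_real (r * pi) * e)" and "a \<equiv> real (m + 1) / 3"
  shows "norm (integral {0..1} (\<lambda>r. exp (\<i> * of_real t * (sinh (p r) - p r)) * (cbrt_sinh (p r) ^ m * deriv cbrt_sinh (p r)) * (of_real pi * e))
      - of_real (Gamma a / 3 * (6 / t) powr a) * e ^ (m + 1))
    \<le> norm (cbrt_sinh (of_real pi * e)) ^ (m + 1) * Gamma a / 3 * exp (1 - t)"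
proof -
  let ?W = cbrt_sinh
  have pe: "p r \<in> strip" if "r \<in> {0..1}" for r
    using ray_in_strip[OF e] that by (auto simp: p_def)
  define w1 where "w1 = ?W (p 1)"
  have p1: "p 1 = of_real pi * e" by (simp add: p_def)
  have w10: "w1 \<noteq> 0" using ray_direction_norm[OF e] by (auto simp: w1_def p1)
  define \<phi> where "\<phi> = (\<lambda>w. exp (\<i> * of_real t * w ^ 3 / 6) * w ^ m)"
  have "\<phi> holomorphic_on UNIV" unfolding \<phi>_def by (intro holomorphic_intros) auto
  then obtain \<Phi> where \<Phi>: "\<And>z. (\<Phi> has_field_derivative \<phi> z) (at z)" using entire_has_primitive by blast
  have "((\<lambda>r. exp (\<i> * of_real t * (sinh (p r) - p r)) * (?W (p r) ^ m * deriv ?W (p r)) * (of_real pi * e)) has_integral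
      (\<Phi> \<circ> (?W \<circ> p)) 1 - (\<Phi> \<circ> (?W \<circ> p)) 0) {0..1}"
  proof (rule fundamental_theorem_of_calculus)
    fix r :: real assume r: "r \<in> {0..1}"
    have "(p has_vector_derivative of_real pi * e) (at r)"
      unfolding p_def has_vector_derivative_def
      by (auto intro!: derivative_eq_intros simp: fun_eq_iff scaleR_conv_of_real)
    moreover have "(?W has_field_derivative deriv ?W (p r)) (at (p r))"
      using cbrt_sinh_holomorphic strip_open pe[OF r] holomorphic_derivI by blast
    ultimately have "((?W \<circ> p) has_vector_derivative (of_real pi * e * deriv ?W (p r))) (at r)"
      by (rule field_vector_diff_chain_at)
    from field_vector_diff_chain_at[OF this \<Phi>]
    have D: "((\<Phi> \<circ> (?W \<circ> p)) has_vector_derivative (of_real pi * e * deriv ?W (p r) * \<phi> ((?W \<circ> p) r))) (at r)" .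
    have "\<i> * of_real t * ?W (p r) ^ 3 / 6 = \<i> * of_real t * (sinh (p r) - p r)"
      unfolding cbrt_sinh_cube[OF pe[OF r]] by simp
    then have E: "of_real pi * e * deriv ?W (p r) * \<phi> ((?W \<circ> p) r) = exp (\<i> * of_real t * (sinh (p r) - p r)) * (?W (p r) ^ m * deriv ?W (p r)) * (of_real pi * e)"
      unfolding \<phi>_def o_def by (simp only: mult_ac)
    show "((\<Phi> \<circ> (?W \<circ> p)) has_vector_derivative exp (\<i> * of_real t * (sinh (p r) - p r)) * (?W (p r) ^ m * deriv ?W (p r)) * (of_real pi * e)) (at r within {0..1})"
      by (rule has_vector_derivative_at_within[OF D[unfolded E]])
  qed simp
  note ftc1 = integral_unique[OF this]
  have p0: "p 0 = 0" by (simp add: p_def)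
  from ftc1 have L: "integral {0..1} (\<lambda>r. exp (\<i> * of_real t * (sinh (p r) - p r)) * (?W (p r) ^ m * deriv ?W (p r)) * (of_real pi * e)) = \<Phi> w1 - \<Phi> 0"
    by (simp only: o_def w1_def p0 cbrt_sinh_0)
  define b1 where "b1 = - \<i> * (sinh (of_real pi * e) - of_real pi * e)"
  define b where "b = of_real t * b1"
  \<comment> \<open>A path from 0 to \<open>w1\<close> whose cube is linear in the parameter, so
    that the exponent becomes \<open>- b * \<tau>\<close>. The cube root is not differentiable at 0,
    which is why the fundamental theorem is used with interior derivatives.\<close>
  define \<sigma> where "\<sigma> = (\<lambda>\<tau>. w1 * complex_of_real (\<tau> powr (1 / 3)))"
  have w13: "\<i> * of_real t * w1 ^ 3 / 6 = - b"
    unfolding w1_def cbrt_sinh_cube[OF pe[of 1, simplified]] by (simp add: b_def b1_def p1)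
  have a: "a > 0" by (simp add: a_def)
  have "((\<lambda>\<tau>. w1 ^ (m + 1) / 3 * (of_real \<tau> powr (of_real a - 1) * exp (- (b * of_real \<tau>)))) has_integral (\<Phi> \<circ> \<sigma>) 1 - (\<Phi> \<circ> \<sigma>) 0) {0..1}"
  proof (rule fundamental_theorem_of_calculus_interior)
    have "continuous_on UNIV \<Phi>"
      using \<Phi> DERIV_isCont continuous_at_imp_continuous_on by blast
    moreover have "continuous_on {0..1} \<sigma>"
      unfolding \<sigma>_def by (intro continuous_intros continuous_on_powr') auto
    ultimately show "continuous_on {0..1} (\<Phi> \<circ> \<sigma>)"
      using continuous_on_compose continuous_on_subset by blast
    fix \<tau> :: real assume "\<tau> \<in> {0<..<1}"
    then have \<tau>: "\<tau> > 0" by simp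
    have "((\<lambda>\<tau>. \<tau> powr (1 / 3)) has_real_derivative (1 / 3) * \<tau> powr (1 / 3 - 1)) (at \<tau>)"
      using has_real_derivative_powr[OF \<tau>, of "1 / 3"] by simp
    then have "((\<lambda>\<tau>. complex_of_real (\<tau> powr (1 / 3))) has_vector_derivative of_real ((1 / 3) * \<tau> powr (1 / 3 - 1))) (at \<tau>)"
      by (intro has_vector_derivative_of_real) (simp only: has_real_derivative_iff_has_vector_derivative)
    then have "(\<sigma> has_vector_derivative w1 * of_real ((1 / 3) * \<tau> powr (1 / 3 - 1))) (at \<tau>)"
      unfolding \<sigma>_def by (rule has_vector_derivative_mult_right)
    from field_vector_diff_chain_at[OF this \<Phi>]
    have D: "((\<Phi> \<circ> \<sigma>) has_vector_derivative w1 * of_real ((1 / 3) * \<tau> powr (1 / 3 - 1)) * \<phi> (\<sigma> \<tau>)) (at \<tau>)" .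
    have E: "w1 * of_real ((1 / 3) * \<tau> powr (1 / 3 - 1)) * \<phi> (\<sigma> \<tau>) = w1 ^ (m + 1) / 3 * (of_real \<tau> powr (of_real a - 1) * exp (- (b * of_real \<tau>)))"
    proof -
      have "(\<tau> powr (1 / 3)) ^ 3 = \<tau>" using \<tau> by (simp add: powr_power)
      then have "\<sigma> \<tau> ^ 3 = w1 ^ 3 * of_real \<tau>" unfolding \<sigma>_def power_mult_distrib of_real_power[symmetric] by simp
      then have "\<i> * of_real t * \<sigma> \<tau> ^ 3 / 6 = (\<i> * of_real t * w1 ^ 3 / 6) * of_real \<tau>" by simp
      then have 1: "\<i> * of_real t * \<sigma> \<tau> ^ 3 / 6 = - (b * of_real \<tau>)" unfolding w13 by simp
      have "\<sigma> \<tau> ^ m = w1 ^ m * of_real (\<tau> powr (real m / 3))"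
        unfolding \<sigma>_def power_mult_distrib of_real_power[symmetric] using \<tau> by (simp add: powr_power)
      moreover have "complex_of_real ((1 / 3) * \<tau> powr (1 / 3 - 1)) * of_real (\<tau> powr (real m / 3)) = of_real (\<tau> powr (a - 1)) / 3"
        using \<tau> unfolding of_real_mult[symmetric] by (simp add: a_def powr_add[symmetric] add_divide_distrib)
      moreover have "of_real \<tau> powr (of_real a - 1) = complex_of_real (\<tau> powr (a - 1))"
        using \<tau> powr_of_real[of \<tau> "a - 1"] by simp
      ultimately show ?thesis unfolding \<phi>_def 1 by (simp add: mult_ac)
    qed
    show "((\<Phi> \<circ> \<sigma>) has_vector_derivative w1 ^ (m + 1) / 3 * (of_real \<tau> powr (of_real a - 1) * exp (- (b * of_real \<tau>)))) (at \<tau>)"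
      by (rule D[unfolded E])
  qed simp
  then have "((\<lambda>\<tau>. w1 ^ (m + 1) / 3 * (of_real \<tau> powr (of_real a - 1) * exp (- (b * of_real \<tau>)))) has_integral \<Phi> w1 - \<Phi> 0) {0..1}"
    by (simp add: \<sigma>_def)
  from has_integral_mult_right[OF this, of "3 / w1 ^ (m + 1)"]
  have I: "((\<lambda>\<tau>. of_real \<tau> powr (of_real a - 1) * exp (- (b * of_real \<tau>))) has_integral 3 / w1 ^ (m + 1) * (\<Phi> w1 - \<Phi> 0)) {0..1}"
    using w10 by simp
  have "Re b1 \<ge> 1" unfolding b1_def by (rule cbrt_sinh_ray_end(1)[OF e])
  then have tb: "t \<le> Re b" using t mult_left_mono[of 1 "Re b1" t] by (simp add: b_def)
  have est: "norm (Gamma (of_real a) * b powr (- of_real a) - 3 / w1 ^ (m + 1) * (\<Phi> w1 - \<Phi> 0)) \<le> Gamma a * exp (1 - t)"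
    by (rule gamma_integral_unit_interval[OF a t tb I])
  have main: "w1 ^ (m + 1) / 3 * (Gamma (of_real a) * b powr (- of_real a)) = of_real (Gamma a / 3 * (6 / t) powr a) * e ^ (m + 1)"
  proof -
    have "b powr (- of_real a) = of_real (t powr (- a)) * b1 powr (- of_real a)"
      unfolding b_def using t powr_of_real[of t "- a"] by (subst powr_times_real_left) auto
    moreover have "w1 ^ (m + 1) * b1 powr (- of_real a) = e ^ (m + 1) * of_real (6 powr a)"
      using cbrt_sinh_ray_end(2)[OF e, of "m + 1"] unfolding b1_def[symmetric] w1_def p1 a_def by simp
    ultimately have "w1 ^ (m + 1) * b powr (- of_real a) = e ^ (m + 1) * of_real (6 powr a) * of_real (t powr (- a))"
      by (metis mult.assoc mult.commute)
    also have "\<dots> = e ^ (m + 1) * of_real ((6 / t) powr a)"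
    proof -
      have "6 powr a * t powr (- a) = (6 / t) powr a" by (simp add: powr_divide powr_minus field_simps)
      then show ?thesis unfolding mult.assoc of_real_mult[symmetric] by (simp only:)
    qed
    finally have 1: "w1 ^ (m + 1) * b powr (- of_real a) = e ^ (m + 1) * of_real ((6 / t) powr a)" .
    have "w1 ^ (m + 1) / 3 * (Gamma (of_real a) * b powr (- of_real a)) = Gamma (of_real a) / 3 * (w1 ^ (m + 1) * b powr (- of_real a))"
      by simp
    also have "\<dots> = of_real (Gamma a / 3 * (6 / t) powr a) * e ^ (m + 1)"
      unfolding 1 by (simp add: Gamma_complex_of_real)
    finally show ?thesis .
  qed
  have "norm (\<Phi> w1 - \<Phi> 0 - of_real (Gamma a / 3 * (6 / t) powr a) * e ^ (m + 1))
     = norm (w1 ^ (m + 1) / 3 * (Gamma (of_real a) * b powr (- of_real a) - 3 / w1 ^ (m + 1) * (\<Phi> w1 - \<Phi> 0)))"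
    unfolding main[symmetric] right_diff_distrib using w10 by (subst norm_minus_commute) simp
  also have "\<dots> \<le> norm w1 ^ (m + 1) / 3 * (Gamma a * exp (1 - t))"
    unfolding norm_mult norm_divide norm_power using est by (intro mult_mono) auto
  finally show ?thesis unfolding L by (simp add: w1_def p1)
qed


section \<open>Bounds for the remainder along a ray\<close>

lemma exp_minus_le_powr: "exp (- y) \<le> a powr a * y powr (- a)" if "a > 0" "y > 0" for a y :: real
proof -
  have "y / a \<le> exp (y / a)" using exp_ge_add_one_self[of "y / a"] by linarith
  then have "(y / a) powr a \<le> exp (y / a) powr a" using that by (intro powr_mono2) auto
  also have "exp (y / a) powr a = exp y" using that by (simp add: powr_def)
  finally have "y powr a / a powr a \<le> exp y" by (simp add: powr_divide)
  then show ?thesis using that by (simp add: exp_minus powr_minus field_simps)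
qed

text \<open>Scaling by \<open>t powr (1 / 3)\<close> extracts the power of \<open>t\<close>; the
  remaining integral over the half line is a fixed number \<open>K\<close>, which is why the bound
  holds for small \<open>t\<close> as well.\<close>

lemma cubic_exp_integral_bound:
  "\<exists>K\<ge>0. \<forall>t>0. integral {0..1} (\<lambda>r. r ^ M * exp (- (t * r ^ 3))) \<le> K * t powr (- (real (M + 1) / 3))"
proof -
  define F where "F = (\<lambda>s::real. indicator {0<..} s * (s ^ M * exp (- (s ^ 3))))"
  have mF: "F \<in> borel_measurable lborel" unfolding F_def by simp
  have "has_bochner_integral lborel (\<lambda>t. indicator {0<..} t *\<^sub>R (of_real t powr (of_nat (M + 1) - 1) * exp (- (1 * complex_of_real t))))
    (Gamma (of_nat (M + 1)) * 1 powr (- of_nat (M + 1)))"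
    by (intro gamma_integral_complex_scaled) auto
  then have i: "integrable lborel (\<lambda>t. exp 1 * norm (indicator {0<..} t *\<^sub>R (of_real t powr (of_nat (M + 1) - 1) * exp (- (1 * complex_of_real t)))))"
    by (intro integrable_mult_right integrable_norm) (rule integrable.intros)
  have iF: "integrable lborel F"
  proof (rule Bochner_Integration.integrable_bound[OF i mF], rule AE_I2)
    fix s :: real
    show "norm (F s) \<le> norm (exp 1 * norm (indicator {0<..} s *\<^sub>R (of_real s powr (of_nat (M + 1) - 1) * exp (- (1 * complex_of_real s)))))"
    proof (cases "s > 0")
      case True
      \<comment> \<open>This lets the integrand be dominated by \<open>exp 1\<close> times the Gamma
        integrand of \<open>s ^ M * exp (- s)\<close>.\<close>
      have "s - 1 \<le> s ^ 3"
      proof (cases "s \<le> 1")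
        case True then show ?thesis using \<open>s > 0\<close> by (smt (verit) zero_le_power)
      next
        case False
        then have "s ^ 1 \<le> s ^ 3" by (intro power_increasing) auto
        then show ?thesis by simp
      qed
      then have "exp (- (s ^ 3)) \<le> exp 1 * exp (- s)" unfolding exp_add[symmetric] by simp
      then have "s ^ M * exp (- (s ^ 3)) \<le> s ^ M * (exp 1 * exp (- s))"
        using True by (intro mult_left_mono) auto
      moreover have "of_real s powr (of_nat (M + 1) - 1) = complex_of_real s ^ M"
        using True by (simp add: powr_nat')
      moreover have "norm (exp (- (1 * complex_of_real s))) = exp (- s)" by simp
      ultimately show ?thesis using True by (simp add: F_def norm_mult norm_power mult_ac)
    qed (simp add: F_def)
  qed
  define K where "K = integral\<^sup>L lborel F"
  have K0: "K \<ge> 0" unfolding K_def by (intro integral_nonneg_AE AE_I2) (auto simp: F_def indicator_def)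
  have "integral {0..1} (\<lambda>r. r ^ M * exp (- (t * r ^ 3))) \<le> K * t powr (- (real (M + 1) / 3))" if t: "t > 0" for t
  proof -
    define c where "c = t powr (1 / 3)"
    have c: "c > 0" using t by (simp add: c_def)
    have c3: "c ^ 3 = t" using t by (simp add: c_def powr_power)
    have H: "has_bochner_integral lborel (\<lambda>r. F (0 + c * r)) (K /\<^sub>R \<bar>c\<bar>)"
      using lborel_has_bochner_integral_real_affine_iff[of c F K 0] c iF by (simp add: has_bochner_integral_iff K_def)
    have Fc: "F (0 + c * r) = c ^ M * (indicator {0<..} r * (r ^ M * exp (- (t * r ^ 3))))" for r
      using c by (auto simp: F_def power_mult_distrib c3 zero_less_mult_iff indicator_def)
    have "has_bochner_integral lborel (\<lambda>r. (1 / c ^ M) * F (0 + c * r)) ((1 / c ^ M) * (K /\<^sub>R \<bar>c\<bar>))"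
      by (rule has_bochner_integral_mult_right[OF H])
    then have H2: "has_bochner_integral lborel (\<lambda>r. indicator {0<..} r * (r ^ M * exp (- (t * r ^ 3)))) (K / c ^ (M + 1))"
      unfolding Fc using c by (simp add: field_simps)
    have S: "set_integrable lborel {0..1} (\<lambda>r. r ^ M * exp (- (t * r ^ 3)))"
      by (intro borel_integrable_atLeastAtMost') (intro continuous_intros)
    have "integral {0..1} (\<lambda>r. r ^ M * exp (- (t * r ^ 3))) = (LINT r|lborel. indicator {0..1} r *\<^sub>R (r ^ M * exp (- (t * r ^ 3))))"
      using set_borel_integral_eq_integral(2)[OF S] by (simp add: set_lebesgue_integral_def)
    also have "\<dots> \<le> (LINT r|lborel. indicator {0<..} r * (r ^ M * exp (- (t * r ^ 3))))"
    proof (rule integral_mono_AE)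
      show "integrable lborel (\<lambda>r. indicator {0..1} r *\<^sub>R (r ^ M * exp (- (t * r ^ 3))))"
        using S by (simp add: set_integrable_def)
      show "integrable lborel (\<lambda>r. indicator {0<..} r * (r ^ M * exp (- (t * r ^ 3))))"
        using H2 by (rule integrable.intros)
      have "AE r in lborel. r \<noteq> (0::real)" by (rule AE_lborel_singleton)
      then show "AE r in lborel. indicator {0..1} r *\<^sub>R (r ^ M * exp (- (t * r ^ 3))) \<le> indicator {0<..} r * (r ^ M * exp (- (t * r ^ 3)))"
        by eventually_elim (auto simp: indicator_def)
    qed
    also have "\<dots> = K / c ^ (M + 1)" using H2 by (rule has_bochner_integral_integral_eq)
    also have "c ^ (M + 1) = t powr (real (M + 1) / 3)" using t unfolding c_def by (subst powr_power) auto
    finally show ?thesis by (simp only: powr_minus divide_inverse)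
  qed
  then show ?thesis using K0 by blast
qed

text \<open>Writing \<open>cbrt_sinh u\<close> as \<open>u / cbrt_base u\<close> exposes the factor
  \<open>r ^ M\<close>; the other factor is continuous on a compact ray and hence bounded. The cubic
  decay estimate then reduces the claim to the scaled integral.\<close>

lemma ray_remainder_bound:
  assumes e: "ray_direction e" and g: "g holomorphic_on strip"
  defines "p \<equiv> (\<lambda>r. of_real (r * pi) * e)"
  shows "\<exists>C. \<forall>t>0. norm (integral {0..1} (\<lambda>r. exp (\<i> * of_real t * (sinh (p r) - p r)) * (cbrt_sinh (p r) ^ M * g (p r)) * (of_real pi * e)))
     \<le> C * t powr (- (real (M + 1) / 3))"
proof -
  have im: "p ` {0..1} \<subseteq> strip" using ray_in_strip[OF e] by (auto simp: p_def)
  have cp: "continuous_on {0..1} p" unfolding p_def by (intro continuous_intros)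
  have cc: "continuous_on {0..1} (\<lambda>r. f (p r))" if "f holomorphic_on strip" for f
    by (rule continuous_on_compose2[OF holomorphic_on_imp_continuous_on[OF that] cp im])
  have "(\<lambda>u. (1 / cbrt_base u) ^ M * g u) holomorphic_on strip"
    by (intro holomorphic_intros g cbrt_base_holomorphic) auto
  from compact_continuous_image[OF cc[OF this] compact_Icc]
  have "bounded ((\<lambda>r. (1 / cbrt_base (p r)) ^ M * g (p r)) ` {0..1})"
    by (rule compact_imp_bounded)
  then obtain K0 where "\<forall>x\<in>(\<lambda>r. (1 / cbrt_base (p r)) ^ M * g (p r)) ` {0..1}. norm x \<le> K0"
    unfolding bounded_iff by blast
  then have K0: "norm ((1 / cbrt_base (p r)) ^ M * g (p r)) \<le> K0" if "r \<in> {0..1}" for r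
    using that by blast
  have K00: "K0 \<ge> 0" using order_trans[OF norm_ge_zero K0[of 0]] by simp
  have "(\<lambda>u. sinh u - u) holomorphic_on strip" unfolding sinh_field_def by (intro holomorphic_intros) auto
  note conts = cc[OF this] cc[OF cbrt_sinh_holomorphic] cc[OF g]
  obtain K where K: "K \<ge> 0" "\<And>t. t > 0 \<Longrightarrow> integral {0..1} (\<lambda>r. r ^ M * exp (- (t * r ^ 3))) \<le> K * t powr (- (real (M + 1) / 3))"
    using cubic_exp_integral_bound[of M] by blast
  have "norm (integral {0..1} (\<lambda>r. exp (\<i> * of_real t * (sinh (p r) - p r)) * (cbrt_sinh (p r) ^ M * g (p r)) * (of_real pi * e)))
     \<le> (pi ^ (M + 1) * K0 * K) * t powr (- (real (M + 1) / 3))" if t: "t > 0" for t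
  proof -
    have "norm (integral {0..1} (\<lambda>r. exp (\<i> * of_real t * (sinh (p r) - p r)) * (cbrt_sinh (p r) ^ M * g (p r)) * (of_real pi * e)))
      \<le> integral {0..1} (\<lambda>r. pi ^ (M + 1) * K0 * (r ^ M * exp (- (t * r ^ 3))))"
    proof (rule integral_norm_bound_integral)
      show "(\<lambda>r. exp (\<i> * of_real t * (sinh (p r) - p r)) * (cbrt_sinh (p r) ^ M * g (p r)) * (of_real pi * e)) integrable_on {0..1}"
        by (intro integrable_continuous_real continuous_intros conts)
      show "(\<lambda>r. pi ^ (M + 1) * K0 * (r ^ M * exp (- (t * r ^ 3)))) integrable_on {0..1}"
        by (intro integrable_continuous_real continuous_intros)
      fix r :: real assume r: "r \<in> {0..1}"
      have "r ^ 3 \<le> Im (sinh (p r) - p r)"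
        unfolding p_def using e r by (intro Im_sinh_minus_self_ray) (auto simp: ray_direction_def)
      then have "t * r ^ 3 \<le> t * Im (sinh (p r) - p r)" using t by (intro mult_left_mono) auto
      then have 1: "norm (exp (\<i> * of_real t * (sinh (p r) - p r))) \<le> exp (- (t * r ^ 3))"
        by simp
      have "cbrt_sinh (p r) ^ M * g (p r) = p r ^ M * ((1 / cbrt_base (p r)) ^ M * g (p r))"
        by (simp add: cbrt_sinh_def power_divide)
      moreover have "norm (p r ^ M) = (r * pi) ^ M"
        using r by (simp add: p_def norm_power norm_mult ray_direction_norm[OF e])
      ultimately have 2: "norm (cbrt_sinh (p r) ^ M * g (p r)) \<le> (r * pi) ^ M * K0"
        using K0[OF r] r by (simp only: norm_mult[of "p r ^ M"]) (intro mult_left_mono, auto)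
      have "norm (exp (\<i> * of_real t * (sinh (p r) - p r)) * (cbrt_sinh (p r) ^ M * g (p r)) * (of_real pi * e))
         \<le> exp (- (t * r ^ 3)) * ((r * pi) ^ M * K0) * pi"
        unfolding norm_mult[of "_ * _" "of_real pi * e"] norm_mult[of "exp _"]
        using 1 2 r K00 by (intro mult_mono) (auto simp: norm_mult ray_direction_norm[OF e])
      also have "\<dots> = pi ^ (M + 1) * K0 * (r ^ M * exp (- (t * r ^ 3)))"
        by (simp add: power_mult_distrib mult_ac)
      finally show "norm (exp (\<i> * of_real t * (sinh (p r) - p r)) * (cbrt_sinh (p r) ^ M * g (p r)) * (of_real pi * e))
         \<le> pi ^ (M + 1) * K0 * (r ^ M * exp (- (t * r ^ 3)))" .
    qed
    also have "\<dots> = pi ^ (M + 1) * K0 * integral {0..1} (\<lambda>r. r ^ M * exp (- (t * r ^ 3)))"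
      by (rule integral_mult_right)
    also have "\<dots> \<le> pi ^ (M + 1) * K0 * (K * t powr (- (real (M + 1) / 3)))"
      using K(2)[OF t] K00 by (intro mult_left_mono) auto
    finally show ?thesis by (simp only: mult.assoc)
  qed
  then show ?thesis by blast
qed

lemma ray_asymptotics:
  assumes e: "ray_direction e"
  defines "p \<equiv> (\<lambda>r. of_real (r * pi) * e)"
  shows "\<exists>C. \<forall>t\<ge>1. norm (integral {0..1} (\<lambda>r. exp (\<i> * of_real t * (sinh (p r) - p r) + \<kappa> * p r) * (of_real pi * e))
      - (\<Sum>m<M. B m \<kappa> * (of_real (Gamma (real (m + 1) / 3) / 3 * (6 / t) powr (real (m + 1) / 3)) * e ^ (m + 1))))
     \<le> C * t powr (- (real (M + 1) / 3))"
proof -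
  let ?W = cbrt_sinh
  define \<alpha> where "\<alpha> = real (M + 1) / 3"
  have \<alpha>: "\<alpha> > 0" by (simp add: \<alpha>_def)
  obtain g where g: "g holomorphic_on strip" "\<And>u. u \<in> strip \<Longrightarrow> exp (\<kappa> * u) =
     (\<Sum>m<M. B m \<kappa> * ?W u ^ m * deriv ?W u) + ?W u ^ M * g u"
    using exp_expansion[of \<kappa> M] by blast
  obtain C where C: "\<And>t. t > 0 \<Longrightarrow> norm (integral {0..1} (\<lambda>r. exp (\<i> * of_real t * (sinh (p r) - p r)) * (?W (p r) ^ M * g (p r)) * (of_real pi * e))) \<le> C * t powr (- \<alpha>)"
    using ray_remainder_bound[OF e g(1), of M] unfolding p_def \<alpha>_def by blast
  have im: "p ` {0..1} \<subseteq> strip" using ray_in_strip[OF e] by (auto simp: p_def)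
  have cp: "continuous_on {0..1} p" unfolding p_def by (intro continuous_intros)
  have cc: "continuous_on {0..1} (\<lambda>r. f (p r))" if "f holomorphic_on strip" for f
    by (rule continuous_on_compose2[OF holomorphic_on_imp_continuous_on[OF that] cp im])
  have W': "deriv ?W holomorphic_on strip"
    by (rule holomorphic_deriv[OF cbrt_sinh_holomorphic strip_open])
  have hs: "(\<lambda>u. sinh u - u) holomorphic_on strip" unfolding sinh_field_def by (intro holomorphic_intros) auto
  note conts = cc[OF hs] cc[OF cbrt_sinh_holomorphic] cc[OF g(1)] cc[OF W']
  define D where "D = (\<lambda>m. norm (B m \<kappa>) * (norm (?W (of_real pi * e)) ^ (m + 1) * Gamma (real (m + 1) / 3) / 3))"
  have "norm (integral {0..1} (\<lambda>r. exp (\<i> * of_real t * (sinh (p r) - p r) + \<kappa> * p r) * (of_real pi * e))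
      - (\<Sum>m<M. B m \<kappa> * (of_real (Gamma (real (m + 1) / 3) / 3 * (6 / t) powr (real (m + 1) / 3)) * e ^ (m + 1))))
     \<le> ((\<Sum>m<M. D m) * (exp 1 * \<alpha> powr \<alpha>) + C) * t powr (- \<alpha>)" if t: "t \<ge> 1" for t
  proof -
    define J where "J = (\<lambda>m r. exp (\<i> * of_real t * (sinh (p r) - p r)) * (?W (p r) ^ m * deriv ?W (p r)) * (of_real pi * e))"
    define J' where "J' = (\<lambda>r. exp (\<i> * of_real t * (sinh (p r) - p r)) * (?W (p r) ^ M * g (p r)) * (of_real pi * e))"
    have iJ: "J m integrable_on {0..1}" for m
      unfolding J_def by (intro integrable_continuous_real continuous_intros conts)
    have iJ': "J' integrable_on {0..1}"
      unfolding J'_def by (intro integrable_continuous_real continuous_intros conts)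
    have "integral {0..1} (\<lambda>r. exp (\<i> * of_real t * (sinh (p r) - p r) + \<kappa> * p r) * (of_real pi * e))
       = integral {0..1} (\<lambda>r. (\<Sum>m<M. B m \<kappa> * J m r) + J' r)"
    proof (rule integral_cong)
      fix r :: real assume "r \<in> {0..1}"
      then have r: "p r \<in> strip" using im by blast
      show "exp (\<i> * of_real t * (sinh (p r) - p r) + \<kappa> * p r) * (of_real pi * e) = (\<Sum>m<M. B m \<kappa> * J m r) + J' r"
        unfolding exp_add g(2)[OF r] J_def J'_def
        by (simp add: sum_distrib_left sum_distrib_right distrib_left distrib_right mult_ac)
    qed
    also have "\<dots> = (\<Sum>m<M. B m \<kappa> * integral {0..1} (J m)) + integral {0..1} J'"
    proof -
      have "((\<lambda>r. (\<Sum>m<M. B m \<kappa> * J m r) + J' r) has_integral ((\<Sum>m<M. B m \<kappa> * integral {0..1} (J m)) + integral {0..1} J')) {0..1}"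
        by (intro has_integral_add has_integral_sum has_integral_mult_right integrable_integral iJ iJ') auto
      then show ?thesis by (rule integral_unique)
    qed
    finally have eq: "integral {0..1} (\<lambda>r. exp (\<i> * of_real t * (sinh (p r) - p r) + \<kappa> * p r) * (of_real pi * e))
       = (\<Sum>m<M. B m \<kappa> * integral {0..1} (J m)) + integral {0..1} J'" .
    define G where "G = (\<lambda>m. of_real (Gamma (real (m + 1) / 3) / 3 * (6 / t) powr (real (m + 1) / 3)) * e ^ (m + 1))"
    have bm: "norm (B m \<kappa> * (integral {0..1} (J m) - G m)) \<le> D m * exp (1 - t)" for m
    proof -
      have "norm (integral {0..1} (J m) - G m) \<le> norm (?W (of_real pi * e)) ^ (m + 1) * Gamma (real (m + 1) / 3) / 3 * exp (1 - t)"
        using ray_power_integral[OF e t, of m] unfolding J_def G_def p_def .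
      then show ?thesis unfolding norm_mult D_def mult.assoc by (intro mult_left_mono) auto
    qed
    have D0: "D m \<ge> 0" for m unfolding D_def by (intro mult_nonneg_nonneg divide_nonneg_nonneg) (auto intro: less_imp_le Gamma_real_pos)
    \<comment> \<open>The truncation errors of the individual terms are exponentially small and are
      absorbed into the power that governs the remainder.\<close>
    have "exp (1 - t) = exp 1 * exp (- t)" by (simp add: exp_add[symmetric])
    also have "\<dots> \<le> exp 1 * (\<alpha> powr \<alpha> * t powr (- \<alpha>))" using t by (intro mult_left_mono exp_minus_le_powr \<alpha>) auto
    finally have ex: "exp (1 - t) \<le> exp 1 * \<alpha> powr \<alpha> * t powr (- \<alpha>)" by simp
    have "norm ((\<Sum>m<M. B m \<kappa> * integral {0..1} (J m)) + integral {0..1} J' - (\<Sum>m<M. B m \<kappa> * G m))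
       = norm ((\<Sum>m<M. B m \<kappa> * (integral {0..1} (J m) - G m)) + integral {0..1} J')"
      by (rule arg_cong[where f = norm]) (simp add: right_diff_distrib sum_subtractf algebra_simps)
    also have "\<dots> \<le> (\<Sum>m<M. D m * exp (1 - t)) + C * t powr (- \<alpha>)"
      using C[of t] t bm by (intro norm_triangle_mono order_trans[OF norm_sum] sum_mono) (auto simp: J'_def)
    also have "(\<Sum>m<M. D m * exp (1 - t)) = (\<Sum>m<M. D m) * exp (1 - t)" by (simp add: sum_distrib_right)
    also have "\<dots> \<le> (\<Sum>m<M. D m) * (exp 1 * \<alpha> powr \<alpha> * t powr (- \<alpha>))"
      using ex D0 by (intro mult_left_mono sum_nonneg) auto
    finally show ?thesis unfolding eq G_def by (simp add: algebra_simps)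
  qed
  then show ?thesis unfolding \<alpha>_def by blast
qed

section \<open>The remainder of the Hankel expansion\<close>


lemma norm_hankel_integrand:
  "norm (hankel_integrand \<kappa> t s) = exp (- (t * (cosh s - pi / 2))) * exp (Re \<kappa> * s - Im \<kappa> * (pi / 2))"
  unfolding hankel_integrand_def norm_exp_eq_Re exp_add[symmetric] by (simp add: algebra_simps)

lemma hankel_integrand_measurable: "hankel_integrand \<kappa> t \<in> borel_measurable lborel"
proof -
  have "continuous_on UNIV (hankel_integrand \<kappa> t)"
    unfolding hankel_integrand_def by (intro continuous_intros)
  then show ?thesis using borel_measurable_continuous_onI by simp
qed

text \<open>Bounding \<open>exp (- t * cosh s)\<close> by a power of \<open>t * cosh s\<close>
  trades decay for the factor \<open>t powr (- a)\<close>, and the power of \<open>cosh s\<close>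
  gives \<open>exp (- a * \<bar>s\<bar>)\<close>, which beats the growth of the \<kappa> factor
  exactly because \<open>\<bar>Re \<kappa>\<bar> < a\<close>. This is the estimate for small
  \<open>t\<close>.\<close>

lemma hankel_integrand_bound:
  assumes \<kappa>: "\<bar>Re \<kappa>\<bar> < a"
  shows "\<exists>C\<ge>0. \<forall>t>0. integrable lborel (hankel_integrand \<kappa> t) \<and>
    (LINT s|lborel. norm (hankel_integrand \<kappa> t s)) \<le> C * exp (t * (pi / 2)) * t powr (- a)"
proof -
  have a: "a > 0" using \<kappa> by linarith
  define K where "K = a powr a * 2 powr a * exp (\<bar>Im \<kappa>\<bar> * (pi / 2))"
  define w where "w = (\<lambda>s. exp (- ((a - \<bar>Re \<kappa>\<bar>) * \<bar>s::real\<bar>)))"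
  have w: "integrable lborel w" unfolding w_def using \<kappa> by (intro integrable_exp_minus_abs) simp
  have b: "norm (hankel_integrand \<kappa> t s) \<le> K * exp (t * (pi / 2)) * t powr (- a) * w s" if t: "t > 0" for t s
  proof -
    have c: "cosh s > 0" by (rule cosh_real_pos)
    have 1: "cosh s powr (- a) \<le> 2 powr a * exp (- (a * \<bar>s\<bar>))"
      using add_cosh_powr_le[of a 0 s] a by simp
    have "exp (- (t * cosh s)) \<le> a powr a * (t * cosh s) powr (- a)"
      using a t c by (intro exp_minus_le_powr) auto
    also have "(t * cosh s) powr (- a) = t powr (- a) * cosh s powr (- a)"
      by (rule powr_mult)
    also have "a powr a * (t powr (- a) * cosh s powr (- a)) \<le> a powr a * (t powr (- a) * (2 powr a * exp (- (a * \<bar>s\<bar>))))"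
      using 1 by (intro mult_left_mono) auto
    finally have 2: "exp (- (t * cosh s)) \<le> a powr a * (t powr (- a) * (2 powr a * exp (- (a * \<bar>s\<bar>))))" .
    have "Re \<kappa> * s \<le> \<bar>Re \<kappa>\<bar> * \<bar>s\<bar>" by (metis abs_ge_self abs_mult)
    moreover have "- (Im \<kappa> * (pi / 2)) \<le> \<bar>Im \<kappa>\<bar> * (pi / 2)"
      unfolding mult_minus_left[symmetric] by (intro mult_right_mono) auto
    ultimately have "exp (Re \<kappa> * s - Im \<kappa> * (pi / 2)) \<le> exp (\<bar>Re \<kappa>\<bar> * \<bar>s\<bar>) * exp (\<bar>Im \<kappa>\<bar> * (pi / 2))"
      unfolding exp_add[symmetric] exp_le_cancel_iff by linarith
    then have "norm (hankel_integrand \<kappa> t s) \<le> (exp (- (t * cosh s)) * exp (t * (pi / 2))) * (exp (\<bar>Re \<kappa>\<bar> * \<bar>s\<bar>) * exp (\<bar>Im \<kappa>\<bar> * (pi / 2)))"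
      unfolding norm_hankel_integrand exp_add[symmetric, of "- (t * cosh s)"]
      by (intro mult_mono) (auto simp: algebra_simps)
    also have "\<dots> \<le> (a powr a * (t powr (- a) * (2 powr a * exp (- (a * \<bar>s\<bar>)))) * exp (t * (pi / 2))) * (exp (\<bar>Re \<kappa>\<bar> * \<bar>s\<bar>) * exp (\<bar>Im \<kappa>\<bar> * (pi / 2)))"
      using 2 by (intro mult_right_mono) auto
    also have "\<dots> = K * exp (t * (pi / 2)) * t powr (- a) * (exp (- (a * \<bar>s\<bar>)) * exp (\<bar>Re \<kappa>\<bar> * \<bar>s\<bar>))"
      unfolding K_def by (simp only: mult_ac)
    also have "exp (- (a * \<bar>s\<bar>)) * exp (\<bar>Re \<kappa>\<bar> * \<bar>s\<bar>) = w s"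
      unfolding w_def exp_add[symmetric] by (simp add: algebra_simps)
    finally show ?thesis .
  qed
  have K0: "K \<ge> 0" by (simp add: K_def)
  have "integrable lborel (hankel_integrand \<kappa> t) \<and>
    (LINT s|lborel. norm (hankel_integrand \<kappa> t s)) \<le> (K * integral\<^sup>L lborel w) * exp (t * (pi / 2)) * t powr (- a)" if t: "t > 0" for t
  proof
    have i: "integrable lborel (\<lambda>s. K * exp (t * (pi / 2)) * t powr (- a) * w s)"
      using w by (intro integrable_mult_right)
    show i2: "integrable lborel (hankel_integrand \<kappa> t)"
    proof (rule Bochner_Integration.integrable_bound[OF i hankel_integrand_measurable], rule AE_I2)
      fix s show "norm (hankel_integrand \<kappa> t s) \<le> norm (K * exp (t * (pi / 2)) * t powr (- a) * w s)"
        using b[OF t, of s] abs_ge_self order_trans unfolding real_norm_def by blast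
    qed
    have "(LINT s|lborel. norm (hankel_integrand \<kappa> t s)) \<le> (LINT s|lborel. K * exp (t * (pi / 2)) * t powr (- a) * w s)"
      by (intro integral_mono integrable_norm i2 i b t)
    then show "(LINT s|lborel. norm (hankel_integrand \<kappa> t s)) \<le> (K * integral\<^sup>L lborel w) * exp (t * (pi / 2)) * t powr (- a)"
      by (simp add: mult_ac)
  qed
  moreover have "integral\<^sup>L lborel w \<ge> 0" by (intro integral_nonneg_AE AE_I2) (simp add: w_def)
  ultimately show ?thesis using K0 by (intro exI[of _ "K * integral\<^sup>L lborel w"]) auto
qed

lemma hankel_integrand_integrable: "t > 0 \<Longrightarrow> integrable lborel (hankel_integrand \<kappa> t)"
  using hankel_integrand_bound[of \<kappa> "\<bar>Re \<kappa>\<bar> + 1"] by auto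

section \<open>From the Schlaefli line to the two rays\<close>

definition ray_right :: complex where "ray_right = Complex (sqrt 3 / 2) (1 / 2)"
definition ray_left :: complex where "ray_left = Complex (- sqrt 3 / 2) (1 / 2)"

lemma ray_directions: "ray_direction ray_right" "ray_direction ray_left"
  by (auto simp: ray_direction_def ray_right_def ray_left_def)

text \<open>The integrand is entire, and rays of length \<pi> end on the line at height \<pi> / 2,
  at real parts \<plusminus> \<open>c\<close>. The segment between these ends is therefore the right
  ray minus the left ray.\<close>

lemma hankel_integrand_triangle:
  fixes \<kappa> :: complex and t :: real
  defines "c \<equiv> pi * sqrt 3 / 2"
  defines "f \<equiv> (\<lambda>u. exp (\<i> * of_real t * (sinh u - u) + \<kappa> * u))"
  shows "integral {-c..c} (hankel_integrand \<kappa> t) =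
     integral {0..1} (\<lambda>r. f (of_real (r * pi) * ray_right) * (of_real pi * ray_right))
     - integral {0..1} (\<lambda>r. f (of_real (r * pi) * ray_left) * (of_real pi * ray_left))"
proof -
  have "f holomorphic_on UNIV" unfolding f_def sinh_field_def by (intro holomorphic_intros) auto
  then obtain G where G: "\<And>z. (G has_field_derivative f z) (at z)" using entire_has_primitive by blast
  have c0: "c > 0" by (simp add: c_def)
  have ray: "integral {0..1} (\<lambda>r. f (of_real (r * pi) * e) * (of_real pi * e)) = G (of_real pi * e) - G 0" for e
  proof -
    have "((\<lambda>r. f (of_real (r * pi) * e) * (of_real pi * e)) has_integral (G \<circ> (\<lambda>r. of_real (r * pi) * e)) 1 - (G \<circ> (\<lambda>r. of_real (r * pi) * e)) 0) {0..1}"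
    proof (rule fundamental_theorem_of_calculus)
      fix r :: real
      have "((\<lambda>r. complex_of_real (r * pi) * e) has_vector_derivative of_real pi * e) (at r)"
        unfolding has_vector_derivative_def
        by (auto intro!: derivative_eq_intros simp: fun_eq_iff scaleR_conv_of_real)
      from field_vector_diff_chain_at[OF this G]
      have D: "((G \<circ> (\<lambda>r. of_real (r * pi) * e)) has_vector_derivative of_real pi * e * f (of_real (r * pi) * e)) (at r)" .
      have E: "of_real pi * e * f (of_real (r * pi) * e) = f (of_real (r * pi) * e) * (of_real pi * e)" by (simp only: mult_ac)
      show "((G \<circ> (\<lambda>r. of_real (r * pi) * e)) has_vector_derivative f (of_real (r * pi) * e) * (of_real pi * e)) (at r within {0..1})"
        by (rule has_vector_derivative_at_within[OF D[unfolded E]])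
    qed simp
    from integral_unique[OF this] show ?thesis by (simp only: o_def) simp
  qed
  have hf: "hankel_integrand \<kappa> t s = f (Complex s (pi / 2))" for s
  proof -
    have "sinh (Complex s (pi / 2)) = \<i> * of_real (cosh s)" by (simp add: complex_eq_iff Re_sinh Im_sinh)
    then show ?thesis unfolding f_def hankel_integrand_def Complex_eq
      by (intro arg_cong[where f = exp]) (simp add: Complex_eq algebra_simps)
  qed
  have "((\<lambda>s. f (Complex s (pi / 2))) has_integral (G \<circ> (\<lambda>s. Complex s (pi / 2))) c - (G \<circ> (\<lambda>s. Complex s (pi / 2))) (- c)) {-c..c}"
  proof (rule fundamental_theorem_of_calculus)
    fix r :: real
    have "((\<lambda>s. Complex s (pi / 2)) has_vector_derivative 1) (at r)"
      unfolding has_vector_derivative_def Complex_eq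
      by (auto intro!: derivative_eq_intros simp: fun_eq_iff scaleR_conv_of_real)
    from field_vector_diff_chain_at[OF this G]
    show "((G \<circ> (\<lambda>s. Complex s (pi / 2))) has_vector_derivative f (Complex r (pi / 2))) (at r within {-c..c})"
      by (simp add: has_vector_derivative_at_within)
  qed (use c0 in simp)
  then have "integral {-c..c} (hankel_integrand \<kappa> t) = G (Complex c (pi / 2)) - G (Complex (- c) (pi / 2))"
    unfolding hf by (simp add: integral_unique)
  also have "Complex c (pi / 2) = of_real pi * ray_right" by (simp add: ray_right_def complex_eq_iff c_def)
  also have "Complex (- c) (pi / 2) = of_real pi * ray_left" by (simp add: ray_left_def complex_eq_iff c_def)
  finally show ?thesis unfolding ray by simp
qed

text \<open>Beyond the ends of the rays \<open>cosh s - pi / 2\<close> is at least 1, so raising the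
  parameter from 1 to \<open>t\<close> multiplies the integrand by at most
  \<open>exp (1 - t)\<close>; a single integral at parameter 1 controls all tails.\<close>

lemma hankel_tail_bound:
  assumes t: "t \<ge> 1"
  shows "norm (integral\<^sup>L lborel (hankel_integrand \<kappa> t) - integral {- (pi * sqrt 3 / 2)..pi * sqrt 3 / 2} (hankel_integrand \<kappa> t))
    \<le> exp (1 - t) * (LINT s|lborel. norm (hankel_integrand \<kappa> 1 s))"
proof -
  define c where "c = pi * sqrt 3 / 2"
  have i: "integrable lborel (hankel_integrand \<kappa> t)" and i1: "integrable lborel (hankel_integrand \<kappa> 1)"
    using t by (auto intro!: hankel_integrand_integrable)
  have S: "set_integrable lborel {-c..c} (hankel_integrand \<kappa> t)"
    unfolding set_integrable_def by (intro integrable_mult_indicator i) simp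
  have "integral {-c..c} (hankel_integrand \<kappa> t) = (LINT s|lborel. indicator {-c..c} s *\<^sub>R hankel_integrand \<kappa> t s)"
    using set_borel_integral_eq_integral(2)[OF S] by (simp add: set_lebesgue_integral_def)
  then have "integral\<^sup>L lborel (hankel_integrand \<kappa> t) - integral {-c..c} (hankel_integrand \<kappa> t)
     = (LINT s|lborel. hankel_integrand \<kappa> t s - indicator {-c..c} s *\<^sub>R hankel_integrand \<kappa> t s)"
    using S i unfolding set_integrable_def by (simp add: Bochner_Integration.integral_diff)
  also have "norm \<dots> \<le> (LINT s|lborel. norm (hankel_integrand \<kappa> t s - indicator {-c..c} s *\<^sub>R hankel_integrand \<kappa> t s))"
    by (rule integral_norm_bound)
  also have "\<dots> \<le> (LINT s|lborel. exp (1 - t) * norm (hankel_integrand \<kappa> 1 s))"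
  proof (rule integral_mono)
    show "integrable lborel (\<lambda>s. norm (hankel_integrand \<kappa> t s - indicator {-c..c} s *\<^sub>R hankel_integrand \<kappa> t s))"
      using S i unfolding set_integrable_def by (intro integrable_norm Bochner_Integration.integrable_diff)
    show "integrable lborel (\<lambda>s. exp (1 - t) * norm (hankel_integrand \<kappa> 1 s))"
      by (intro integrable_mult_right integrable_norm i1)
    fix s :: real
    show "norm (hankel_integrand \<kappa> t s - indicator {-c..c} s *\<^sub>R hankel_integrand \<kappa> t s) \<le> exp (1 - t) * norm (hankel_integrand \<kappa> 1 s)"
    proof (cases "s \<in> {-c..c}")
      case False
      then have "c \<le> \<bar>s\<bar>" by auto
      moreover have "5 / 2 \<le> c"
      proof -
        have "1.7 \<le> sqrt 3" by (rule real_le_rsqrt) (simp add: power2_eq_square)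
        then have "3 * 1.7 \<le> pi * sqrt 3" using pi_gt3 by (intro mult_mono) auto
        then show ?thesis by (simp add: c_def)
      qed
      ultimately have "2.5\<^sup>2 \<le> \<bar>s\<bar>\<^sup>2" by (intro power_mono) auto
      then have "25 / 4 \<le> s\<^sup>2" by (simp add: power2_eq_square)
      \<comment> \<open>From \<open>c \<ge> 5 / 2\<close> the quadratic lower bound of
        \<open>cosh\<close> gives 1 + 25 / 8 > 4, while \<pi> / 2 < 2.\<close>
      then have "cosh s \<ge> 4" using one_plus_half_square_le_cosh[of s] by linarith
      then have c1: "cosh s - pi / 2 \<ge> 1" using pi_less_4 by linarith
      have "(t - 1) * 1 \<le> (t - 1) * (cosh s - pi / 2)" using t c1 by (intro mult_left_mono) auto
      moreover have "(t - 1) * X = t * X - X" for X by (simp add: left_diff_distrib)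
      ultimately have "- (t * (cosh s - pi / 2)) \<le> (1 - t) + - (1 * (cosh s - pi / 2))" by simp
      then have "exp (- (t * (cosh s - pi / 2))) \<le> exp (1 - t) * exp (- (1 * (cosh s - pi / 2)))"
        unfolding exp_add[symmetric] exp_le_cancel_iff .
      then have "norm (hankel_integrand \<kappa> t s) \<le> exp (1 - t) * norm (hankel_integrand \<kappa> 1 s)"
        unfolding norm_hankel_integrand mult.assoc[symmetric] by (rule mult_right_mono) simp
      then show ?thesis using False by simp
    qed simp
  qed
  finally show ?thesis by (simp add: c_def)
qed

lemma hankel_integral_asymptotics:
  "\<exists>C. \<forall>t\<ge>1. norm (of_real pi * \<i> * hankel_integral \<kappa> t
      - (\<Sum>m<M. B m \<kappa> * (of_real (Gamma (real (m + 1) / 3) / 3 * (6 / t) powr (real (m + 1) / 3)) * (ray_right ^ (m + 1) - ray_left ^ (m + 1)))))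
     \<le> C * t powr (- (real (M + 1) / 3))"
proof -
  define \<alpha> where "\<alpha> = real (M + 1) / 3"
  have \<alpha>: "\<alpha> > 0" by (simp add: \<alpha>_def)
  define f where "f = (\<lambda>t u. exp (\<i> * complex_of_real t * (sinh u - u) + \<kappa> * u))"
  define J where "J = (\<lambda>e t. integral {0..1} (\<lambda>r. f t (of_real (r * pi) * e) * (of_real pi * e)))"
  define S where "S = (\<lambda>e t. \<Sum>m<M. B m \<kappa> * (of_real (Gamma (real (m + 1) / 3) / 3 * (6 / t) powr (real (m + 1) / 3)) * e ^ (m + 1)))"
  obtain C1 where C1: "\<And>t. t \<ge> 1 \<Longrightarrow> norm (J ray_right t - S ray_right t) \<le> C1 * t powr (- \<alpha>)"
    using ray_asymptotics[OF ray_directions(1), of \<kappa> M] unfolding \<alpha>_def J_def S_def f_def by blast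
  obtain C2 where C2: "\<And>t. t \<ge> 1 \<Longrightarrow> norm (J ray_left t - S ray_left t) \<le> C2 * t powr (- \<alpha>)"
    using ray_asymptotics[OF ray_directions(2), of \<kappa> M] unfolding \<alpha>_def J_def S_def f_def by blast
  define C3 where "C3 = exp 1 * \<alpha> powr \<alpha> * (LINT s|lborel. norm (hankel_integrand \<kappa> 1 s))"
  have "norm (of_real pi * \<i> * hankel_integral \<kappa> t - (S ray_right t - S ray_left t)) \<le> (C1 + C2 + C3) * t powr (- \<alpha>)" if t: "t \<ge> 1" for t
  proof -
    define H where "H = integral\<^sup>L lborel (hankel_integrand \<kappa> t)"
    have mid: "integral {- (pi * sqrt 3 / 2)..pi * sqrt 3 / 2} (hankel_integrand \<kappa> t) = J ray_right t - J ray_left t"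
      unfolding J_def f_def by (rule hankel_integrand_triangle)
    have "exp (1 - t) = exp 1 * exp (- t)" by (simp add: exp_add[symmetric])
    also have "\<dots> \<le> exp 1 * (\<alpha> powr \<alpha> * t powr (- \<alpha>))" using t by (intro mult_left_mono exp_minus_le_powr \<alpha>) auto
    finally have "exp (1 - t) * (LINT s|lborel. norm (hankel_integrand \<kappa> 1 s)) \<le> exp 1 * (\<alpha> powr \<alpha> * t powr (- \<alpha>)) * (LINT s|lborel. norm (hankel_integrand \<kappa> 1 s))"
      by (intro mult_right_mono integral_nonneg_AE AE_I2) auto
    then have h3: "norm (H - (J ray_right t - J ray_left t)) \<le> C3 * t powr (- \<alpha>)"
      using hankel_tail_bound[OF t, of \<kappa>] unfolding mid H_def C3_def by (simp add: mult_ac)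
    have "of_real pi * \<i> * hankel_integral \<kappa> t = H" unfolding hankel_integral_def H_def by simp
    then have "of_real pi * \<i> * hankel_integral \<kappa> t - (S ray_right t - S ray_left t)
       = (H - (J ray_right t - J ray_left t)) + ((J ray_right t - S ray_right t) - (J ray_left t - S ray_left t))" by simp
    also have "norm \<dots> \<le> C3 * t powr (- \<alpha>) + (C1 * t powr (- \<alpha>) + C2 * t powr (- \<alpha>))"
      by (intro norm_triangle_mono h3 order_trans[OF norm_triangle_ineq4] add_mono C1 C2 t)
    finally show ?thesis by (simp add: algebra_simps)
  qed
  moreover have "S ray_right t - S ray_left t = (\<Sum>m<M. B m \<kappa> * (of_real (Gamma (real (m + 1) / 3) / 3 * (6 / t) powr (real (m + 1) / 3)) * (ray_right ^ (m + 1) - ray_left ^ (m + 1))))" for t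
    by (simp only: S_def sum_subtractf[symmetric] right_diff_distrib)
  ultimately show ?thesis unfolding \<alpha>_def by (simp only:) blast
qed


text \<open>The rays are \<open>\<i>\<close> rotated by \<minusplus> \<pi> / 3; their difference is
  the origin of the sine factors in the expansion.\<close>

lemma ray_power_diff:
  "ray_right ^ p - ray_left ^ p = - 2 * \<i> * of_real (sin (real p * pi / 3)) * \<i> ^ p"
proof -
  have e: "ray_right = \<i> * cis (- (pi / 3))" "ray_left = \<i> * cis (pi / 3)"
    by (simp_all add: ray_right_def ray_left_def complex_eq_iff cos_60 sin_60)
  have "ray_right ^ p - ray_left ^ p = \<i> ^ p * (cis (real p * (- (pi / 3))) - cis (real p * (pi / 3)))"
    unfolding e by (simp only: power_mult_distrib Complex.DeMoivre right_diff_distrib)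
  also have "cis (real p * (- (pi / 3))) - cis (real p * (pi / 3)) = - 2 * \<i> * of_real (sin (real p * pi / 3))"
    by (simp add: complex_eq_iff)
  finally show ?thesis by simp
qed

text \<open>A summand of \<open>R_H\<close> at \<open>z = \<i> * t\<close>. The phase of the summand
  has angle 2 (m + 1) \<pi> / 3, the power of \<open>\<i>\<close> in the denominator removes (m + 1)
  \<pi> / 6, and (m + 1) \<pi> / 2 is left, which is \<open>\<i> ^ (m + 1)\<close>.\<close>

definition hankel_term :: "complex \<Rightarrow> nat \<Rightarrow> real \<Rightarrow> complex" where
  "hankel_term \<kappa> m t = of_real (2 / (3 * pi) * 6 powr (real (m + 1) / 3) * sin (real (m + 1) * pi / 3)
     * Gamma (real (m + 1) / 3) * t powr (- (real (m + 1) / 3))) * B m \<kappa> * \<i> ^ (m + 1)"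

definition hankel_remainder :: "nat \<Rightarrow> complex \<Rightarrow> real \<Rightarrow> complex" where
  "hankel_remainder M \<kappa> t = hankel_integral \<kappa> t + (\<Sum>m<M. hankel_term \<kappa> m t)"

lemma exp_quarter_turns: "exp (of_real (pi / 2 * real n) * \<i>) = \<i> ^ n"
  and exp_minus_quarter_turns: "exp (- of_real (pi / 2 * real n) * \<i>) = (- \<i>) ^ n"
proof -
  have "\<i> ^ n = cis (pi / 2) ^ n" by simp
  also have "\<dots> = cis (real n * (pi / 2))" by (rule Complex.DeMoivre)
  also have "\<dots> = exp (of_real (pi / 2 * real n) * \<i>)" by (simp only: cis_conv_exp mult.commute)
  finally show 1: "exp (of_real (pi / 2 * real n) * \<i>) = \<i> ^ n" by simp
  have "exp (- of_real (pi / 2 * real n) * \<i>) = inverse (\<i> ^ n)"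
    unfolding 1[symmetric] exp_minus[symmetric] by simp
  also have "\<dots> = (- \<i>) ^ n" by (simp only: power_inverse[symmetric] inverse_i)
  finally show "exp (- of_real (pi / 2 * real n) * \<i>) = (- \<i>) ^ n" .
qed

lemma R_H_imaginary:
  assumes t: "t > 0" and \<kappa>: "\<i> * of_real t - \<kappa> \<notin> \<int>"
  shows "R_H M (\<i> * of_real t) \<kappa> = hankel_remainder M \<kappa> t"
proof -
  have term_eq: "of_real (2 / (3 * pi)) * (of_real (6 powr (real (m + 1) / 3)) * B m \<kappa>
        * exp (of_real (2 * real (m + 1) * pi / 3) * \<i>)
        * of_real (sin (real (m + 1) * pi / 3))
        * (of_real (Gamma (real (m + 1) / 3)) / (\<i> * of_real t) powr (of_nat (m + 1) / 3))) = hankel_term \<kappa> m t" for m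
  proof -
    define a where "a = real (m + 1) / 3"
    have "(\<i> * of_real t) powr (of_nat (m + 1) / 3) = (of_real t * \<i>) powr (of_real a)"
      by (simp add: a_def mult.commute)
    also have "\<dots> = of_real t powr of_real a * \<i> powr of_real a"
      using t by (intro powr_times_real_left) auto
    also have "of_real t powr of_real a = complex_of_real (t powr a)"
      using t powr_of_real[of t a] by simp
    also have "\<i> powr of_real a = exp (of_real (a * pi / 2) * \<i>)"
      by (simp add: powr_def mult_ac)
    finally have p: "(\<i> * of_real t) powr (of_nat (m + 1) / 3) = of_real (t powr a) * exp (of_real (a * pi / 2) * \<i>)" .
    have "exp (of_real (2 * real (m + 1) * pi / 3) * \<i>) = exp (of_real (a * pi / 2) * \<i>) * exp (of_real (real (m + 1) * (pi / 2)) * \<i>)"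
      unfolding exp_add[symmetric] by (rule arg_cong[where f = exp]) (simp add: a_def field_simps)
    also have "exp (of_real (real (m + 1) * (pi / 2)) * \<i>) = \<i> ^ (m + 1)"
      using exp_quarter_turns[of "m + 1"] by (simp only: mult.commute)
    finally have e: "exp (of_real (2 * real (m + 1) * pi / 3) * \<i>) = exp (of_real (a * pi / 2) * \<i>) * \<i> ^ (m + 1)" .
    have cancel: "c * (s * b * (x * i) * s' * (g / (p * x))) = (c * s * s' * g * inverse p) * b * i" if "x \<noteq> 0" for c s b x i s' g p :: complex
      using that by (simp add: field_simps)
    have "hankel_term \<kappa> m t = (of_real (2 / (3 * pi)) * of_real (6 powr a) * of_real (sin (real (m + 1) * pi / 3)) * of_real (Gamma a) * inverse (of_real (t powr a))) * B m \<kappa> * \<i> ^ (m + 1)"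
      unfolding hankel_term_def a_def[symmetric] powr_minus by (simp only: of_real_mult of_real_inverse)
    then show ?thesis unfolding p e a_def[symmetric] by (subst cancel) simp_all
  qed
  have "R_H M (\<i> * of_real t) \<kappa> = hankel_integral \<kappa> t + (\<Sum>m<M. hankel_term \<kappa> m t)"
    unfolding R_H_def hankel1_imaginary[OF t \<kappa>] sum_distrib_left term_eq ..
  then show ?thesis by (simp add: hankel_remainder_def)
qed

text \<open>For \<open>t \<ge> 1\<close> this is the ray expansion. For \<open>t \<le> 1\<close> no
  cancellation is used: the integral and each subtracted term are separately of the required order,
  the former by the condition on \<kappa>, the latter since their exponents do not exceed
  \<alpha>.\<close>

lemma hankel_remainder_bound:
  assumes \<kappa>: "\<bar>Re \<kappa>\<bar> < (real M + 1) / 3"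
  shows "\<exists>C\<ge>0. \<forall>t>0. norm (hankel_remainder M \<kappa> t) \<le> C * t powr (- (real (M + 1) / 3))"
proof -
  define \<alpha> where "\<alpha> = real (M + 1) / 3"
  obtain C1 where C1: "\<And>t. t \<ge> 1 \<Longrightarrow> norm (of_real pi * \<i> * hankel_integral \<kappa> t
      - (\<Sum>m<M. B m \<kappa> * (of_real (Gamma (real (m + 1) / 3) / 3 * (6 / t) powr (real (m + 1) / 3)) * (ray_right ^ (m + 1) - ray_left ^ (m + 1)))))
     \<le> C1 * t powr (- \<alpha>)"
    using hankel_integral_asymptotics[of \<kappa> M] unfolding \<alpha>_def by blast
  have large: "norm (hankel_remainder M \<kappa> t) \<le> (C1 / pi) * t powr (- \<alpha>)" if t: "t \<ge> 1" for t
  proof -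
    have "B m \<kappa> * (of_real (Gamma (real (m + 1) / 3) / 3 * (6 / t) powr (real (m + 1) / 3)) * (ray_right ^ (m + 1) - ray_left ^ (m + 1)))
       = - (of_real pi * \<i> * hankel_term \<kappa> m t)" for m
    proof -
      define a where "a = real (m + 1) / 3"
      have q: "(6 / t) powr a = 6 powr a * t powr (- a)" by (simp add: powr_divide powr_minus field_simps)
      have r: "of_real (2 / (3 * pi) * s6 * sn * g * tt) = complex_of_real (2 / 3) * of_real (1 / pi) * of_real (g * (s6 * tt)) * of_real sn" for s6 sn g tt
        unfolding of_real_mult[symmetric] by simp
      have "B m \<kappa> * (of_real (Gamma a / 3 * (6 / t) powr a) * (ray_right ^ (m + 1) - ray_left ^ (m + 1)))
        = - (2 / 3) * \<i> * of_real (Gamma a * (6 powr a * t powr (- a))) * of_real (sin (real (m + 1) * pi / 3)) * B m \<kappa> * \<i> ^ (m + 1)"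
        unfolding ray_power_diff q by simp
      moreover have "of_real pi * \<i> * hankel_term \<kappa> m t = (2 / 3) * \<i> * of_real (Gamma a * (6 powr a * t powr (- a))) * of_real (sin (real (m + 1) * pi / 3)) * B m \<kappa> * \<i> ^ (m + 1)"
        unfolding hankel_term_def a_def[symmetric] r by simp
      ultimately show ?thesis unfolding a_def[symmetric] by (simp only: mult_minus_left)
    qed
    then have "of_real pi * \<i> * hankel_integral \<kappa> t
      - (\<Sum>m<M. B m \<kappa> * (of_real (Gamma (real (m + 1) / 3) / 3 * (6 / t) powr (real (m + 1) / 3)) * (ray_right ^ (m + 1) - ray_left ^ (m + 1))))
      = of_real pi * \<i> * hankel_remainder M \<kappa> t"
      by (simp only: hankel_remainder_def sum_negf sum_distrib_left[symmetric] diff_minus_eq_add distrib_left)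
    then have "norm (of_real pi * \<i> * hankel_remainder M \<kappa> t) \<le> C1 * t powr (- \<alpha>)" using C1[OF t] by simp
    then have "pi * norm (hankel_remainder M \<kappa> t) \<le> C1 * t powr (- \<alpha>)" by (simp add: norm_mult)
    then show ?thesis by (simp add: field_simps)
  qed
  have k: "\<bar>Re \<kappa>\<bar> < \<alpha>" using \<kappa> by (simp add: \<alpha>_def add.commute)
  obtain C2 where C2: "C2 \<ge> 0" "\<And>t. t > 0 \<Longrightarrow> (LINT s|lborel. norm (hankel_integrand \<kappa> t s)) \<le> C2 * exp (t * (pi / 2)) * t powr (- \<alpha>)"
    using hankel_integrand_bound[OF k] by blast
  define c where "c = (\<lambda>m. norm (hankel_term \<kappa> m 1))"
  have small: "norm (hankel_remainder M \<kappa> t) \<le> (1 / pi * (C2 * exp (pi / 2)) + (\<Sum>m<M. c m)) * t powr (- \<alpha>)" if t: "0 < t" "t \<le> 1" for t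
  proof -
    have "norm (hankel_integral \<kappa> t) \<le> 1 / pi * (LINT s|lborel. norm (hankel_integrand \<kappa> t s))"
      unfolding hankel_integral_def norm_mult by (intro mult_mono integral_norm_bound) (auto simp: norm_divide norm_mult)
    also have "\<dots> \<le> 1 / pi * (C2 * exp (t * (pi / 2)) * t powr (- \<alpha>))"
      using C2(2)[OF t(1)] by (intro mult_left_mono) auto
    also have "\<dots> \<le> 1 / pi * (C2 * exp (pi / 2) * t powr (- \<alpha>))"
      using t C2(1) by (intro mult_left_mono mult_right_mono) (auto simp: mult_le_cancel_right1)
    finally have 1: "norm (hankel_integral \<kappa> t) \<le> 1 / pi * (C2 * exp (pi / 2)) * t powr (- \<alpha>)" by (simp add: mult_ac)
    have 2: "norm (hankel_term \<kappa> m t) \<le> c m * t powr (- \<alpha>)" if m: "m < M" for m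
    proof -
      have h: "hankel_term \<kappa> m t = of_real (t powr (- (real (m + 1) / 3))) * hankel_term \<kappa> m 1"
        unfolding hankel_term_def of_real_mult by simp
      have "t powr (- (real (m + 1) / 3)) \<le> t powr (- \<alpha>)"
        using t m by (intro powr_mono') (auto simp: \<alpha>_def)
      then have "t powr (- (real (m + 1) / 3)) * c m \<le> t powr (- \<alpha>) * c m" by (rule mult_right_mono) (simp add: c_def)
      then show ?thesis unfolding h norm_mult c_def by (simp add: mult.commute)
    qed
    have "norm (hankel_remainder M \<kappa> t) \<le> 1 / pi * (C2 * exp (pi / 2)) * t powr (- \<alpha>) + (\<Sum>m<M. c m * t powr (- \<alpha>))"
      unfolding hankel_remainder_def using 1 2 by (intro norm_triangle_mono order_trans[OF norm_sum] sum_mono) auto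
    then show ?thesis by (simp add: distrib_right sum_distrib_right)
  qed
  define C where "C = max (C1 / pi) (max 0 (1 / pi * (C2 * exp (pi / 2)) + (\<Sum>m<M. c m)))"
  have "norm (hankel_remainder M \<kappa> t) \<le> C * t powr (- \<alpha>)" if t: "t > 0" for t
  proof (cases "t \<ge> 1")
    case True
    have "C1 / pi * t powr (- \<alpha>) \<le> C * t powr (- \<alpha>)" by (intro mult_right_mono) (auto simp: C_def)
    then show ?thesis using large[OF True] by linarith
  next
    case False
    have "(1 / pi * (C2 * exp (pi / 2)) + (\<Sum>m<M. c m)) * t powr (- \<alpha>) \<le> C * t powr (- \<alpha>)" by (intro mult_right_mono) (auto simp: C_def)
    then show ?thesis using small[OF t] False by linarith
  qed
  moreover have "C \<ge> 0" by (simp add: C_def)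
  ultimately show ?thesis unfolding \<alpha>_def by blast
qed

text \<open>The logarithm of Gamma is convex and vanishes at 1 and 2, so it is nonnegative and
  nondecreasing from 2 on.\<close>

lemma Gamma_real_mono_ge_2:
  fixes x y :: real
  assumes "2 \<le> x" "x \<le> y"
  shows "Gamma x \<le> Gamma y"
proof -
  define f where "f = (ln \<circ> Gamma :: real \<Rightarrow> real)"
  have conv: "f (u * a + v * b) \<le> u * f a + v * f b" if "a > 0" "b > 0" "u \<ge> 0" "v \<ge> 0" "u + v = 1" for a b u v
    using log_convex_Gamma_real that unfolding convex_on_def f_def by auto
  have f12: "f 1 = 0" "f 2 = 0" 
    using Gamma_fact[of 1, where 'a = real] by (simp_all add: f_def)
  have nonneg: "f y \<ge> 0" if "y \<ge> 2" for y
  proof -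
    \<comment> \<open>Writes 2 as a convex combination of 1 and \<open>y\<close>; as
      \<open>f\<close> vanishes at 1 and 2, convexity forces \<open>f y\<close> to be
      nonnegative.\<close>
    have "(y - 2) / (y - 1) * 1 + 1 / (y - 1) * y = (2 * (y - 1)) / (y - 1)"
      by (simp add: add_divide_distrib[symmetric])
    then have "(y - 2) / (y - 1) * 1 + 1 / (y - 1) * y = 2"
      using nonzero_mult_div_cancel_right[of "y - 1" 2] that by simp
    moreover have "(y - 2) / (y - 1) + 1 / (y - 1) = 1" using that by (simp add: field_simps)
    ultimately have "f 2 \<le> (y - 2) / (y - 1) * f 1 + 1 / (y - 1) * f y"
      using conv[of 1 y "(y - 2) / (y - 1)" "1 / (y - 1)"] that by simp
    then have "0 \<le> 1 / (y - 1) * f y" by (simp add: f12)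
    then show ?thesis using that by (simp add: zero_le_divide_iff)
  qed
  have "f x \<le> f y"
  proof (cases "y = 2")
    case True then show ?thesis using assms by simp
  next
    case False
    then have y: "y > 2" using assms by simp
    define v where "v = (x - 2) / (y - 2)"
    have v: "0 \<le> v" "v \<le> 1" using assms y by (auto simp: v_def)
    have "v * (y - 2) = x - 2" using y by (simp add: v_def)
    then have "(1 - v) * 2 + v * y = x" by (simp add: algebra_simps)
    then have "f x \<le> (1 - v) * f 2 + v * f y" using conv[of 2 y "1 - v" v] y v by simp
    also have "\<dots> \<le> 1 * f y" using v nonneg[of y] y by (simp add: f12 mult_left_le_one_le)
    finally show ?thesis by simp
  qed
  then show ?thesis using assms unfolding f_def by (simp add: Gamma_real_pos)
qed

section \<open>The expansion in inverse factorials\<close>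


text \<open>The exponents add up to (n - m) / 3 - 1, positivity of (n - m) / 3 being
  \<open>m < n\<close>; this Gamma value is the numerator of \<open>Gamma_ratio n m\<close>.\<close>

lemma hankel_term_mellin:
  assumes "m < n"
  shows "has_bochner_integral lborel
    (\<lambda>t. indicator {0<..} t *\<^sub>R (of_real (t powr ((real n - 2) / 3) * exp (- 2 * pi * t)) * hankel_term \<kappa> m t))
    (of_real (2 / (3 * pi) * 6 powr (real (m + 1) / 3) * sin (real (m + 1) * pi / 3)
     * Gamma (real (m + 1) / 3) * (Gamma ((real n - real m) / 3) * (2 * pi) powr (- ((real n - real m) / 3)))) * B m \<kappa> * \<i> ^ (m + 1))"
proof -
  define c where "c = of_real (2 / (3 * pi) * 6 powr (real (m + 1) / 3) * sin (real (m + 1) * pi / 3)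
     * Gamma (real (m + 1) / 3)) * B m \<kappa> * \<i> ^ (m + 1)"
  define b where "b = (real n - real m) / 3"
  have b: "b > 0" using assms by (simp add: b_def)
  have "has_bochner_integral lborel
     (\<lambda>t. c * (indicator {0<..} t *\<^sub>R (of_real t powr (of_real b - 1) * exp (- of_real (2 * pi * t)))))
     (c * (Gamma (of_real b) * of_real (2 * pi) powr (- of_real b)))"
    by (intro has_bochner_integral_mult_right gamma_integral_scaled_pos) (use b in auto)
  also have "(\<lambda>t. c * (indicator {0<..} t *\<^sub>R (of_real t powr (of_real b - 1) * exp (- of_real (2 * pi * t)))))
     = (\<lambda>t. indicator {0<..} t *\<^sub>R (of_real (t powr ((real n - 2) / 3) * exp (- 2 * pi * t)) * hankel_term \<kappa> m t))"
  proof
    fix t :: real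
    show "c * (indicator {0<..} t *\<^sub>R (of_real t powr (of_real b - 1) * exp (- of_real (2 * pi * t))))
     = indicator {0<..} t *\<^sub>R (of_real (t powr ((real n - 2) / 3) * exp (- 2 * pi * t)) * hankel_term \<kappa> m t)"
    proof (cases "t > 0")
      case True
      have 1: "of_real t powr (of_real b - 1) = complex_of_real (t powr (b - 1))"
        using True powr_of_real[of t "b - 1"] by simp
      have 2: "exp (- of_real (2 * pi * t)) = complex_of_real (exp (- 2 * pi * t))"
        unfolding exp_of_real[symmetric] by simp
      have "b - 1 = (real n - 2) / 3 + - (real (m + 1) / 3)" by (simp add: b_def field_simps)
      then have 3: "t powr (b - 1) = t powr ((real n - 2) / 3) * t powr (- (real (m + 1) / 3))"
        by (simp only: powr_add)
      show ?thesis unfolding 1 2 3 c_def hankel_term_def by (simp only: of_real_mult mult_ac scaleR_conv_of_real)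
    qed simp
  qed
  also have "c * (Gamma (of_real b) * of_real (2 * pi) powr (- of_real b)) = of_real (2 / (3 * pi) * 6 powr (real (m + 1) / 3) * sin (real (m + 1) * pi / 3)
     * Gamma (real (m + 1) / 3) * (Gamma b * (2 * pi) powr (- b))) * B m \<kappa> * \<i> ^ (m + 1)"
  proof -
    have "of_real (2 * pi) powr (- complex_of_real b) = of_real ((2 * pi) powr (- b))"
      using powr_of_real[of "2 * pi" "- b"] by simp
    then show ?thesis unfolding c_def Gamma_complex_of_real by (simp only: of_real_mult mult_ac)
  qed
  finally show ?thesis unfolding b_def .
qed

definition phase_plus :: "nat \<Rightarrow> complex \<Rightarrow> complex" where
  "phase_plus n \<kappa> = exp ((of_real (2 * pi) * \<kappa> - of_real (pi / 2 * real n)) * \<i>)"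

definition phase_minus :: "nat \<Rightarrow> complex \<Rightarrow> complex" where
  "phase_minus n \<kappa> = exp (- (of_real (2 * pi) * \<kappa> - of_real (pi / 2 * real n)) * \<i>)"

lemma phase_plus_eq: "phase_plus n \<kappa> = exp (2 * of_real pi * \<i> * \<kappa>) * (- \<i>) ^ n"
  unfolding phase_plus_def exp_minus_quarter_turns[symmetric] exp_add[symmetric]
  by (rule arg_cong[where f = exp]) (simp add: algebra_simps)

lemma phase_minus_eq: "phase_minus n \<kappa> = exp (- (2 * of_real pi * \<i> * \<kappa>)) * \<i> ^ n"
  unfolding phase_minus_def exp_quarter_turns[symmetric] exp_add[symmetric]
  by (rule arg_cong[where f = exp]) (simp add: algebra_simps)

text \<open>The sign \<open>(- 1) ^ m\<close> is the one from \<open>B_minus\<close>, and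
  \<open>\<i> ^ m\<close> shifts both phases so that n + m appears. The minus sign on the right is
  what turns the subtracted terms of the remainder into the terms of the final formula.\<close>

lemma phase_cos:
  "\<i> * (phase_plus n \<kappa> * (- 1) ^ m + phase_minus n \<kappa>) * \<i> ^ (m + 1)
    = - 2 * cos (of_real (2 * pi) * \<kappa> - of_real (pi / 2 * (real n + real m)))"
proof -
  define w where "w = of_real (2 * pi) * \<kappa> - of_real (pi / 2 * (real n + real m))"
  have 1: "exp (\<i> * w) = phase_plus n \<kappa> * (- \<i>) ^ m"
    unfolding phase_plus_def exp_minus_quarter_turns[symmetric] exp_add[symmetric] w_def
    by (rule arg_cong[where f = exp]) (simp add: algebra_simps)
  have 2: "exp (- (\<i> * w)) = phase_minus n \<kappa> * \<i> ^ m"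
    unfolding phase_minus_def exp_quarter_turns[symmetric] exp_add[symmetric] w_def
    by (rule arg_cong[where f = exp]) (simp add: algebra_simps)
  have m1: "(- \<i>) ^ m = (- 1) ^ m * \<i> ^ m" unfolding power_mult_distrib[symmetric] by simp
  have "2 * cos w = exp (\<i> * w) + exp (- (\<i> * w))" by (simp add: cos_exp_eq)
  also have "\<dots> = (phase_plus n \<kappa> * (- 1) ^ m + phase_minus n \<kappa>) * \<i> ^ m"
    unfolding 1 2 m1 by (simp add: distrib_right mult.assoc)
  finally have c: "2 * cos w = (phase_plus n \<kappa> * (- 1) ^ m + phase_minus n \<kappa>) * \<i> ^ m" .
  have "\<i> * X * \<i> ^ (m + 1) = - (X * \<i> ^ m)" for X
  proof -
    have "\<i> * X * \<i> ^ (m + 1) = (\<i> * \<i>) * (X * \<i> ^ m)"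
      by (simp only: power_add power_one_right mult_ac)
    then show ?thesis by simp
  qed
  then show ?thesis unfolding w_def[symmetric] mult_minus_left c by simp
qed

text \<open>The orders \<open>\<i> * t - \<kappa>\<close> and \<open>\<i> * t + \<kappa>\<close>
  have imaginary parts \<open>t - Im \<kappa>\<close> and \<open>t + Im \<kappa>\<close>, so an
  integer order, where \<open>bessel_Y\<close> is a limit, can occur only at the two excluded
  points.\<close>

lemma A_integrand_eq:
  assumes "t \<noteq> Im \<kappa>" "t \<noteq> - Im \<kappa>"
  shows "indicator {0<..} t *\<^sub>R A_integrand M n \<kappa> t = \<i> *
     (phase_plus n \<kappa> * (indicator {0<..} t *\<^sub>R (of_real (t powr ((real n - 2) / 3) * exp (- 2 * pi * t)) * hankel_remainder M (- \<kappa>) t))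
      + phase_minus n \<kappa> * (indicator {0<..} t *\<^sub>R (of_real (t powr ((real n - 2) / 3) * exp (- 2 * pi * t)) * hankel_remainder M \<kappa> t)))"
proof (cases "t > 0")
  case True
  have "\<i> * of_real t - \<kappa> \<notin> \<int>" "\<i> * of_real t - (- \<kappa>) \<notin> \<int>"
    using assms by (auto simp: complex_is_Int_iff)
  then have R: "R_H M (\<i> * of_real t) \<kappa> = hankel_remainder M \<kappa> t" "R_H M (\<i> * of_real t) (- \<kappa>) = hankel_remainder M (- \<kappa>) t"
    using R_H_imaginary[OF True] by blast+
  show ?thesis using True unfolding A_integrand_def R phase_plus_def[symmetric] phase_minus_def[symmetric]
    by (simp add: distrib_left mult_ac)
qed simp

text \<open>Measurability of \<open>f\<close> is a conclusion: \<open>f\<close> is the measurable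
  \<open>g\<close> with two values changed. This covers \<open>A_integrand\<close>, whose values at
  integer orders are given by \<open>Lim\<close> and stay unevaluated.\<close>

lemma has_bochner_integral_eq_except_two:
  fixes f g :: "real \<Rightarrow> complex"
  assumes g: "has_bochner_integral lborel g x" and eq: "\<And>t. t \<noteq> a \<Longrightarrow> t \<noteq> b \<Longrightarrow> f t = g t"
  shows "has_bochner_integral lborel f x"
proof -
  have mg: "g \<in> borel_measurable lborel"
    using g borel_measurable_integrable unfolding has_bochner_integral_iff by blast
  have "f = (\<lambda>t. if t = a then f a else if t = b then f b else g t)" using eq by auto
  moreover have "(\<lambda>t. if t = a then f a else if t = b then f b else g t) \<in> borel_measurable lborel"
    using mg by measurable
  ultimately have mf: "f \<in> borel_measurable lborel" by simp
  have "AE t in lborel. t \<noteq> a" "AE t in lborel. t \<noteq> b" by (rule AE_lborel_singleton)+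
  then have "AE t in lborel. f t = g t" by eventually_elim (rule eq)
  then show ?thesis using has_bochner_integral_cong_AE[OF mf mg] g by blast
qed

section \<open>Assembling the exact formula\<close>

definition hankel_mellin :: "nat \<Rightarrow> complex \<Rightarrow> complex" where
  "hankel_mellin n \<kappa> = 1 / (of_real pi * \<i>) * of_real (Gamma (real (n + 1) / 3)) * exp (2 * of_real pi * \<i> * \<kappa>) * integral\<^sup>L lborel (line_integrand n (- \<kappa>))"

definition term_mellin :: "nat \<Rightarrow> nat \<Rightarrow> real" where
  "term_mellin n m = 2 / (3 * pi) * 6 powr (real (m + 1) / 3) * sin (real (m + 1) * pi / 3)
     * Gamma (real (m + 1) / 3) * (Gamma ((real n - real m) / 3) * (2 * pi) powr (- ((real n - real m) / 3)))"

lemma hankel_remainder_mellin: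
  assumes n: "M < n" and \<kappa>: "\<bar>Re \<kappa>\<bar> < (real M + 1) / 3"
  shows "has_bochner_integral lborel
    (\<lambda>t. indicator {0<..} t *\<^sub>R (of_real (t powr ((real n - 2) / 3) * exp (- 2 * pi * t)) * hankel_remainder M \<kappa> t))
    (hankel_mellin n \<kappa> + (\<Sum>m<M. of_real (term_mellin n m) * B m \<kappa> * \<i> ^ (m + 1)))"
proof -
  have k: "\<bar>Re \<kappa>\<bar> < (real n + 1) / 3" using n \<kappa> by simp
  have "has_bochner_integral lborel
    (\<lambda>t. indicator {0<..} t *\<^sub>R (of_real (t powr ((real n - 2) / 3) * exp (- 2 * pi * t)) * hankel_integral \<kappa> t)
      + (\<Sum>m<M. indicator {0<..} t *\<^sub>R (of_real (t powr ((real n - 2) / 3) * exp (- 2 * pi * t)) * hankel_term \<kappa> m t)))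
    (hankel_mellin n \<kappa> + (\<Sum>m<M. of_real (term_mellin n m) * B m \<kappa> * \<i> ^ (m + 1)))"
    unfolding hankel_mellin_def term_mellin_def
    by (intro has_bochner_integral_add has_bochner_integral_sum hankel_integral_mellin k hankel_term_mellin) (use n in auto)
  then show ?thesis
    by (simp add: hankel_remainder_def sum_distrib_left scaleR_sum_right distrib_left scaleR_add_right)
qed

lemma A_integrand_integral:
  assumes n: "M < n" and \<kappa>: "\<bar>Re \<kappa>\<bar> < (real M + 1) / 3"
  shows "has_bochner_integral lborel (\<lambda>t. indicator {0<..} t *\<^sub>R A_integrand M n \<kappa> t)
    (\<i> * (phase_plus n \<kappa> * hankel_mellin n (- \<kappa>) + phase_minus n \<kappa> * hankel_mellin n \<kappa>)
     - (\<Sum>m<M. of_real (2 * term_mellin n m) * B m \<kappa> * cos (of_real (2 * pi) * \<kappa> - of_real (pi / 2 * (real n + real m)))))"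
proof -
  define S where "S = (\<lambda>\<kappa>. \<Sum>m<M. of_real (term_mellin n m) * B m \<kappa> * \<i> ^ (m + 1))"
  have \<kappa>': "\<bar>Re (- \<kappa>)\<bar> < (real M + 1) / 3" using \<kappa> by simp
  have "has_bochner_integral lborel (\<lambda>t. \<i> *
     (phase_plus n \<kappa> * (indicator {0<..} t *\<^sub>R (of_real (t powr ((real n - 2) / 3) * exp (- 2 * pi * t)) * hankel_remainder M (- \<kappa>) t))
      + phase_minus n \<kappa> * (indicator {0<..} t *\<^sub>R (of_real (t powr ((real n - 2) / 3) * exp (- 2 * pi * t)) * hankel_remainder M \<kappa> t))))
    (\<i> * (phase_plus n \<kappa> * (hankel_mellin n (- \<kappa>) + S (- \<kappa>)) + phase_minus n \<kappa> * (hankel_mellin n \<kappa> + S \<kappa>)))"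
    unfolding S_def by (intro has_bochner_integral_add has_bochner_integral_mult_right hankel_remainder_mellin n \<kappa> \<kappa>')
  from has_bochner_integral_eq_except_two[OF this A_integrand_eq]
  have H: "has_bochner_integral lborel (\<lambda>t. indicator {0<..} t *\<^sub>R A_integrand M n \<kappa> t)
    (\<i> * (phase_plus n \<kappa> * (hankel_mellin n (- \<kappa>) + S (- \<kappa>)) + phase_minus n \<kappa> * (hankel_mellin n \<kappa> + S \<kappa>)))" .
  have t: "\<i> * (phase_plus n \<kappa> * (of_real (term_mellin n m) * B m (- \<kappa>) * \<i> ^ (m + 1)) + phase_minus n \<kappa> * (of_real (term_mellin n m) * B m \<kappa> * \<i> ^ (m + 1)))
     = - (of_real (2 * term_mellin n m) * B m \<kappa> * cos (of_real (2 * pi) * \<kappa> - of_real (pi / 2 * (real n + real m))))" for m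
  proof -
    have "\<i> * (phase_plus n \<kappa> * (of_real (term_mellin n m) * B m (- \<kappa>) * \<i> ^ (m + 1)) + phase_minus n \<kappa> * (of_real (term_mellin n m) * B m \<kappa> * \<i> ^ (m + 1)))
      = of_real (term_mellin n m) * B m \<kappa> * (\<i> * (phase_plus n \<kappa> * (- 1) ^ m + phase_minus n \<kappa>) * \<i> ^ (m + 1))"
      unfolding B_minus by (simp only: distrib_left distrib_right mult_ac)
    then show ?thesis unfolding phase_cos by simp
  qed
  have "\<i> * (phase_plus n \<kappa> * S (- \<kappa>) + phase_minus n \<kappa> * S \<kappa>) = - (\<Sum>m<M. of_real (2 * term_mellin n m) * B m \<kappa> * cos (of_real (2 * pi) * \<kappa> - of_real (pi / 2 * (real n + real m))))"
    unfolding S_def sum_distrib_left sum.distrib[symmetric] t sum_negf ..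
  moreover have "\<i> * (p * (x + u) + q * (y + v)) = \<i> * (p * x + q * y) + \<i> * (p * u + q * v)" for p q x y u v
    by (simp add: algebra_simps)
  ultimately have "\<i> * (phase_plus n \<kappa> * (hankel_mellin n (- \<kappa>) + S (- \<kappa>)) + phase_minus n \<kappa> * (hankel_mellin n \<kappa> + S \<kappa>))
    = \<i> * (phase_plus n \<kappa> * hankel_mellin n (- \<kappa>) + phase_minus n \<kappa> * hankel_mellin n \<kappa>)
     - (\<Sum>m<M. of_real (2 * term_mellin n m) * B m \<kappa> * cos (of_real (2 * pi) * \<kappa> - of_real (pi / 2 * (real n + real m))))"
    by (simp only: add_uminus_conv_diff)
  with H show ?thesis by (simp only:)
qed

definition A_factor :: "nat \<Rightarrow> real" where
  "A_factor n = 3 * pi * (2 * pi) powr (real n / 3) / (6 powr (1 / 3) * 4 * Gamma (real (n + 1) / 3))"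

lemma A_eq_integral: "A M n \<kappa> = of_real (A_factor n) * (LINT t|lborel. indicator {0<..} t *\<^sub>R A_integrand M n \<kappa> t)"
  unfolding A_def A_factor_def set_lebesgue_integral_def ..

lemma six_powr_split: "6 powr (real (n + 1) / 3) = 6 powr (real n / 3) * 6 powr (1 / 3 :: real)"
  unfolding powr_add[symmetric] by (rule arg_cong[where f = "\<lambda>x. 6 powr x"]) simp

lemma twelve_pi_split: "(12 * pi) powr x = 6 powr x * (2 * pi) powr x"
  by (subst powr_mult[symmetric]) simp

text \<open>The case M = 0. The phases contain exactly the inverses of the factors
  \<open>exp (2 * pi * \<i> * \<kappa>)\<close> created by the Mellin transform, leaving the
  combination of line integrals that represents \<open>B n \<kappa>\<close>; the normalising
  constants multiply to 1.\<close>

lemma B_main_part: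
  assumes \<kappa>: "\<bar>Re \<kappa>\<bar> < (real n + 1) / 3"
  shows "of_real (B_prefactor n * A_factor n) * (\<i> * (phase_plus n \<kappa> * hankel_mellin n (- \<kappa>) + phase_minus n \<kappa> * hankel_mellin n \<kappa>)) = B n \<kappa>"
proof -
  define G where "G = Gamma (real (n + 1) / 3)"
  have G: "G > 0" unfolding G_def by (rule Gamma_real_pos) simp
  define L where "L = (\<lambda>\<kappa>. integral\<^sup>L lborel (line_integrand n \<kappa>))"
  have e: "exp x * exp (- x) = 1" "exp (- x) * exp x = 1" for x :: complex
    by (simp_all add: exp_minus)
  have mm: "exp (2 * of_real pi * \<i> * (- \<kappa>)) = exp (- (2 * of_real pi * \<i> * \<kappa>))" by simp
  have "phase_plus n \<kappa> * hankel_mellin n (- \<kappa>) = (exp (2 * of_real pi * \<i> * \<kappa>) * exp (- (2 * of_real pi * \<i> * \<kappa>))) * (1 / (of_real pi * \<i>) * of_real G * ((- \<i>) ^ n * L \<kappa>))"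
    unfolding phase_plus_eq hankel_mellin_def G_def L_def mm minus_minus by (simp only: mult_ac)
  then have 1: "phase_plus n \<kappa> * hankel_mellin n (- \<kappa>) = 1 / (of_real pi * \<i>) * of_real G * ((- \<i>) ^ n * L \<kappa>)"
    by (simp only: e mult_1)
  have "phase_minus n \<kappa> * hankel_mellin n \<kappa> = (exp (- (2 * of_real pi * \<i> * \<kappa>)) * exp (2 * of_real pi * \<i> * \<kappa>)) * (1 / (of_real pi * \<i>) * of_real G * (\<i> ^ n * L (- \<kappa>)))"
    unfolding phase_minus_eq hankel_mellin_def G_def L_def by (simp only: mult_ac)
  then have 2: "phase_minus n \<kappa> * hankel_mellin n \<kappa> = 1 / (of_real pi * \<i>) * of_real G * (\<i> ^ n * L (- \<kappa>))"
    by (simp only: e mult_1)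
  have "\<i> * (phase_plus n \<kappa> * hankel_mellin n (- \<kappa>) + phase_minus n \<kappa> * hankel_mellin n \<kappa>)
     = of_real (G / pi) * (\<i> ^ n * L (- \<kappa>) + (- \<i>) ^ n * L \<kappa>)"
    unfolding 1 2 by (simp add: distrib_left)
  also have "\<i> ^ n * L (- \<kappa>) + (- \<i>) ^ n * L \<kappa> = 2 * of_real (pi * 6 powr (real (n + 1) / 3)) * B n \<kappa>"
    unfolding L_def using B_eq_line_integrals[OF \<kappa>] by simp
  finally have 3: "\<i> * (phase_plus n \<kappa> * hankel_mellin n (- \<kappa>) + phase_minus n \<kappa> * hankel_mellin n \<kappa>)
     = of_real (G / pi) * (2 * of_real (pi * 6 powr (real (n + 1) / 3)) * B n \<kappa>)" .
  have "B_prefactor n * A_factor n * (G / pi * (2 * (pi * 6 powr (real (n + 1) / 3)))) = 1"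
    unfolding B_prefactor_def A_factor_def G_def[symmetric] six_powr_split twelve_pi_split
    using G by (simp add: field_simps)
  then have "complex_of_real (B_prefactor n * A_factor n * (G / pi * (2 * (pi * 6 powr (real (n + 1) / 3))))) = 1" by simp
  then have "of_real (B_prefactor n * A_factor n) * (of_real (G / pi) * (2 * of_real (pi * 6 powr (real (n + 1) / 3)))) = (1 :: complex)"
    by (simp only: of_real_mult of_real_numeral)
  then show ?thesis unfolding 3 by (simp only: mult.assoc[symmetric]) (simp only: mult_1)
qed

text \<open>The powers of 2 \<pi> with exponents n / 3 and - (n - m) / 3 leave exponent m / 3, and
  dividing by the cube root of 6 leaves 6 to the m / 3; together they are the power of 12 \<pi> in
  \<open>B_term\<close>.\<close>

lemma A_term_part:
  "of_real (A_factor n) * (of_real (2 * term_mellin n m) * B m \<kappa> * cos (of_real (2 * pi) * \<kappa> - of_real (pi / 2 * (real n + real m))))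
    = B_term n \<kappa> m"
proof -
  define G where "G = Gamma (real (n + 1) / 3)"
  have G: "G > 0" unfolding G_def by (rule Gamma_real_pos) simp
  have p: "(2 * pi) powr (- ((real n - real m) / 3)) = (2 * pi) powr (real m / 3) / (2 * pi) powr (real n / 3)"
    unfolding powr_diff[symmetric] by (rule arg_cong[where f = "\<lambda>x. (2 * pi) powr x"]) (simp add: field_simps)
  have "A_factor n * (2 * term_mellin n m) = (12 * pi) powr (real m / 3) * sin (real (m + 1) * pi / 3) * Gamma (real (m + 1) / 3) * Gamma_ratio n m"
    unfolding A_factor_def term_mellin_def Gamma_ratio_def G_def[symmetric] six_powr_split twelve_pi_split p
    using G by (simp add: field_simps)
  then have "of_real (A_factor n) * of_real (2 * term_mellin n m) = complex_of_real ((12 * pi) powr (real m / 3) * sin (real (m + 1) * pi / 3) * Gamma (real (m + 1) / 3) * Gamma_ratio n m)"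
    by (metis of_real_mult)
  then have "of_real (A_factor n) * (of_real (2 * term_mellin n m) * B m \<kappa> * x) = complex_of_real ((12 * pi) powr (real m / 3) * sin (real (m + 1) * pi / 3) * Gamma (real (m + 1) / 3) * Gamma_ratio n m) * (B m \<kappa> * x)" for x
    by (simp only: mult.assoc[symmetric])
  note eq = this
  show ?thesis unfolding B_term_def eq by (simp only: of_real_mult mult_ac)
qed

text \<open>The integral in \<open>A\<close> contributes each term once with a minus sign, so the
  explicit sum cancels and the identity for M = 0 remains.\<close>

lemma B_eq_terms_plus_A:
  assumes n: "M < n" and \<kappa>: "\<bar>Re \<kappa>\<bar> < (real M + 1) / 3"
  shows "B n \<kappa> = of_real (B_prefactor n) * ((\<Sum>m<M. B_term n \<kappa> m) + A M n \<kappa>)"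
proof -
  define X where "X = \<i> * (phase_plus n \<kappa> * hankel_mellin n (- \<kappa>) + phase_minus n \<kappa> * hankel_mellin n \<kappa>)"
  have "A M n \<kappa> = of_real (A_factor n) * X - (\<Sum>m<M. B_term n \<kappa> m)"
    unfolding A_eq_integral has_bochner_integral_integral_eq[OF A_integrand_integral[OF n \<kappa>]] X_def[symmetric]
      right_diff_distrib sum_distrib_left A_term_part ..
  then have "of_real (B_prefactor n) * ((\<Sum>m<M. B_term n \<kappa> m) + A M n \<kappa>) = of_real (B_prefactor n * A_factor n) * X"
    by simp
  also have "\<dots> = B n \<kappa>" unfolding X_def using n \<kappa> by (intro B_main_part) simp
  finally show ?thesis by simp
qed

text \<open>The pointwise bound by \<open>t powr (- \<alpha>)\<close> turns the integral into a
  Gamma integral with parameter (n - M) / 3. The n-dependent power of 2 \<pi> cancels against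
  \<open>A_factor\<close>, so the constant is uniform in \<open>n\<close>.\<close>

lemma A_bound:
  assumes \<kappa>: "\<bar>Re \<kappa>\<bar> < (real M + 1) / 3"
  shows "\<exists>C. \<forall>n>M. norm (A M n \<kappa>) \<le> C * Gamma_ratio n M"
proof -
  define \<alpha> where "\<alpha> = real (M + 1) / 3"
  have \<kappa>': "\<bar>Re (- \<kappa>)\<bar> < (real M + 1) / 3" using \<kappa> by simp
  obtain C1 where C1: "C1 \<ge> 0" "\<And>t. t > 0 \<Longrightarrow> norm (hankel_remainder M \<kappa> t) \<le> C1 * t powr (- \<alpha>)"
    using hankel_remainder_bound[OF \<kappa>] unfolding \<alpha>_def by blast
  obtain C2 where C2: "C2 \<ge> 0" "\<And>t. t > 0 \<Longrightarrow> norm (hankel_remainder M (- \<kappa>) t) \<le> C2 * t powr (- \<alpha>)"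
    using hankel_remainder_bound[OF \<kappa>'] unfolding \<alpha>_def by blast
  \<comment> \<open>The integer \<open>n\<close> enters the phases through a real shift only, so
    their norms are bounded by this number for all \<open>n\<close>.\<close>
  define E where "E = exp (2 * pi * \<bar>Im \<kappa>\<bar>)"
  have ph: "norm (phase_plus n \<kappa>) \<le> E" "norm (phase_minus n \<kappa>) \<le> E" for n
    unfolding phase_plus_def phase_minus_def E_def norm_exp_eq_Re by (auto simp: abs_if)
  have E0: "0 \<le> E" by (simp add: E_def)
  define K where "K = E * C2 + E * C1"
  have bound: "norm (A M n \<kappa>) \<le> (3 * pi / (6 powr (1 / 3) * 4) * (2 * pi) powr (real M / 3) * K) * Gamma_ratio n M" if n: "M < n" for n
  proof -
    define b where "b = (real n - real M) / 3"
    have b: "b > 0" using n by (simp add: b_def)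
    have H: "has_bochner_integral lborel (\<lambda>t. K * Re (indicator {0<..} t *\<^sub>R (of_real t powr (of_real b - 1) * exp (- of_real (2 * pi * t)))))
       (K * Re (Gamma (of_real b) * of_real (2 * pi) powr (- of_real b)))"
      by (intro has_bochner_integral_mult_right has_bochner_integral_Re gamma_integral_scaled_pos) (use b in auto)
    have int: "integrable lborel (\<lambda>t. indicator {0<..} t *\<^sub>R A_integrand M n \<kappa> t)"
      using A_integrand_integral[OF n \<kappa>] by (rule integrable.intros)
    have "norm (LINT t|lborel. indicator {0<..} t *\<^sub>R A_integrand M n \<kappa> t) \<le> (LINT t|lborel. norm (indicator {0<..} t *\<^sub>R A_integrand M n \<kappa> t))"
      by (rule integral_norm_bound)
    also have "\<dots> \<le> (LINT t|lborel. K * Re (indicator {0<..} t *\<^sub>R (of_real t powr (of_real b - 1) * exp (- of_real (2 * pi * t)))))"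
    proof (rule integral_mono_AE)
      show "integrable lborel (\<lambda>t. norm (indicator {0<..} t *\<^sub>R A_integrand M n \<kappa> t))" using int by (rule integrable_norm)
      show "integrable lborel (\<lambda>t. K * Re (indicator {0<..} t *\<^sub>R (of_real t powr (of_real b - 1) * exp (- of_real (2 * pi * t)))))"
        using H by (rule integrable.intros)
      have "AE t in lborel. t \<noteq> Im \<kappa>" "AE t in lborel. t \<noteq> - Im \<kappa>" by (rule AE_lborel_singleton)+
      then show "AE t in lborel. norm (indicator {0<..} t *\<^sub>R A_integrand M n \<kappa> t) \<le> K * Re (indicator {0<..} t *\<^sub>R (of_real t powr (of_real b - 1) * exp (- of_real (2 * pi * t))))"
      proof eventually_elim
        case (elim t)
        show ?case
        proof (cases "t > 0")
          case True
          define w where "w = t powr ((real n - 2) / 3) * exp (- 2 * pi * t)"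
          have w: "w \<ge> 0" by (simp add: w_def)
          have "indicator {0<..} t *\<^sub>R A_integrand M n \<kappa> t = \<i> * (phase_plus n \<kappa> * (of_real w * hankel_remainder M (- \<kappa>) t) + phase_minus n \<kappa> * (of_real w * hankel_remainder M \<kappa> t))"
            unfolding A_integrand_eq[OF elim] w_def using True by simp
          also have "norm \<dots> \<le> E * (w * (C2 * t powr (- \<alpha>))) + E * (w * (C1 * t powr (- \<alpha>)))"
            unfolding norm_mult[of \<i>] norm_ii mult_1
          proof (rule norm_triangle_mono)
            show "norm (phase_plus n \<kappa> * (of_real w * hankel_remainder M (- \<kappa>) t)) \<le> E * (w * (C2 * t powr (- \<alpha>)))"
              unfolding norm_mult norm_of_real using C2(2)[OF True] ph[of n] w E0 by (intro mult_mono) auto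
            show "norm (phase_minus n \<kappa> * (of_real w * hankel_remainder M \<kappa> t)) \<le> E * (w * (C1 * t powr (- \<alpha>)))"
              unfolding norm_mult norm_of_real using C1(2)[OF True] ph[of n] w E0 by (intro mult_mono) auto
          qed
          also have "\<dots> = K * (w * t powr (- \<alpha>))" by (simp add: K_def algebra_simps)
          also have "w * t powr (- \<alpha>) = t powr (b - 1) * exp (- 2 * pi * t)"
          proof -
            have "b - 1 = (real n - 2) / 3 + - \<alpha>" by (simp add: b_def \<alpha>_def field_simps)
            then have "t powr (b - 1) = t powr ((real n - 2) / 3) * t powr (- \<alpha>)" by (simp only: powr_add)
            then show ?thesis unfolding w_def by simp
          qed
          also have "\<dots> = Re (indicator {0<..} t *\<^sub>R (of_real t powr (of_real b - 1) * exp (- of_real (2 * pi * t))))"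
          proof -
            have 1: "of_real t powr (of_real b - 1) = complex_of_real (t powr (b - 1))"
              using True powr_of_real[of t "b - 1"] by simp
            have 2: "exp (- of_real (2 * pi * t)) = complex_of_real (exp (- 2 * pi * t))"
              unfolding exp_of_real[symmetric] by simp
            show ?thesis unfolding 1 2 of_real_mult[symmetric] using True by simp
          qed
          finally show ?thesis .
        qed simp
      qed
    qed
    also have "\<dots> = K * Re (Gamma (of_real b) * of_real (2 * pi) powr (- of_real b))"
      using H by (rule has_bochner_integral_integral_eq)
    also have "Gamma (of_real b) * of_real (2 * pi) powr (- of_real b) = complex_of_real (Gamma b * (2 * pi) powr (- b))"
      unfolding Gamma_complex_of_real using powr_of_real[of "2 * pi" "- b"] by simp
    finally have I: "norm (LINT t|lborel. indicator {0<..} t *\<^sub>R A_integrand M n \<kappa> t) \<le> K * (Gamma b * (2 * pi) powr (- b))"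
      by (simp only: Re_complex_of_real)
    define G where "G = Gamma (real (n + 1) / 3)"
    have G: "G > 0" unfolding G_def by (rule Gamma_real_pos) simp
    have F: "A_factor n \<ge> 0" unfolding A_factor_def G_def[symmetric] using G by simp
    have "norm (A M n \<kappa>) = A_factor n * norm (LINT t|lborel. indicator {0<..} t *\<^sub>R A_integrand M n \<kappa> t)"
      unfolding A_eq_integral norm_mult norm_of_real using F by simp
    also have "\<dots> \<le> A_factor n * (K * (Gamma b * (2 * pi) powr (- b)))"
      using I F by (rule mult_left_mono)
    also have "\<dots> = (3 * pi / (6 powr (1 / 3) * 4) * (2 * pi) powr (real M / 3) * K) * Gamma_ratio n M"
    proof -
      have p: "(2 * pi) powr (- b) = (2 * pi) powr (real M / 3) / (2 * pi) powr (real n / 3)"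
        unfolding powr_diff[symmetric] b_def by (rule arg_cong[where f = "\<lambda>x. (2 * pi) powr x"]) (simp add: field_simps)
      show ?thesis unfolding A_factor_def Gamma_ratio_def G_def[symmetric] b_def[symmetric] p using G by (simp add: field_simps)
    qed
    finally show ?thesis .
  qed
  then show ?thesis by blast
qed

section \<open>The expansion for arbitrary \<kappa>\<close>

lemma Gamma_ratio_nonneg: "m < n \<Longrightarrow> Gamma_ratio n m \<ge> 0"
  unfolding Gamma_ratio_def by (intro divide_nonneg_nonneg less_imp_le Gamma_real_pos) auto

text \<open>The condition \<open>m + 6 \<le> n\<close> puts the smaller argument (n - m) / 3 at 2 or
  beyond, where Gamma is monotone.\<close>

lemma Gamma_ratio_antimono:
  assumes "M \<le> m" "m + 6 \<le> n"
  shows "Gamma_ratio n m \<le> Gamma_ratio n M"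
  unfolding Gamma_ratio_def
proof (rule divide_right_mono)
  show "Gamma ((real n - real m) / 3) \<le> Gamma ((real n - real M) / 3)"
    using assms by (intro Gamma_real_mono_ge_2) auto
  show "0 \<le> Gamma (real (n + 1) / 3)" by (intro less_imp_le Gamma_real_pos) simp
qed

text \<open>The cosine has argument 2 \<pi> \<kappa> shifted by a real number, so it is bounded by
  \<open>exp (2 * pi * \<bar>Im \<kappa>\<bar>)\<close> uniformly in \<open>n\<close>.\<close>

lemma B_term_bound:
  "\<exists>C. \<forall>n>m. norm (B_term n \<kappa> m) \<le> C * Gamma_ratio n m"
proof -
  define c where "c = norm (of_real ((12 * pi) powr (real m / 3)) * B m \<kappa>
     * of_real (sin (real (m + 1) * pi / 3)) * of_real (Gamma (real (m + 1) / 3)))"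
  have "norm (cos (of_real (2 * pi) * \<kappa> - of_real (pi / 2 * (real n + real m)))) \<le> exp (2 * pi * \<bar>Im \<kappa>\<bar>)" for n
  proof -
    have "norm (cos w) \<le> exp \<bar>Im w\<bar>" for w :: complex
    proof -
      have "norm (cos w) \<le> (norm (exp (\<i> * w)) + norm (exp (- (\<i> * w)))) / 2"
        unfolding cos_exp_eq using norm_triangle_ineq[of "exp (\<i> * w)" "exp (- (\<i> * w))"] by (simp add: norm_divide)
      also have "\<dots> \<le> (exp \<bar>Im w\<bar> + exp \<bar>Im w\<bar>) / 2"
        by (intro divide_right_mono add_mono) auto
      finally show ?thesis by simp
    qed
    from this[of "of_real (2 * pi) * \<kappa> - of_real (pi / 2 * (real n + real m))"]
    show ?thesis by (simp add: abs_mult)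
  qed
  then have "norm (B_term n \<kappa> m) \<le> c * exp (2 * pi * \<bar>Im \<kappa>\<bar>) * Gamma_ratio n m" if "n > m" for n
  proof -
    have "norm (B_term n \<kappa> m) = c * Gamma_ratio n m * norm (cos (of_real (2 * pi) * \<kappa> - of_real (pi / 2 * (real n + real m))))"
      unfolding B_term_def c_def norm_mult[of _ "cos _"] norm_mult[of _ "of_real (Gamma_ratio n m)"]
      using Gamma_ratio_nonneg[OF that] by simp
    also have "\<dots> \<le> c * Gamma_ratio n m * exp (2 * pi * \<bar>Im \<kappa>\<bar>)"
      using Gamma_ratio_nonneg[OF that] \<open>\<And>n. norm (cos _) \<le> _\<close> by (intro mult_left_mono mult_nonneg_nonneg) (auto simp: c_def)
    finally show ?thesis by (simp add: mult_ac)
  qed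
  then show ?thesis by blast
qed

lemma B_expansion_bound:
  "(\<lambda>n. B n \<kappa> - of_real (B_prefactor n) * (\<Sum>m<M. B_term n \<kappa> m))
     \<in> O(\<lambda>n. of_real ((12 * pi) powr (- real n / 3) * Gamma_ratio n M))"
proof -
  \<comment> \<open>Raising M to at least 3 \<bar>Re \<kappa>\<bar> makes the exact formula
    applicable to the given \<kappa>. The surplus terms and the remainder for \<open>N\<close> are
    of order \<open>Gamma_ratio n m\<close> with \<open>M \<le> m \<le> N\<close>, hence at most a
    constant times \<open>Gamma_ratio n M\<close> once \<open>n \<ge> N + 6\<close>.\<close>
  define N where "N = max M (nat \<lceil>3 * \<bar>Re \<kappa>\<bar>\<rceil>)"
  have "3 * \<bar>Re \<kappa>\<bar> \<le> real (nat \<lceil>3 * \<bar>Re \<kappa>\<bar>\<rceil>)" by linarith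
  also have "\<dots> \<le> real N" by (simp add: N_def)
  finally have \<kappa>: "\<bar>Re \<kappa>\<bar> < (real N + 1) / 3" by simp
  have MN: "M \<le> N" by (simp add: N_def)
  obtain C where C: "\<And>n. n > N \<Longrightarrow> norm (A N n \<kappa>) \<le> C * Gamma_ratio n N" using A_bound[OF \<kappa>] by blast
  obtain D where D: "\<And>m n. n > m \<Longrightarrow> norm (B_term n \<kappa> m) \<le> D m * Gamma_ratio n m"
    using B_term_bound[of _ \<kappa>] by metis
  define K where "K = (\<Sum>m\<in>{M..<N}. \<bar>D m\<bar>) + \<bar>C\<bar>"
  have "norm (B n \<kappa> - of_real (B_prefactor n) * (\<Sum>m<M. B_term n \<kappa> m))
     \<le> (2 / (3 * pi) * K) * norm (complex_of_real ((12 * pi) powr (- real n / 3) * Gamma_ratio n M))" if n: "n \<ge> N + 6" for n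
  proof -
    have g: "Gamma_ratio n m \<le> Gamma_ratio n M" if "M \<le> m" "m \<le> N" for m
      using that n by (intro Gamma_ratio_antimono) auto
    have g0: "Gamma_ratio n m \<ge> 0" if "m \<le> N" for m using that n by (intro Gamma_ratio_nonneg) auto
    have sp: "{..<N} = {..<M} \<union> {M..<N}" using MN by auto
    have s: "(\<Sum>m<N. B_term n \<kappa> m) = (\<Sum>m<M. B_term n \<kappa> m) + (\<Sum>m\<in>{M..<N}. B_term n \<kappa> m)"
      unfolding sp by (rule sum.union_disjoint) auto
    have "B n \<kappa> = of_real (B_prefactor n) * ((\<Sum>m<N. B_term n \<kappa> m) + A N n \<kappa>)"
      using n by (intro B_eq_terms_plus_A \<kappa>) simp
    then have eq: "B n \<kappa> - of_real (B_prefactor n) * (\<Sum>m<M. B_term n \<kappa> m) = of_real (B_prefactor n) * ((\<Sum>m\<in>{M..<N}. B_term n \<kappa> m) + A N n \<kappa>)"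
      unfolding s by (simp add: algebra_simps)
    have "norm ((\<Sum>m\<in>{M..<N}. B_term n \<kappa> m) + A N n \<kappa>) \<le> (\<Sum>m\<in>{M..<N}. \<bar>D m\<bar> * Gamma_ratio n M) + \<bar>C\<bar> * Gamma_ratio n M"
    proof (intro norm_triangle_mono order_trans[OF norm_sum] sum_mono)
      fix m assume m: "m \<in> {M..<N}"
      have "norm (B_term n \<kappa> m) \<le> D m * Gamma_ratio n m" using m n by (intro D) auto
      also have "\<dots> \<le> \<bar>D m\<bar> * Gamma_ratio n M" using m g[of m] g0[of m] by (intro mult_mono) auto
      finally show "norm (B_term n \<kappa> m) \<le> \<bar>D m\<bar> * Gamma_ratio n M" .
    next
      have "norm (A N n \<kappa>) \<le> C * Gamma_ratio n N" using n by (intro C) auto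
      also have "\<dots> \<le> \<bar>C\<bar> * Gamma_ratio n M" using g[of N] g0[of N] MN by (intro mult_mono) auto
      finally show "norm (A N n \<kappa>) \<le> \<bar>C\<bar> * Gamma_ratio n M" .
    qed
    also have "\<dots> = K * Gamma_ratio n M" by (simp add: K_def distrib_right sum_distrib_right)
    finally have 1: "norm ((\<Sum>m\<in>{M..<N}. B_term n \<kappa> m) + A N n \<kappa>) \<le> K * Gamma_ratio n M" .
    have pre: "B_prefactor n = 2 / (3 * pi) * (12 * pi) powr (- real n / 3)"
      unfolding B_prefactor_def using powr_minus_divide[of "12 * pi" "real n / 3"] by simp
    have "norm (of_real (B_prefactor n) * ((\<Sum>m\<in>{M..<N}. B_term n \<kappa> m) + A N n \<kappa>)) = B_prefactor n * norm ((\<Sum>m\<in>{M..<N}. B_term n \<kappa> m) + A N n \<kappa>)"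
      unfolding norm_mult norm_of_real pre by simp
    also have "\<dots> \<le> B_prefactor n * (K * Gamma_ratio n M)" using 1 by (intro mult_left_mono) (simp_all add: pre)
    also have "\<dots> = (2 / (3 * pi) * K) * norm (complex_of_real ((12 * pi) powr (- real n / 3) * Gamma_ratio n M))"
      unfolding norm_of_real abs_mult using g0[OF MN] by (simp add: pre)
    finally show ?thesis unfolding eq .
  qed
  then show ?thesis by (intro bigoI[where c = "2 / (3 * pi) * K"]) (auto simp: eventually_at_top_linorder)
qed

text \<open>The integrability clause ensures that \<open>A\<close> is a genuine integral, since a
  set integral of a non-integrable function is 0 by default. The asymptotic series is rendered by
  its meaning: one error bound for each truncation M, with \<kappa> arbitrary.\<close>

theorem mainTheorem4:
  shows "(\<forall>(n::nat) (M::nat) (\<kappa>::complex).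
            1 \<le> n \<longrightarrow> M \<le> n - 1 \<longrightarrow> \<bar>Re \<kappa>\<bar> < (real M + 1) / 3 \<longrightarrow>
              set_integrable lborel {0<..} (A_integrand M n \<kappa>) \<and>
              B n \<kappa> = of_real (B_prefactor n) * ((\<Sum>m<M. B_term n \<kappa> m) + A M n \<kappa>))
       \<and> (\<forall>(M::nat) (\<kappa>::complex).
            \<bar>Re \<kappa>\<bar> < (real M + 1) / 3 \<longrightarrow>
              (\<lambda>n. A M n \<kappa>) \<in> O(\<lambda>n. of_real (Gamma_ratio n M)))
       \<and> (\<forall>(M::nat) (\<kappa>::complex).
            (\<lambda>n. B n \<kappa> - of_real (B_prefactor n) * (\<Sum>m<M. B_term n \<kappa> m))
              \<in> O(\<lambda>n. of_real ((12 * pi) powr (- real n / 3) * Gamma_ratio n M)))"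
proof (intro conjI allI impI)
  fix n M :: nat and \<kappa> :: complex
  assume "1 \<le> n" "M \<le> n - 1" and \<kappa>: "\<bar>Re \<kappa>\<bar> < (real M + 1) / 3"
  \<comment> \<open>Subtraction of naturals truncates at 0; \<open>1 \<le> n\<close> makes
    \<open>M \<le> n - 1\<close> equivalent to this.\<close>
  then have n: "M < n" by simp
  show "set_integrable lborel {0<..} (A_integrand M n \<kappa>)"
    unfolding set_integrable_def using A_integrand_integral[OF n \<kappa>] by (rule integrable.intros)
  show "B n \<kappa> = of_real (B_prefactor n) * ((\<Sum>m<M. B_term n \<kappa> m) + A M n \<kappa>)"
    by (rule B_eq_terms_plus_A[OF n \<kappa>])
next
  fix M :: nat and \<kappa> :: complex
  assume \<kappa>: "\<bar>Re \<kappa>\<bar> < (real M + 1) / 3"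
  obtain C where C: "\<And>n. n > M \<Longrightarrow> norm (A M n \<kappa>) \<le> C * Gamma_ratio n M" using A_bound[OF \<kappa>] by blast
  have "eventually (\<lambda>n. norm (A M n \<kappa>) \<le> C * norm (complex_of_real (Gamma_ratio n M))) at_top"
    using eventually_gt_at_top[of M]
  proof eventually_elim
    case (elim n)
    then show ?case using C[OF elim] Gamma_ratio_nonneg[OF elim] by simp
  qed
  then show "(\<lambda>n. A M n \<kappa>) \<in> O(\<lambda>n. of_real (Gamma_ratio n M))" by (rule bigoI)
next
  fix M :: nat and \<kappa> :: complex
  show "(\<lambda>n. B n \<kappa> - of_real (B_prefactor n) * (\<Sum>m<M. B_term n \<kappa> m))
     \<in> O(\<lambda>n. of_real ((12 * pi) powr (- real n / 3) * Gamma_ratio n M))"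
    by (rule B_expansion_bound)
qed

end
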